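(* Let $(R,\mathfrak m)$ be a Noetherian local ring of dimension $d\ge1$ and let $\boldsymbol{\mathcal I}=(\mathcal I^{(1)},\ldots,\mathcal I^{(s)})$, $\mathcal I^{(i)}=\{I^{(i)}_n\}_{n\ge0}$, be graded $\mathfrak m$-primary families. Assume that $R/\mathfrak m$ is infinite and that $\boldsymbol{\mathcal I}$ is multigraded admissible with respect to $\mathbf J=(J_1,\ldots,J_s)$. Let $\mathbf r=(r_1,\ldots,r_s)\in\mathbb N^s$ satisfy $r_1+\cdots+r_s=d$, and prescribe positive integers $a_{ij}$ for $1\leq i\leq s$ and $1\leq j\leq r_i$. Then there exist elements $y_{ij}\in J_i^{a_{ij}}\subseteq I_{a_{ij}}^{(i)}$ forming a strong homogeneous joint reduction of $\boldsymbol{\mathcal I}$ of type $\mathbf r$ with homogeneous degrees $a_{ij}$.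
   Context: $\mathbb N$ includes $0$; $\mathbf e_i$ is the $i$-th unit vector; "$\mathbf n\gg\mathbf 0$" means: for all $\mathbf n\geq\mathbf n_0$ componentwise, for some $\mathbf n_0\in\mathbb N^s$. A graded $\mathfrak m$-primary family is a family $\mathcal I=\{I_n\}_{n\ge0}$ of ideals with $I_0=R$, $I_n$ $\mathfrak m$-primary for $n>0$, and $I_mI_n\subseteq I_{m+n}$. Multigraded admissibility: put $\mathcal F(\mathbf n)=I^{(1)}_{n_1}\cdots I^{(s)}_{n_s}$ for $\mathbf n\in\mathbb N^s$ and extend to $\mathbf n\in\mathbb Z^s$ by $\mathcal F(\mathbf n)=\mathcal F(\mathbf n^+)$, $\mathbf n^+=(\max\{n_1,0\},\ldots,\max\{n_s,0\})$. The collection is multigraded admissible with respect to a tuple $\mathbf J=(J_1,\ldots,J_s)$ of $\mathfrak m$-primary ideals if for all $\mathbf m,\mathbf n\in\mathbb Z^s$: (1) $J_1^{n_1}\cdots J_s^{n_s}\subseteq\mathcal F(\mathbf n)$ (with $J_i^{n_i}=R$ if $n_i\le0$); (2) $\mathcal F(\mathbf n)\mathcal F(\mathbf m)\subseteq\mathcal F(\mathbf n+\mathbf m)$; (3) $\mathbf m\ge\mathbf n$ implies $\mathcal F(\mathbf m)\subseteq\mathcal F(\mathbf n)$; (4) $\bigoplus_{\mathbf n\in\mathbb Z^s}\mathcal F(\mathbf n)\mathbf t^{\mathbf n}$ is a finite module over $R[J_1t_1,\ldots,J_st_s,t_1^{-1},\ldots,t_s^{-1}]$. Strong homogeneous joint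 reduction of type $\mathbf r$ with homogeneous degrees $a_{ij}\ge1$: elements $y_{ij}\in I^{(i)}_{a_{ij}}$ ($1\le i\le s$, $1\le j\le r_i$) with $\mathcal F(\mathbf n)=\sum_{i,j}y_{ij}\mathcal F(\mathbf n-a_{ij}\mathbf e_i)$ for all $\mathbf n\gg\mathbf 0$. *)

theory Defs
  imports
    "HOL-Algebra.Ideal_Product"
    "HOL-Algebra.Generated_Rings"
    "HOL-Algebra.Ring_Divisibility"
    "HOL-Algebra.QuotRing"
    "HOL-Library.Extended_Nat"
    "HOL-Library.Function_Algebras"
begin

section \<open>Noetherian local rings\<close>

definition noetherian_local_ring :: "('a, 'b) ring_scheme \<Rightarrow> 'a set \<Rightarrow> bool" where
  "noetherian_local_ring R m \<longleftrightarrow>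
     cring R \<and> noetherian_ring R \<and> maximalideal m R \<and> (\<forall>n. maximalideal n R \<longrightarrow> n = m)"

definition krull_dim :: "('a, 'b) ring_scheme \<Rightarrow> enat" where
  "krull_dim R =
     (SUP n \<in> {n. \<exists>P. (\<forall>i\<le>n. primeideal (P i) R) \<and> (\<forall>i<n. P i \<subset> P (Suc i))}. enat n)"

definition radical :: "('a, 'b) ring_scheme \<Rightarrow> 'a set \<Rightarrow> 'a set" where
  "radical R Q = {x \<in> carrier R. \<exists>k::nat. x [^]\<^bsub>R\<^esub> k \<in> Q}"

definition primary_ideal :: "('a, 'b) ring_scheme \<Rightarrow> 'a set \<Rightarrow> bool" where
  "primary_ideal R Q \<longleftrightarrow> ideal Q R \<and> Q \<noteq> carrier R \<and>
     (\<forall>x \<in> carrier R. \<forall>y \<in> carrier R. x \<otimes>\<^bsub>R\<^esub> y \<in> Q \<longrightarrow> x \<in> Q \<or> y \<in> radical R Q)"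

definition m_primary :: "('a, 'b) ring_scheme \<Rightarrow> 'a set \<Rightarrow> 'a set \<Rightarrow> bool" where
  "m_primary R m Q \<longleftrightarrow> primary_ideal R Q \<and> radical R Q = m"

section \<open>Graded families\<close>

definition graded_primary_family ::
    "('a, 'b) ring_scheme \<Rightarrow> 'a set \<Rightarrow> (nat \<Rightarrow> 'a set) \<Rightarrow> bool" where
  "graded_primary_family R m I \<longleftrightarrow>
     I 0 = carrier R \<and> (\<forall>n>0. m_primary R m (I n)) \<and>
     (\<forall>k n. I k \<cdot>\<^bsub>R\<^esub> I n \<subseteq> I (k + n))"

text \<open>
  A finite index type \<open>'s\<close> replaces the index set \<open>{1, \<dots>, s}\<close>. Products and powers of ideals
  are taken in the commutative monoid \<^term>\<open>ideals_set R\<close>, whose unit is \<^term>\<open>carrier R\<close>.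
  The truncation \<open>n\<^sup>+\<close> is the conversion \<^const>\<open>nat\<close>, which sends negative integers to \<open>0\<close>.
\<close>

definition multi_filtration ::
    "('a, 'b) ring_scheme \<Rightarrow> ('s::finite \<Rightarrow> nat \<Rightarrow> 'a set) \<Rightarrow> ('s \<Rightarrow> int) \<Rightarrow> 'a set" where
  "multi_filtration R I n = finprod (ideals_set R) (\<lambda>i. I i (nat (n i))) UNIV"

definition multi_power ::
    "('a, 'b) ring_scheme \<Rightarrow> ('s::finite \<Rightarrow> 'a set) \<Rightarrow> ('s \<Rightarrow> int) \<Rightarrow> 'a set" where
  "multi_power R J n = finprod (ideals_set R) (\<lambda>i. J i [^]\<^bsub>ideals_set R\<^esub> nat (n i)) UNIV"

section \<open>Multigraded Laurent polynomials and Rees algebras\<close>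

definition unit_exponent :: "'s \<Rightarrow> 's \<Rightarrow> int" where
  "unit_exponent i = (\<lambda>k. if k = i then 1 else 0)"

text \<open>
  The ring of Laurent polynomials over \<open>R\<close> in variables \<open>t\<^sub>i\<close> indexed by \<open>'s\<close>: the function \<open>f\<close>
  stands for the sum of all \<open>f n t\<^sup>n\<close>.
\<close>

definition laurent_ring :: "('a, 'b) ring_scheme \<Rightarrow> (('s::finite \<Rightarrow> int) \<Rightarrow> 'a) ring" where
  "laurent_ring R =
     \<lparr> carrier = {f. (\<forall>n. f n \<in> carrier R) \<and> finite {n. f n \<noteq> \<zero>\<^bsub>R\<^esub>}},
       monoid.mult = (\<lambda>f g n. finsum R (\<lambda>k. f k \<otimes>\<^bsub>R\<^esub> g (n - k)) {k. f k \<noteq> \<zero>\<^bsub>R\<^esub>}),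
       one = (\<lambda>n. if n = 0 then \<one>\<^bsub>R\<^esub> else \<zero>\<^bsub>R\<^esub>),
       zero = (\<lambda>n. \<zero>\<^bsub>R\<^esub>),
       add = (\<lambda>f g n. f n \<oplus>\<^bsub>R\<^esub> g n) \<rparr>"

lemma (in abelian_monoid) finsum_swap:
  assumes "finite A" "finite B" "\<And>x y. x \<in> A \<Longrightarrow> y \<in> B \<Longrightarrow> f x y \<in> carrier G"
  shows "finsum G (\<lambda>x. finsum G (f x) B) A = finsum G (\<lambda>y. finsum G (\<lambda>x. f x y) A) B"
  using assms(1,3)
proof (induction A rule: finite_induct)
  case empty
  then show ?case by (simp add: finsum_zero)
next
  case (insert a A)
  have "finsum G (\<lambda>x. finsum G (f x) B) (insert a A)
      = finsum G (f a) B \<oplus> finsum G (\<lambda>x. finsum G (f x) B) A"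
    using insert by (intro finsum_insert) (auto intro!: finsum_closed)
  also have "\<dots> = finsum G (f a) B \<oplus> finsum G (\<lambda>y. finsum G (\<lambda>x. f x y) A) B"
    using insert by simp
  also have "\<dots> = finsum G (\<lambda>y. f a y \<oplus> finsum G (\<lambda>x. f x y) A) B"
    using insert by (intro finsum_addf[symmetric]) (auto intro!: finsum_closed)
  also have "\<dots> = finsum G (\<lambda>y. finsum G (\<lambda>x. f x y) (insert a A)) B"
    using insert by (intro finsum_cong') (auto intro!: finsum_closed simp: Pi_def)
  finally show ?case .
qed

lemma laurent_ring_cring:
  fixes R :: "('a, 'b) ring_scheme"
  assumes "cring R"
  shows "cring (laurent_ring R :: (('s::finite \<Rightarrow> int) \<Rightarrow> 'a) ring)"
proof -
  interpret cring R by fact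
  define L where "L = (laurent_ring R :: (('s \<Rightarrow> int) \<Rightarrow> 'a) ring)"
  let ?s = "\<lambda>f :: ('s \<Rightarrow> int) \<Rightarrow> 'a. {n. f n \<noteq> \<zero>\<^bsub>R\<^esub>}"
  have carr: "f \<in> carrier L \<longleftrightarrow> (\<forall>n. f n \<in> carrier R) \<and> finite (?s f)" for f
    by (simp add: L_def laurent_ring_def)
  have mulS: "(f \<otimes>\<^bsub>L\<^esub> g) n = finsum R (\<lambda>k. f k \<otimes>\<^bsub>R\<^esub> g (n - k)) S"
    if "f \<in> carrier L" "g \<in> carrier L" "finite S" "?s f \<subseteq> S" for f g n S
  proof -
    have "finsum R (\<lambda>k. f k \<otimes>\<^bsub>R\<^esub> g (n - k)) (?s f) = finsum R (\<lambda>k. f k \<otimes>\<^bsub>R\<^esub> g (n - k)) S"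
      using that by (intro add.finprod_mono_neutral_cong_left) (auto simp: carr)
    then show ?thesis by (simp add: L_def laurent_ring_def)
  qed
  have add: "(f \<oplus>\<^bsub>L\<^esub> g) n = f n \<oplus>\<^bsub>R\<^esub> g n" for f g n
    by (simp add: L_def laurent_ring_def)
  have zero: "\<zero>\<^bsub>L\<^esub> n = \<zero>\<^bsub>R\<^esub>" for n by (simp add: L_def laurent_ring_def)
  have one: "\<one>\<^bsub>L\<^esub> n = (if n = 0 then \<one>\<^bsub>R\<^esub> else \<zero>\<^bsub>R\<^esub>)" for n by (simp add: L_def laurent_ring_def)
  have mulc: "f \<otimes>\<^bsub>L\<^esub> g \<in> carrier L" if fg: "f \<in> carrier L" "g \<in> carrier L" for f g
  proof -
    have 1: "(f \<otimes>\<^bsub>L\<^esub> g) n \<in> carrier R" for n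
      using fg by (subst mulS[OF fg _ order_refl]) (auto simp: carr intro!: finsum_closed)
    have "n \<in> (\<lambda>(k,l). k + l) ` (?s f \<times> ?s g)" if "(f \<otimes>\<^bsub>L\<^esub> g) n \<noteq> \<zero>\<^bsub>R\<^esub>" for n
    proof (rule ccontr)
      assume c: "n \<notin> (\<lambda>(k,l). k + l) ` (?s f \<times> ?s g)"
      have "g (n - k) = \<zero>\<^bsub>R\<^esub>" if "f k \<noteq> \<zero>\<^bsub>R\<^esub>" for k
      proof (rule ccontr)
        assume "g (n - k) \<noteq> \<zero>\<^bsub>R\<^esub>"
        with that have "(k, n - k) \<in> ?s f \<times> ?s g" by auto
        then have "k + (n - k) \<in> (\<lambda>(k,l). k + l) ` (?s f \<times> ?s g)" by force
        with c show False by simp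
      qed
      then have "finsum R (\<lambda>k. f k \<otimes>\<^bsub>R\<^esub> g (n - k)) (?s f) = finsum R (\<lambda>k. \<zero>\<^bsub>R\<^esub>) (?s f)"
        using fg by (intro finsum_cong') (auto simp: carr)
      then have "(f \<otimes>\<^bsub>L\<^esub> g) n = \<zero>\<^bsub>R\<^esub>"
        using fg by (subst mulS[OF fg _ order_refl]) (auto simp: carr)
      with that show False by simp
    qed
    then have "?s (f \<otimes>\<^bsub>L\<^esub> g) \<subseteq> (\<lambda>(k,l). k + l) ` (?s f \<times> ?s g)" by blast
    moreover have "finite ((\<lambda>(k,l). k + l) ` (?s f \<times> ?s g))" using fg by (auto simp: carr)
    ultimately have "finite (?s (f \<otimes>\<^bsub>L\<^esub> g))" by (rule finite_subset)
    with 1 show ?thesis by (auto simp: carr)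
  qed
  have addc: "f \<oplus>\<^bsub>L\<^esub> g \<in> carrier L" if fg: "f \<in> carrier L" "g \<in> carrier L" for f g
  proof -
    have "?s (f \<oplus>\<^bsub>L\<^esub> g) \<subseteq> ?s f \<union> ?s g" by (auto simp: add)
    then have "finite (?s (f \<oplus>\<^bsub>L\<^esub> g))" using fg by (auto simp: carr intro: finite_subset)
    then show ?thesis using fg by (auto simp: carr add)
  qed
  have comm: "f \<otimes>\<^bsub>L\<^esub> g = g \<otimes>\<^bsub>L\<^esub> f" if fg: "f \<in> carrier L" "g \<in> carrier L" for f g
  proof
    fix n
    define S where "S = ?s f \<union> (\<lambda>k. n - k) ` ?s g"
    have S: "finite S" "?s f \<subseteq> S" "finite ((\<lambda>k. n - k) ` S)" "?s g \<subseteq> (\<lambda>k. n - k) ` S"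
      using fg by (auto simp: S_def carr image_Un image_image)
    have "(g \<otimes>\<^bsub>L\<^esub> f) n = finsum R (\<lambda>k. g k \<otimes>\<^bsub>R\<^esub> f (n - k)) ((\<lambda>k. n - k) ` S)"
      using fg S by (intro mulS) auto
    also have "\<dots> = finsum R (\<lambda>k. g (n - k) \<otimes>\<^bsub>R\<^esub> f (n - (n - k))) S"
      using fg by (intro finsum_reindex) (auto simp: inj_on_def carr)
    also have "\<dots> = finsum R (\<lambda>k. f k \<otimes>\<^bsub>R\<^esub> g (n - k)) S"
      using fg by (intro finsum_cong') (auto simp: carr m_comm)
    also have "\<dots> = (f \<otimes>\<^bsub>L\<^esub> g) n" using fg S by (intro mulS[symmetric]) auto
    finally show "(f \<otimes>\<^bsub>L\<^esub> g) n = (g \<otimes>\<^bsub>L\<^esub> f) n" by simp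
  qed
  have assoc: "(f \<otimes>\<^bsub>L\<^esub> g) \<otimes>\<^bsub>L\<^esub> h = f \<otimes>\<^bsub>L\<^esub> (g \<otimes>\<^bsub>L\<^esub> h)"
    if fgh: "f \<in> carrier L" "g \<in> carrier L" "h \<in> carrier L" for f g h
  proof
    fix n
    have fc: "f k \<in> carrier R" "g k \<in> carrier R" "h k \<in> carrier R" for k using fgh by (auto simp: carr)
    have fin: "finite (?s f)" "finite (?s h)" using fgh by (auto simp: carr)
    have "((f \<otimes>\<^bsub>L\<^esub> g) \<otimes>\<^bsub>L\<^esub> h) n = (h \<otimes>\<^bsub>L\<^esub> (f \<otimes>\<^bsub>L\<^esub> g)) n" using fgh by (simp add: comm mulc)
    also have "\<dots> = finsum R (\<lambda>k. h k \<otimes>\<^bsub>R\<^esub> (f \<otimes>\<^bsub>L\<^esub> g) (n - k)) (?s h)"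
      using fgh fin by (intro mulS) (auto simp: mulc)
    also have "\<dots> = finsum R (\<lambda>k. finsum R (\<lambda>l. h k \<otimes>\<^bsub>R\<^esub> (f l \<otimes>\<^bsub>R\<^esub> g (n - k - l))) (?s f)) (?s h)"
      using fin fc by (intro finsum_cong') (auto simp: mulS[OF fgh(1,2) fin(1) order_refl] finsum_rdistr intro!: finsum_closed)
    also have "\<dots> = finsum R (\<lambda>l. finsum R (\<lambda>k. h k \<otimes>\<^bsub>R\<^esub> (f l \<otimes>\<^bsub>R\<^esub> g (n - k - l))) (?s h)) (?s f)"
      using fin fc by (intro finsum_swap) auto
    also have "\<dots> = finsum R (\<lambda>l. f l \<otimes>\<^bsub>R\<^esub> (h \<otimes>\<^bsub>L\<^esub> g) (n - l)) (?s f)"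
    proof (intro finsum_cong' refl)
      fix l
      have "finsum R (\<lambda>k. h k \<otimes>\<^bsub>R\<^esub> (f l \<otimes>\<^bsub>R\<^esub> g (n - k - l))) (?s h)
        = finsum R (\<lambda>k. f l \<otimes>\<^bsub>R\<^esub> (h k \<otimes>\<^bsub>R\<^esub> g (n - l - k))) (?s h)"
        using fin fc by (intro finsum_cong') (auto simp: m_lcomm Groups.diff_right_commute[of n _ l])
      also have "\<dots> = f l \<otimes>\<^bsub>R\<^esub> (h \<otimes>\<^bsub>L\<^esub> g) (n - l)"
        using fin fc by (simp add: mulS[OF fgh(3,2) fin(2) order_refl] finsum_rdistr)
      finally show "finsum R (\<lambda>k. h k \<otimes>\<^bsub>R\<^esub> (f l \<otimes>\<^bsub>R\<^esub> g (n - k - l))) (?s h)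
        = f l \<otimes>\<^bsub>R\<^esub> (h \<otimes>\<^bsub>L\<^esub> g) (n - l)" .
    qed (use fc mulc[OF fgh(3,2)] in \<open>auto simp: carr\<close>)
    also have "\<dots> = (f \<otimes>\<^bsub>L\<^esub> (h \<otimes>\<^bsub>L\<^esub> g)) n"
      using fgh fin by (intro mulS[symmetric]) (auto simp: mulc)
    finally show "((f \<otimes>\<^bsub>L\<^esub> g) \<otimes>\<^bsub>L\<^esub> h) n = (f \<otimes>\<^bsub>L\<^esub> (g \<otimes>\<^bsub>L\<^esub> h)) n"
      using fgh by (simp add: comm)
  qed
  have onec: "\<one>\<^bsub>L\<^esub> \<in> carrier L"
  proof -
    have "?s \<one>\<^bsub>L\<^esub> \<subseteq> {0}" by (auto simp: one)
    then have "finite (?s \<one>\<^bsub>L\<^esub>)" by (rule finite_subset) simp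
    then show ?thesis by (auto simp: carr one)
  qed
  have lone: "\<one>\<^bsub>L\<^esub> \<otimes>\<^bsub>L\<^esub> f = f" if f: "f \<in> carrier L" for f
  proof
    fix n
    have "(\<one>\<^bsub>L\<^esub> \<otimes>\<^bsub>L\<^esub> f) n = finsum R (\<lambda>k. \<one>\<^bsub>L\<^esub> k \<otimes>\<^bsub>R\<^esub> f (n - k)) {0}"
      using f onec by (intro mulS) (auto simp: one)
    also have "\<dots> = f n" using f by (simp add: one carr)
    finally show "(\<one>\<^bsub>L\<^esub> \<otimes>\<^bsub>L\<^esub> f) n = f n" .
  qed
  have distr: "(f \<oplus>\<^bsub>L\<^esub> g) \<otimes>\<^bsub>L\<^esub> h = f \<otimes>\<^bsub>L\<^esub> h \<oplus>\<^bsub>L\<^esub> g \<otimes>\<^bsub>L\<^esub> h"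
    if fgh: "f \<in> carrier L" "g \<in> carrier L" "h \<in> carrier L" for f g h
  proof
    fix n
    let ?S = "?s f \<union> ?s g"
    have S: "finite ?S" "?s (f \<oplus>\<^bsub>L\<^esub> g) \<subseteq> ?S" using fgh by (auto simp: carr add)
    have fc: "f k \<in> carrier R" "g k \<in> carrier R" "h k \<in> carrier R" for k using fgh by (auto simp: carr)
    have "((f \<oplus>\<^bsub>L\<^esub> g) \<otimes>\<^bsub>L\<^esub> h) n = finsum R (\<lambda>k. (f \<oplus>\<^bsub>L\<^esub> g) k \<otimes>\<^bsub>R\<^esub> h (n - k)) ?S"
      using fgh S by (intro mulS) (auto simp: addc)
    also have "\<dots> = finsum R (\<lambda>k. f k \<otimes>\<^bsub>R\<^esub> h (n - k) \<oplus>\<^bsub>R\<^esub> g k \<otimes>\<^bsub>R\<^esub> h (n - k)) ?S"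
      using fc by (intro finsum_cong') (auto simp: add l_distr)
    also have "\<dots> = finsum R (\<lambda>k. f k \<otimes>\<^bsub>R\<^esub> h (n - k)) ?S \<oplus>\<^bsub>R\<^esub> finsum R (\<lambda>k. g k \<otimes>\<^bsub>R\<^esub> h (n - k)) ?S"
      using fc by (intro finsum_addf) auto
    also have "\<dots> = (f \<otimes>\<^bsub>L\<^esub> h \<oplus>\<^bsub>L\<^esub> g \<otimes>\<^bsub>L\<^esub> h) n"
      using fgh S by (simp add: add mulS[of f h ?S] mulS[of g h ?S])
    finally show "((f \<oplus>\<^bsub>L\<^esub> g) \<otimes>\<^bsub>L\<^esub> h) n = (f \<otimes>\<^bsub>L\<^esub> h \<oplus>\<^bsub>L\<^esub> g \<otimes>\<^bsub>L\<^esub> h) n" .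
  qed
  have zeroc: "\<zero>\<^bsub>L\<^esub> \<in> carrier L" by (auto simp: carr zero)
  have "abelian_group L"
  proof (rule abelian_groupI)
    fix f assume f: "f \<in> carrier L"
    have "(\<lambda>n. \<ominus>\<^bsub>R\<^esub> f n) \<in> carrier L"
    proof -
      have "?s (\<lambda>n. \<ominus>\<^bsub>R\<^esub> f n) \<subseteq> ?s f" by auto
      with f have "finite (?s (\<lambda>n. \<ominus>\<^bsub>R\<^esub> f n))" using carr finite_subset by blast
      with f show ?thesis by (auto simp: carr)
    qed
    moreover have "(\<lambda>n. \<ominus>\<^bsub>R\<^esub> f n) \<oplus>\<^bsub>L\<^esub> f = \<zero>\<^bsub>L\<^esub>"
      using f by (auto simp: fun_eq_iff add zero carr l_neg)
    ultimately show "\<exists>y\<in>carrier L. y \<oplus>\<^bsub>L\<^esub> f = \<zero>\<^bsub>L\<^esub>" by blast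
  qed ((simp add: addc zeroc; fail | auto simp: fun_eq_iff add zero a_ac dest!: carr[THEN iffD1])+)
  moreover have "Group.comm_monoid L"
    by (rule comm_monoidI) (simp_all only: mulc onec assoc lone, rule comm)
  ultimately have "cring L" by (rule cringI) (auto simp: distr)
  then show ?thesis by (simp add: L_def)
qed

definition laurent_monom :: "('a, 'b) ring_scheme \<Rightarrow> 'a \<Rightarrow> ('s \<Rightarrow> int) \<Rightarrow> ('s \<Rightarrow> int) \<Rightarrow> 'a" where
  "laurent_monom R c k = (\<lambda>n. if n = k then c else \<zero>\<^bsub>R\<^esub>)"

text \<open>The extended Rees algebra generated over \<open>R\<close> by all \<open>J\<^sub>i t\<^sub>i\<close> and all inverses of the \<open>t\<^sub>i\<close>.\<close>

definition extended_rees_algebra ::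
    "('a, 'b) ring_scheme \<Rightarrow> ('s::finite \<Rightarrow> 'a set) \<Rightarrow> (('s \<Rightarrow> int) \<Rightarrow> 'a) set" where
  "extended_rees_algebra R J = generate_ring (laurent_ring R)
     ({laurent_monom R c 0 |c. c \<in> carrier R} \<union>
      {laurent_monom R c (unit_exponent i) |c i. c \<in> J i} \<union>
      {laurent_monom R \<one>\<^bsub>R\<^esub> (- unit_exponent i) |i. True})"

definition extended_rees_module ::
    "('a, 'b) ring_scheme \<Rightarrow> (('s::finite \<Rightarrow> int) \<Rightarrow> 'a set) \<Rightarrow> (('s \<Rightarrow> int) \<Rightarrow> 'a) set" where
  "extended_rees_module R F = {f \<in> carrier (laurent_ring R). \<forall>n. f n \<in> F n}"

text \<open>
  \<open>M\<close> is a finite module over the subring \<open>A\<close> of \<open>L\<close>, with scalars acting by the multiplication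
  of \<open>L\<close>. Equality with the \<open>A\<close>-span of \<open>G\<close> includes that \<open>M\<close> is closed under the action.
\<close>

definition finite_module_over :: "('c, 'd) ring_scheme \<Rightarrow> 'c set \<Rightarrow> 'c set \<Rightarrow> bool" where
  "finite_module_over L A M \<longleftrightarrow>
     (\<exists>G \<subseteq> M. finite G \<and> M = {finsum L (\<lambda>g. c g \<otimes>\<^bsub>L\<^esub> g) G |c. c \<in> G \<rightarrow> A})"

section \<open>Admissibility and joint reductions\<close>

definition multigraded_admissible ::
    "('a, 'b) ring_scheme \<Rightarrow> 'a set \<Rightarrow> ('s::finite \<Rightarrow> nat \<Rightarrow> 'a set) \<Rightarrow> ('s \<Rightarrow> 'a set) \<Rightarrow> bool" where
  "multigraded_admissible R m I J \<longleftrightarrow>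
     (\<forall>i. m_primary R m (J i)) \<and>
     (\<forall>n. multi_power R J n \<subseteq> multi_filtration R I n) \<and>
     (\<forall>n k. multi_filtration R I n \<cdot>\<^bsub>R\<^esub> multi_filtration R I k \<subseteq> multi_filtration R I (n + k)) \<and>
     (\<forall>n k. n \<le> k \<longrightarrow> multi_filtration R I k \<subseteq> multi_filtration R I n) \<and>
     finite_module_over (laurent_ring R) (extended_rees_algebra R J)
       (extended_rees_module R (multi_filtration R I))"

text \<open>Only the values \<open>a i j\<close> and \<open>y i j\<close> with \<open>1 \<le> j \<le> r i\<close> matter.\<close>

definition strong_homogeneous_joint_reduction ::
    "('a, 'b) ring_scheme \<Rightarrow> ('s::finite \<Rightarrow> nat \<Rightarrow> 'a set) \<Rightarrow> ('s \<Rightarrow> nat) \<Rightarrow>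
     ('s \<Rightarrow> nat \<Rightarrow> nat) \<Rightarrow> ('s \<Rightarrow> nat \<Rightarrow> 'a) \<Rightarrow> bool" where
  "strong_homogeneous_joint_reduction R I r a y \<longleftrightarrow>
     (\<forall>i. \<forall>j \<in> {1..r i}. a i j \<ge> 1 \<and> y i j \<in> I i (a i j)) \<and>
     (\<exists>n0 :: 's \<Rightarrow> nat. \<forall>n :: 's \<Rightarrow> nat. n0 \<le> n \<longrightarrow>
        multi_filtration R I (\<lambda>k. int (n k)) =
          {finsum R (\<lambda>(i, j). y i j \<otimes>\<^bsub>R\<^esub> z i j) (SIGMA i:UNIV. {1..r i}) |z.
             \<forall>i. \<forall>j \<in> {1..r i}. z i j \<in>
               multi_filtration R I (\<lambda>k. int (n k) - int (a i j) * unit_exponent i k)})"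

end

theory Submission
  imports Defs "HOL-Library.Multiset_Order"
begin

text \<open>
  Write \<open>J\<^sup>n\<close> for the multi-indexed powers of \<open>J\<close>. It suffices to find \<open>y\<^sub>p \<in> J\<^bsup>\<delta>(p)\<^esup>\<close> with
  \<open>J\<^sup>n = \<Sum> y\<^sub>p J\<^bsup>n - \<delta>(p)\<^esup>\<close> for large \<open>n\<close>: the extended Rees module of the filtration is generated by finitely many
  elements over the extended Rees algebra of \<open>J\<close>, so the equation passes on to the filtration.
  By Nakayama's lemma the equation is only needed modulo \<open>m J\<^sup>n\<close>, that is, in the multigraded fibre ring
  \<open>T = \<Oplus> J\<^sup>n / m J\<^sup>n\<close>, and there at a single \<open>n\<close>. As the residue field is infinite, each \<open>y\<^sub>p\<close> can be chosen outside the
  finitely many minimal relevant homogeneous primes over the previous ones. If the \<open>d\<close> elements so chosen lay in a relevant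
  prime \<open>P\<^sub>d\<close>, there would be a chain \<open>P\<^sub>0 \<subset> \<dots> \<subset> P\<^sub>d\<close> of relevant primes, and multiplication by the \<open>y\<^sub>p\<close> would show that the
  length of \<open>T\<close> in degree \<open>(N, \<dots>, N)\<close> is at least \<open>c N\<^sup>d\<close>, so that of \<open>R / J\<^bsup>(N, \<dots>, N)\<^esup>\<close> at least
  \<open>c N\<^bsup>d + 1\<^esup>\<close>. But \<open>J\<^bsup>(N, \<dots>, N)\<^esup>\<close> contains \<open>(x\<^sub>1\<^sup>N, \<dots>, x\<^sub>d\<^sup>N)\<close> for a system of parameters in
  \<open>J\<^bsup>(1, \<dots>, 1)\<^esup>\<close>, which bounds this length by \<open>C N\<^sup>d\<close>.
\<close>

section \<open>Ideals of commutative rings\<close>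

text \<open>The fibre ring \<open>T\<close> is never built as a ring: its homogeneous ideals are
  families of ideals of \<open>R\<close>, and every step is a statement about ideals between
  \<open>m J^n\<close> and \<open>J^n\<close>. Length functions and Hilbert polynomials are avoided
  as well. A lower bound for a length is a chain of ideals, an upper bound is a bound on all chains,
  and the final contradiction confronts one of each. The exponents clash only after a summation.
  Growth of order \<open>N^d\<close> in a single degree \<open>(N, ..., N)\<close> of
  \<open>T\<close> would be compatible with a bound of order \<open>N^d\<close> for
  \<open>R / J^(N, ..., N)\<close>. The missing factor \<open>N\<close> comes from stacking the
  fibres over consecutive diagonal degrees, which works because \<open>J^(p+1, ..., p+1)\<close>
  lies in \<open>m J^(p, ..., p)\<close>. The main obstacle is the ascending chain condition for
  homogeneous ideals of \<open>T\<close> in this encoding. It is obtained from leading monomials and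
  Dickson's lemma. Both the finiteness of the set of minimal relevant primes and the existence of a
  relevant prime over an ideal without a full graded piece rest on it; the latter produces the
  single degree to which Nakayama's lemma is applied.\<close>

definition adjoin :: "('a, 'b) ring_scheme \<Rightarrow> 'a set \<Rightarrow> 'a \<Rightarrow> 'a set \<Rightarrow> 'a set" where
  "adjoin R K v W = {k \<oplus>\<^bsub>R\<^esub> v \<otimes>\<^bsub>R\<^esub> w |k w. k \<in> K \<and> w \<in> W}"

definition colon :: "('a, 'b) ring_scheme \<Rightarrow> 'a set \<Rightarrow> 'a \<Rightarrow> 'a set" where
  "colon R K v = {r \<in> carrier R. v \<otimes>\<^bsub>R\<^esub> r \<in> K}"

context cring
begin

lemma idealI_cring:
  assumes "S \<subseteq> carrier R" "\<zero> \<in> S" "\<And>u v. u \<in> S \<Longrightarrow> v \<in> S \<Longrightarrow> u \<oplus> v \<in> S"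
    and "\<And>c u. c \<in> carrier R \<Longrightarrow> u \<in> S \<Longrightarrow> c \<otimes> u \<in> S"
  shows "ideal S R"
proof (rule idealI)
  show "ring R" by (rule ring_axioms)
  have neg: "\<ominus> u \<in> S" if "u \<in> S" for u
  proof -
    have "(\<ominus> \<one>) \<otimes> u \<in> S" using assms(4)[of "\<ominus> \<one>" u] that by simp
    moreover have "(\<ominus> \<one>) \<otimes> u = \<ominus> u" using that assms(1) by (simp add: l_minus subsetD)
    ultimately show ?thesis by simp
  qed
  show "subgroup S (add_monoid R)"
  proof (rule subgroup.intro)
    show "S \<subseteq> carrier (add_monoid R)" "\<one>\<^bsub>add_monoid R\<^esub> \<in> S" using assms(1,2) by simp_all
    show "x \<otimes>\<^bsub>add_monoid R\<^esub> y \<in> S" if "x \<in> S" "y \<in> S" for x y using assms(3)[OF that] by simp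
    show "inv\<^bsub>add_monoid R\<^esub> x \<in> S" if "x \<in> S" for x using neg[OF that] unfolding a_inv_def .
  qed
  show "x \<otimes> a \<in> S" if "a \<in> S" "x \<in> carrier R" for a x
    using assms(4) that by simp
  show "a \<otimes> x \<in> S" if "a \<in> S" "x \<in> carrier R" for a x
    using assms(4)[OF that(2,1)] m_comm[OF subsetD[OF assms(1) that(1)] that(2)] by simp
qed

lemma ideal_subset: "ideal I R \<Longrightarrow> I \<subseteq> carrier R"
  by (rule subsetI) (rule ideal.Icarr)

lemma ideal_zero: "ideal I R \<Longrightarrow> \<zero> \<in> I"
  by (simp add: additive_subgroup.zero_closed ideal.axioms(1))

lemma ideal_add: "ideal I R \<Longrightarrow> u \<in> I \<Longrightarrow> v \<in> I \<Longrightarrow> u \<oplus> v \<in> I"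
  by (simp add: additive_subgroup.a_closed ideal.axioms(1))

lemma ideal_minus: "ideal I R \<Longrightarrow> u \<in> I \<Longrightarrow> v \<in> I \<Longrightarrow> u \<ominus> v \<in> I"
  by (simp add: a_minus_def additive_subgroup.a_closed additive_subgroup.a_inv_closed ideal.axioms(1))

lemma ideal_lmult: "ideal I R \<Longrightarrow> c \<in> carrier R \<Longrightarrow> u \<in> I \<Longrightarrow> c \<otimes> u \<in> I"
  by (simp add: ideal.I_l_closed)

lemma ideal_rmult: "ideal I R \<Longrightarrow> c \<in> carrier R \<Longrightarrow> u \<in> I \<Longrightarrow> u \<otimes> c \<in> I"
  by (simp add: ideal.I_r_closed)

lemma ideal_add_cancel:
  assumes "ideal I R" "u \<oplus> v \<in> I" "u \<in> I" "v \<in> carrier R"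
  shows "v \<in> I"
proof -
  have "u \<in> carrier R" using assms ideal_subset by blast
  then have "v = (u \<oplus> v) \<ominus> u" using assms(4) by algebra
  then show ?thesis using ideal_minus assms by metis
qed

lemma ideal_prod_subset:
  assumes "ideal K R" "\<And>u v. u \<in> I \<Longrightarrow> v \<in> J \<Longrightarrow> u \<otimes> v \<in> K"
  shows "I \<cdot> J \<subseteq> K"
proof
  fix s assume "s \<in> I \<cdot> J"
  then show "s \<in> K" by induct (use assms ideal_add in auto)
qed

lemma finsum_in_ideal:
  assumes "ideal K R" "finite A" "\<And>p. p \<in> A \<Longrightarrow> f p \<in> K"
  shows "finsum R f A \<in> K"
  using assms(2,3)
proof (induction A rule: finite_induct)
  case empty
  then show ?case using ideal_zero[OF assms(1)] by simp
next
  case (insert a A)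
  then have "f a \<in> K" "finsum R f A \<in> K" by auto
  moreover have "f \<in> A \<rightarrow> carrier R" "f a \<in> carrier R"
    using insert.prems ideal_subset[OF assms(1)] by auto
  ultimately show ?case using insert.hyps by (simp add: ideal_add[OF assms(1)])
qed

lemma colon_ideal: "ideal K R \<Longrightarrow> v \<in> carrier R \<Longrightarrow> ideal (colon R K v) R"
  unfolding colon_def by (rule ideal.helper_max_prime[OF _ is_cring])

lemma adjoin_ideal:
  assumes "ideal K R" "v \<in> carrier R" "ideal W R"
  shows "ideal (adjoin R K v W) R"
proof (rule idealI_cring)
  note KW = ideal_subset[OF assms(1)] ideal_subset[OF assms(3)]
  show "adjoin R K v W \<subseteq> carrier R" using KW assms(2) unfolding adjoin_def by blast
  have "\<zero> = \<zero> \<oplus> v \<otimes> \<zero>" using assms(2) by simp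
  then show "\<zero> \<in> adjoin R K v W"
    using ideal_zero[OF assms(1)] ideal_zero[OF assms(3)] unfolding adjoin_def by blast
  fix u u' assume "u \<in> adjoin R K v W"
  then obtain k w where u: "k \<in> K" "w \<in> W" "u = k \<oplus> v \<otimes> w" unfolding adjoin_def by blast
  have c: "k \<in> carrier R" "w \<in> carrier R" using u KW by auto
  { assume "u' \<in> adjoin R K v W"
    then obtain k' w' where u': "k' \<in> K" "w' \<in> W" "u' = k' \<oplus> v \<otimes> w'" unfolding adjoin_def by blast
    have c': "k' \<in> carrier R" "w' \<in> carrier R" using u' KW by auto
    have "u \<oplus> u' = (k \<oplus> k') \<oplus> v \<otimes> (w \<oplus> w')" unfolding u u' using c c' assms(2) by algebra
    then show "u \<oplus> u' \<in> adjoin R K v W"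
      using ideal_add[OF assms(1) u(1) u'(1)] ideal_add[OF assms(3) u(2) u'(2)] unfolding adjoin_def by blast }
  fix a assume a: "a \<in> carrier R"
  have "a \<otimes> u = a \<otimes> k \<oplus> v \<otimes> (a \<otimes> w)" unfolding u using a c assms(2) by algebra
  then show "a \<otimes> u \<in> adjoin R K v W"
    using ideal_lmult[OF assms(1) a u(1)] ideal_lmult[OF assms(3) a u(2)] unfolding adjoin_def by blast
qed

lemma adjoin_super:
  assumes "ideal K R" "v \<in> carrier R" "ideal W R"
  shows "K \<subseteq> adjoin R K v W"
proof
  fix k assume k: "k \<in> K"
  then have "k = k \<oplus> v \<otimes> \<zero>" using ideal_subset[OF assms(1)] assms(2) by auto
  then show "k \<in> adjoin R K v W" using k ideal_zero[OF assms(3)] unfolding adjoin_def by blast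
qed

lemma adjoin_mult:
  assumes "ideal K R" "v \<in> carrier R" "ideal W R" "w \<in> W"
  shows "v \<otimes> w \<in> adjoin R K v W"
proof -
  have "w \<in> carrier R" using assms ideal_subset by blast
  then have "v \<otimes> w = \<zero> \<oplus> v \<otimes> w" using assms(2) by simp
  then show ?thesis using ideal_zero[OF assms(1)] assms(4) unfolding adjoin_def by blast
qed

lemma adjoin_least:
  assumes "ideal L R" "K \<subseteq> L" "\<And>w. w \<in> W \<Longrightarrow> v \<otimes> w \<in> L"
  shows "adjoin R K v W \<subseteq> L"
  using assms ideal_add unfolding adjoin_def by blast

lemma adjoin_self:
  assumes "ideal K R" "v \<in> carrier R"
  shows "v \<in> adjoin R K v (carrier R)"
  using adjoin_mult[OF assms oneideal one_closed] assms(2) by simp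

lemma genideal_insert:
  assumes "v \<in> carrier R" "S \<subseteq> carrier R"
  shows "Idl (insert v S) = adjoin R (Idl S) v (carrier R)"
proof
  have K: "ideal (Idl S) R" using genideal_ideal assms by simp
  have I: "ideal (adjoin R (Idl S) v (carrier R)) R" by (rule adjoin_ideal[OF K assms(1) oneideal])
  show "Idl (insert v S) \<subseteq> adjoin R (Idl S) v (carrier R)"
    by (rule genideal_minimal[OF I])
      (use adjoin_self[OF K assms(1)] adjoin_super[OF K assms(1) oneideal] genideal_self[OF assms(2)] in blast)
  have G: "ideal (Idl (insert v S)) R" "insert v S \<subseteq> Idl (insert v S)"
    using genideal_ideal genideal_self[of "insert v S"] assms by auto
  show "adjoin R (Idl S) v (carrier R) \<subseteq> Idl (insert v S)"
    by (rule adjoin_least[OF G(1)]) (use G genideal_minimal ideal_rmult in auto)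
qed

lemma genideal_mono:
  "S \<subseteq> T \<Longrightarrow> T \<subseteq> carrier R \<Longrightarrow> Idl S \<subseteq> Idl T"
  by (simp add: genideal_ideal genideal_minimal genideal_self order_trans)

lemma sum_ideal_upper:
  assumes "ideal I R" "ideal K R"
  shows "I \<subseteq> I <+>\<^bsub>R\<^esub> K" "K \<subseteq> I <+>\<^bsub>R\<^esub> K"
proof -
  show "I \<subseteq> I <+>\<^bsub>R\<^esub> K"
  proof
    fix u assume u: "u \<in> I"
    then have "u = u \<oplus> \<zero>" using ideal_subset[OF assms(1)] by auto
    then show "u \<in> I <+>\<^bsub>R\<^esub> K" using u ideal_zero[OF assms(2)] unfolding set_add_def' by blast
  qed
  show "K \<subseteq> I <+>\<^bsub>R\<^esub> K"
  proof
    fix u assume u: "u \<in> K"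
    then have "u = \<zero> \<oplus> u" using ideal_subset[OF assms(2)] by auto
    then show "u \<in> I <+>\<^bsub>R\<^esub> K" using u ideal_zero[OF assms(1)] unfolding set_add_def' by blast
  qed
qed

lemma sum_ideal_least:
  assumes "ideal L R" "I \<subseteq> L" "K \<subseteq> L"
  shows "I <+>\<^bsub>R\<^esub> K \<subseteq> L"
  using assms ideal_add unfolding set_add_def' by blast

end

section \<open>Chains of ideals\<close>

text \<open>A witness that \<open>K / I\<close> has length at least \<open>k\<close>. The base case
  asks only for \<open>I \<subseteq> K\<close>, so the chain may begin strictly above
  \<open>I\<close>; this makes lowering \<open>I\<close> immediate.\<close>

inductive ideal_chain :: "('a, 'b) ring_scheme \<Rightarrow> 'a set \<Rightarrow> 'a set \<Rightarrow> nat \<Rightarrow> bool" for R where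
  chain_base: "ideal I R \<Longrightarrow> ideal K R \<Longrightarrow> I \<subseteq> K \<Longrightarrow> ideal_chain R I K 0"
| chain_step: "ideal_chain R I L k \<Longrightarrow> ideal K R \<Longrightarrow> L \<subset> K \<Longrightarrow> ideal_chain R I K (Suc k)"

definition length_le :: "('a, 'b) ring_scheme \<Rightarrow> 'a set \<Rightarrow> 'a set \<Rightarrow> nat \<Rightarrow> bool" where
  "length_le R I K h \<longleftrightarrow> (\<forall>k. ideal_chain R I K k \<longrightarrow> k \<le> h)"

lemma ideal_chainD:
  "ideal_chain R I K k \<Longrightarrow> ideal I R \<and> ideal K R \<and> I \<subseteq> K"
  by (induction rule: ideal_chain.induct) auto

lemma ideal_chain_up:
  assumes "ideal_chain R I K k" "ideal K' R" "K \<subseteq> K'"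
  shows "ideal_chain R I K' k"
  using assms(1)
proof cases
  case chain_base
  then show ?thesis using assms by (auto intro: ideal_chain.intros)
next
  case (chain_step L k)
  then have "L \<subset> K'" using assms(3) by blast
  then show ?thesis using ideal_chain.chain_step chain_step assms(2) by metis
qed

lemma ideal_chain_down:
  assumes "ideal_chain R I K k" "ideal I' R" "I' \<subseteq> I"
  shows "ideal_chain R I' K k"
  using assms by (induction rule: ideal_chain.induct) (auto intro: ideal_chain.intros)

lemma ideal_chain_trans:
  assumes "ideal_chain R L K b" "ideal_chain R I L a"
  shows "ideal_chain R I K (a + b)"
  using assms
proof (induction rule: ideal_chain.induct)
  case (chain_base L K)
  then show ?case using ideal_chain_up by fastforce
next
  case (chain_step L L' b K)
  then show ?case by (auto intro: ideal_chain.intros)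
qed

text \<open>Strictness is demanded only between \<open>I\<close> and \<open>K\<close>. Multiplying
  by an element and forming the colon by an element both collapse ideals in general and are strict
  only on a suitable interval.\<close>

lemma ideal_chain_map:
  assumes "ideal_chain R I K k"
    and "\<And>X. ideal X R \<Longrightarrow> I \<subseteq> X \<Longrightarrow> X \<subseteq> K \<Longrightarrow> ideal (\<phi> X) R"
    and "\<And>X Y. ideal X R \<Longrightarrow> ideal Y R \<Longrightarrow> I \<subseteq> X \<Longrightarrow> X \<subset> Y \<Longrightarrow> Y \<subseteq> K \<Longrightarrow> \<phi> X \<subset> \<phi> Y"
  shows "ideal_chain R (\<phi> I) (\<phi> K) k"
  using assms
proof (induction rule: ideal_chain.induct)
  case (chain_base I K)
  have "\<phi> I \<subset> \<phi> K" if "I \<noteq> K" by (rule chain_base.prems(2)) (use chain_base that in auto)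
  then have "\<phi> I \<subseteq> \<phi> K" by (cases "I = K") auto
  with chain_base show ?case by (auto intro: ideal_chain.intros)
next
  case (chain_step I L k K)
  have L: "ideal I R" "ideal L R" "I \<subseteq> L" using ideal_chainD[OF chain_step.hyps(1)] by auto
  have "ideal_chain R (\<phi> I) (\<phi> L) k"
    by (rule chain_step.IH) (use chain_step.prems chain_step.hyps in auto)
  moreover have "\<phi> L \<subset> \<phi> K"
    by (rule chain_step.prems(2)[OF L(2) chain_step.hyps(2) L(3) chain_step.hyps(3) order_refl])
  moreover have "ideal (\<phi> K) R" by (rule chain_step.prems(1)) (use chain_step L in auto)
  ultimately show ?case by (auto intro: ideal_chain.intros)
qed

context cring
begin

text \<open>By modularity, a strict step \<open>X \<subset> Y\<close> stays strict after intersecting with \<open>L\<close> or after adding \<open>L\<close>.\<close>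

lemma ideal_chain_split:
  assumes "ideal_chain R I K k" "ideal L R"
  shows "\<exists>a b. k \<le> a + b \<and> ideal_chain R (I \<inter> L) (K \<inter> L) a \<and> ideal_chain R (I <+>\<^bsub>R\<^esub> L) (K <+>\<^bsub>R\<^esub> L) b"
  using assms
proof (induction rule: ideal_chain.induct)
  case (chain_base I K)
  have "I <+>\<^bsub>R\<^esub> L \<subseteq> K <+>\<^bsub>R\<^esub> L" using chain_base(3) unfolding set_add_def' by blast
  then have "ideal_chain R (I \<inter> L) (K \<inter> L) 0" "ideal_chain R (I <+>\<^bsub>R\<^esub> L) (K <+>\<^bsub>R\<^esub> L) 0"
    using chain_base by (auto intro!: ideal_chain.intros i_intersect add_ideals)
  then show ?case by fastforce
next
  case (chain_step I M k K)
  then obtain a b where ab: "k \<le> a + b" "ideal_chain R (I \<inter> L) (M \<inter> L) a" "ideal_chain R (I <+>\<^bsub>R\<^esub> L) (M <+>\<^bsub>R\<^esub> L) b"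
    by blast
  have M: "ideal M R" using ideal_chainD[OF chain_step.hyps(1)] by blast
  have ids: "ideal (K \<inter> L) R" "ideal (K <+>\<^bsub>R\<^esub> L) R" using chain_step by (auto intro: i_intersect add_ideals)
  have sub: "M \<inter> L \<subseteq> K \<inter> L" "M <+>\<^bsub>R\<^esub> L \<subseteq> K <+>\<^bsub>R\<^esub> L"
    using chain_step(3) unfolding set_add_def' by blast+
  show ?case
  proof (cases "M \<inter> L = K \<inter> L")
    case False
    with sub ab(2) ids have "ideal_chain R (I \<inter> L) (K \<inter> L) (Suc a)" by (auto intro: ideal_chain.intros)
    moreover have "ideal_chain R (I <+>\<^bsub>R\<^esub> L) (K <+>\<^bsub>R\<^esub> L) b" using ideal_chain_up[OF ab(3) ids(2) sub(2)] .
    ultimately show ?thesis using ab(1) by (intro exI[of _ "Suc a"] exI[of _ b]) auto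
  next
    case True
    have "M <+>\<^bsub>R\<^esub> L \<noteq> K <+>\<^bsub>R\<^esub> L"
    proof
      assume eq: "M <+>\<^bsub>R\<^esub> L = K <+>\<^bsub>R\<^esub> L"
      obtain u where u: "u \<in> K" "u \<notin> M" using chain_step(3) by blast
      then have "u \<in> M <+>\<^bsub>R\<^esub> L" using sum_ideal_upper(1)[OF chain_step(2,5)] eq by blast
      then obtain p l where pl: "p \<in> M" "l \<in> L" "u = p \<oplus> l" unfolding set_add_def' by blast
      have c: "p \<in> carrier R" "l \<in> carrier R" using pl ideal_subset M chain_step(5) by blast+
      have "l = u \<ominus> p" unfolding pl using c by algebra
      then have "l \<in> K" using ideal_minus[OF chain_step(2)] u pl chain_step(3) by blast
      then have "l \<in> M" using True pl by blast
      then show False using u pl ideal_add[OF M] by blast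
    qed
    with sub ab(3) ids have "ideal_chain R (I <+>\<^bsub>R\<^esub> L) (K <+>\<^bsub>R\<^esub> L) (Suc b)" by (auto intro: ideal_chain.intros)
    moreover have "ideal_chain R (I \<inter> L) (K \<inter> L) a" using ideal_chain_up[OF ab(2) ids(1) sub(1)] .
    ultimately show ?thesis using ab(1) by (intro exI[of _ a] exI[of _ "Suc b"]) auto
  qed
qed

text \<open>Subadditivity of length. Intersecting a chain with \<open>L\<close> and adding
  \<open>L\<close> to it gives two chains that together keep all its steps; since
  \<open>I \<subseteq> L \<subseteq> K\<close>, one runs from \<open>I\<close> to \<open>L\<close>
  and the other from \<open>L\<close> to \<open>K\<close>.\<close>

lemma length_le_split:
  assumes "length_le R I L h1" "length_le R L K h2" "ideal L R" "I \<subseteq> L" "L \<subseteq> K"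
  shows "length_le R I K (h1 + h2)"
  unfolding length_le_def
proof (intro allI impI)
  fix k assume k: "ideal_chain R I K k"
  then obtain a b where ab: "k \<le> a + b" "ideal_chain R (I \<inter> L) (K \<inter> L) a" "ideal_chain R (I <+>\<^bsub>R\<^esub> L) (K <+>\<^bsub>R\<^esub> L) b"
    using ideal_chain_split assms(3) by blast
  have IK: "ideal I R" "ideal K R" using ideal_chainD[OF k] by auto
  have "I \<inter> L = I" "K \<inter> L = L" using assms by auto
  moreover have "I <+>\<^bsub>R\<^esub> L = L" "K <+>\<^bsub>R\<^esub> L = K"
    using sum_ideal_least[OF assms(3) assms(4) order_refl] sum_ideal_upper(2)[OF IK(1) assms(3)]
      sum_ideal_least[OF IK(2) order_refl assms(5)] sum_ideal_upper(1)[OF IK(2) assms(3)] by auto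
  ultimately show "k \<le> h1 + h2" using ab assms(1,2) unfolding length_le_def by fastforce
qed

lemma length_le_refl: "length_le R K K 0"
  unfolding length_le_def
proof (intro allI impI)
  fix k assume "ideal_chain R K K k"
  then show "k \<le> 0" by cases (auto dest: ideal_chainD)
qed

lemma length_le_down:
  assumes "length_le R I K h" "I \<subseteq> I'" "ideal I R"
  shows "length_le R I' K h"
  using assms ideal_chain_down unfolding length_le_def by blast

text \<open>Multiplication by \<open>v\<close> maps \<open>R / q\<close> onto
  \<open>(K + v R) / K\<close>. For chains, \<open>X\<close> is pulled back to
  \<open>colon R X v\<close>; no step is lost between \<open>K\<close> and \<open>K + v R\<close>,
  because each element there is \<open>p + v r\<close> with \<open>p\<close> in
  \<open>K\<close>.\<close>

lemma length_le_adjoin: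
  assumes "ideal K R" "v \<in> carrier R" "ideal q R" "\<And>u. u \<in> q \<Longrightarrow> v \<otimes> u \<in> K"
    and "length_le R q (carrier R) h"
  shows "length_le R K (adjoin R K v (carrier R)) h"
  unfolding length_le_def
proof (intro allI impI)
  fix k assume k: "ideal_chain R K (adjoin R K v (carrier R)) k"
  have "ideal_chain R (colon R K v) (colon R (adjoin R K v (carrier R)) v) k"
  proof (rule ideal_chain_map[OF k])
    show "ideal (colon R X v) R" if "ideal X R" for X using colon_ideal that assms(2) by blast
    fix X Y assume XY: "ideal X R" "ideal Y R" "K \<subseteq> X" "X \<subset> Y" "Y \<subseteq> adjoin R K v (carrier R)"
    then obtain y where y: "y \<in> Y" "y \<notin> X" by blast
    with XY(5) obtain p r where pr: "p \<in> K" "r \<in> carrier R" "y = p \<oplus> v \<otimes> r" unfolding adjoin_def by blast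
    have "v \<otimes> r \<in> Y" using ideal_add_cancel[OF XY(2), of p "v \<otimes> r"] pr XY(3,4) y assms(2) by auto
    moreover have "v \<otimes> r \<notin> X" using ideal_add[OF XY(1), of p "v \<otimes> r"] pr XY(3) y by auto
    ultimately show "colon R X v \<subset> colon R Y v" using XY(4) pr(2) unfolding colon_def by auto
  qed
  then have "ideal_chain R (colon R K v) (carrier R) k"
    by (rule ideal_chain_up[OF _ oneideal]) (auto simp: colon_def)
  then have "ideal_chain R q (carrier R) k"
    by (rule ideal_chain_down[OF _ assms(3)]) (use assms(4) ideal_subset[OF assms(3)] in \<open>auto simp: colon_def\<close>)
  then show "k \<le> h" using assms(5) unfolding length_le_def by blast
qed

text \<open>The layers \<open>(K + v^N R) / (K + v^(N+1) R)\<close> are images of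
  \<open>R / (K + v R)\<close> under multiplication by \<open>v^N\<close>, since
  \<open>v^N (K + v R)\<close> lies in \<open>K + v^(N+1) R\<close>. Each of the \<open>N\<close>
  layers therefore costs at most \<open>h\<close>.\<close>

lemma length_le_power:
  assumes K: "ideal K R" and v: "v \<in> carrier R"
    and h: "length_le R (adjoin R K v (carrier R)) (carrier R) h"
  shows "length_le R (adjoin R K (v [^] (N::nat)) (carrier R)) (carrier R) (N * h)"
proof (induction N)
  case 0
  have "carrier R \<subseteq> adjoin R K (v [^] (0::nat)) (carrier R)"
    using adjoin_mult[OF K one_closed oneideal] by force
  then have "adjoin R K (v [^] (0::nat)) (carrier R) = carrier R"
    using ideal_subset[OF adjoin_ideal[OF K _ oneideal]] v by blast
  then show ?case using length_le_refl by simp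
next
  case (Suc N)
  let ?A = "\<lambda>N::nat. adjoin R K (v [^] N) (carrier R)"
  have id: "ideal (?A N) R" for N using adjoin_ideal[OF K _ oneideal] v by simp
  have sup: "K \<subseteq> ?A N" for N using adjoin_super[OF K _ oneideal] v by simp
  have mul: "v [^] N \<otimes> r \<in> ?A N" if "r \<in> carrier R" for N r
    using adjoin_mult[OF K _ oneideal that] v by simp
  \<comment> \<open>Rewrites the lower power ideal as the next one with \<open>v^N\<close> adjoined,
    the shape in which \<open>length_le_adjoin\<close> bounds a layer.\<close>
  have eq: "adjoin R (?A (Suc N)) (v [^] N) (carrier R) = ?A N"
  proof (rule equalityI; rule adjoin_least)
    show "ideal (?A N) R" by (rule id)
    show "?A (Suc N) \<subseteq> ?A N"
    proof (rule adjoin_least[OF id sup])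
      fix w assume w: "w \<in> carrier R"
      have "v [^] Suc N \<otimes> w = v [^] N \<otimes> (v \<otimes> w)" using v w by (simp add: m_assoc)
      then show "v [^] Suc N \<otimes> w \<in> ?A N" using mul[of "v \<otimes> w" N] v w by simp
    qed
    show "v [^] N \<otimes> w \<in> ?A N" if "w \<in> carrier R" for w by (rule mul[OF that])
    show "ideal (adjoin R (?A (Suc N)) (v [^] N) (carrier R)) R"
      by (rule adjoin_ideal[OF id _ oneideal]) (use v in simp)
    show "K \<subseteq> adjoin R (?A (Suc N)) (v [^] N) (carrier R)"
      using adjoin_super[OF id _ oneideal, of "v [^] N" "Suc N"] v sup[of "Suc N"] by auto
    show "v [^] N \<otimes> w \<in> adjoin R (?A (Suc N)) (v [^] N) (carrier R)" if "w \<in> carrier R" for w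
      by (rule adjoin_mult[OF id _ oneideal that]) (use v in simp)
  qed
  have "v [^] N \<otimes> u \<in> ?A (Suc N)" if "u \<in> adjoin R K v (carrier R)" for u
  proof -
    obtain k r where kr: "k \<in> K" "r \<in> carrier R" "u = k \<oplus> v \<otimes> r" using \<open>u \<in> _\<close> unfolding adjoin_def by blast
    have k: "k \<in> carrier R" using kr ideal_subset[OF K] by blast
    have "v [^] N \<otimes> u = v [^] N \<otimes> k \<oplus> v [^] Suc N \<otimes> r"
      unfolding kr using kr k v by (simp add: r_distr m_assoc)
    then show ?thesis
      using ideal_lmult[OF K _ kr(1), of "v [^] N"] v kr(2) unfolding adjoin_def by auto
  qed
  then have "length_le R (?A (Suc N)) (?A N) h"
    using length_le_adjoin[OF id _ adjoin_ideal[OF K v oneideal] _ h, of "v [^] N" "Suc N"] v eq by simp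
  moreover have "?A (Suc N) \<subseteq> ?A N" using eq adjoin_super[OF id _ oneideal, of "v [^] N" "Suc N"] v by auto
  ultimately show ?case
    using length_le_split[OF _ Suc.IH id _ ideal_subset[OF id]] by simp
qed

text \<open>The set \<open>S\<close> holds generators that are left alone. Parking \<open>x\<close>
  in \<open>S\<close> lets the induction raise the others to the power \<open>N\<close>; then
  \<open>x\<close> is raised modulo them, at the price of one more factor \<open>N\<close>. This is
  the source of the upper bound of order \<open>N^d\<close>.\<close>

lemma length_le_powers:
  assumes "length_le R (Idl (set xs \<union> S)) (carrier R) h" "set xs \<subseteq> carrier R" "S \<subseteq> carrier R"
  shows "length_le R (Idl ((\<lambda>x. x [^] (N::nat)) ` set xs \<union> S)) (carrier R) (N ^ length xs * h)"
  using assms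
proof (induction xs arbitrary: S h)
  case Nil
  then show ?case by simp
next
  case (Cons x xs)
  let ?p = "\<lambda>x. x [^] N"
  have x: "x \<in> carrier R" "set xs \<subseteq> carrier R" using Cons by auto
  have "length_le R (Idl (set xs \<union> insert x S)) (carrier R) h" using Cons.prems(1) by simp
  then have "length_le R (Idl (?p ` set xs \<union> insert x S)) (carrier R) (N ^ length xs * h)"
    by (rule Cons.IH) (use Cons.prems in auto)
  moreover have sub: "?p ` set xs \<union> S \<subseteq> carrier R" using x Cons.prems by auto
  ultimately have "length_le R (adjoin R (Idl (?p ` set xs \<union> S)) x (carrier R)) (carrier R) (N ^ length xs * h)"
    using genideal_insert[OF x(1) sub] by simp
  from length_le_power[OF genideal_ideal[OF sub] x(1) this, of N]
  show ?case using genideal_insert[OF nat_pow_closed[OF x(1)] sub] by (simp add: mult.assoc)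
qed

end

section \<open>Noetherian local rings and parameters\<close>

text \<open>
  An abstract form of ``only finitely many minimal primes'': \<open>A\<close> plays the role of the ideals and \<open>P\<close> that
  of the primes; assumption \<open>split\<close> replaces \<open>Q\<close> by \<open>Q + (x)\<close> and \<open>Q + (y)\<close> with \<open>x y \<in> Q\<close>.
\<close>

lemma finite_minimal_elements:
  fixes A P :: "'x::order set"
  assumes wf: "wf {(Y, X). X \<in> A \<and> Y \<in> A \<and> X < Y}"
    and split: "\<And>Q. Q \<in> A \<Longrightarrow> Q \<notin> P \<Longrightarrow> \<exists>X\<in>P. Q \<le> X \<Longrightarrow>
      \<exists>Q1\<in>A. \<exists>Q2\<in>A. Q < Q1 \<and> Q < Q2 \<and> (\<forall>X\<in>P. Q \<le> X \<longrightarrow> Q1 \<le> X \<or> Q2 \<le> X)"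
    and "Q \<in> A"
  shows "\<exists>F. finite F \<and> F \<subseteq> P \<and> (\<forall>X\<in>F. Q \<le> X) \<and> (\<forall>X\<in>P. Q \<le> X \<longrightarrow> (\<exists>Y\<in>F. Y \<le> X))"
  using assms(3)
proof (induction Q rule: wf_induct_rule[OF wf])
  case (1 Q)
  consider "Q \<in> P" | "\<forall>X\<in>P. \<not> Q \<le> X" | "Q \<notin> P" "\<exists>X\<in>P. Q \<le> X" by blast
  then show ?case
  proof cases
    case 1
    then show ?thesis by (intro exI[of _ "{Q}"]) auto
  next
    case 2
    then show ?thesis by (intro exI[of _ "{}"]) auto
  next
    case 3
    obtain Q1 Q2 where Q: "Q1 \<in> A" "Q2 \<in> A" "Q < Q1" "Q < Q2"
      "\<forall>X\<in>P. Q \<le> X \<longrightarrow> Q1 \<le> X \<or> Q2 \<le> X" using split[OF "1.prems" 3] by blast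
    obtain F1 where F1: "finite F1" "F1 \<subseteq> P" "\<forall>X\<in>F1. Q1 \<le> X" "\<forall>X\<in>P. Q1 \<le> X \<longrightarrow> (\<exists>Y\<in>F1. Y \<le> X)"
      using "1.IH"[of Q1] Q "1.prems" by auto
    obtain F2 where F2: "finite F2" "F2 \<subseteq> P" "\<forall>X\<in>F2. Q2 \<le> X" "\<forall>X\<in>P. Q2 \<le> X \<longrightarrow> (\<exists>Y\<in>F2. Y \<le> X)"
      using "1.IH"[of Q2] Q "1.prems" by auto
    have "\<forall>X\<in>F1 \<union> F2. Q \<le> X" using F1(3) F2(3) Q(3,4) by (meson UnE less_imp_le order_trans)
    moreover have "\<forall>X\<in>P. Q \<le> X \<longrightarrow> (\<exists>Y\<in>F1 \<union> F2. Y \<le> X)" using F1(4) F2(4) Q(5) by blast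
    ultimately show ?thesis using F1(1,2) F2(1,2) by (intro exI[of _ "F1 \<union> F2"]) auto
  qed
qed

locale noetherian_local = cring R + noetherian_ring R for R :: "('a, 'b) ring_scheme" (structure) +
  fixes m :: "'a set"
  assumes maximal: "maximalideal m R"
    and unique: "maximalideal n R \<Longrightarrow> n = m"
begin

lemma ideal_m: "ideal m R"
  using maximal maximalideal.axioms(1) by blast

lemma ex_maximal_ideal:
  assumes "\<Phi> I" "\<And>I. \<Phi> I \<Longrightarrow> ideal I R"
  obtains M where "\<Phi> M" "\<And>X. \<Phi> X \<Longrightarrow> M \<subseteq> X \<Longrightarrow> X = M"
proof -
  have "\<exists>M\<in>Collect \<Phi>. \<forall>X\<in>Collect \<Phi>. M \<subseteq> X \<longrightarrow> X = M"
  proof (rule subset_Zorn_nonempty)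
    show "Collect \<Phi> \<noteq> {}" using assms(1) by blast
    fix C assume C: "C \<noteq> {}" "subset.chain (Collect \<Phi>) C"
    then have "subset.chain {I. ideal I R} C"
      using assms(2) unfolding pred_on.chain_def by auto
    then have "\<Union> C \<in> C" using ideal_chain_is_trivial C by blast
    then show "\<Union> C \<in> Collect \<Phi>" using C(2) unfolding pred_on.chain_def by auto
  qed
  then show ?thesis using that by blast
qed

text \<open>The ascending chain condition as well-foundedness, with larger ideals lower in the
  relation. It serves Noetherian induction and matches the hypothesis of
  \<open>finite_minimal_elements\<close>.\<close>

lemma wf_ideals: "wf {(Y, X). X \<in> {I. ideal I R} \<and> Y \<in> {I. ideal I R} \<and> X < Y}"
proof (rule wfI_min)
  fix x :: "'a set" and Q assume x: "x \<in> Q"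
  show "\<exists>z\<in>Q. \<forall>y. (y, z) \<in> {(Y, X). X \<in> {I. ideal I R} \<and> Y \<in> {I. ideal I R} \<and> X < Y} \<longrightarrow> y \<notin> Q"
  proof (cases "\<exists>I\<in>Q. ideal I R")
    case True
    then obtain I where I: "I \<in> Q \<and> ideal I R" by blast
    obtain M where M: "M \<in> Q \<and> ideal M R" "\<And>X. X \<in> Q \<and> ideal X R \<Longrightarrow> M \<subseteq> X \<Longrightarrow> X = M"
      by (rule ex_maximal_ideal[of "\<lambda>I. I \<in> Q \<and> ideal I R", OF I]) auto
    then show ?thesis by (intro bexI[of _ M]) auto
  qed (use x in blast)
qed

lemma proper_ideal_le_m:
  assumes "ideal I R" "I \<noteq> carrier R"
  shows "I \<subseteq> m"
proof -
  define \<Phi> where "\<Phi> = (\<lambda>K. ideal K R \<and> I \<subseteq> K \<and> K \<noteq> carrier R)"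
  have "\<Phi> I" using assms unfolding \<Phi>_def by simp
  then obtain M where "\<Phi> M" and max: "\<And>X. \<Phi> X \<Longrightarrow> M \<subseteq> X \<Longrightarrow> X = M"
    by (rule ex_maximal_ideal) (auto simp: \<Phi>_def)
  then have M: "ideal M R" "I \<subseteq> M" "M \<noteq> carrier R" unfolding \<Phi>_def by auto
  have "maximalideal M R"
  proof (rule maximalidealI)
    fix X assume "ideal X R" "M \<subseteq> X"
    then show "X = M \<or> X = carrier R" using max[of X] M(2) unfolding \<Phi>_def by blast
  qed (use M in auto)
  then show ?thesis using unique M by blast
qed

lemma inverse_of_not_m:
  assumes "c \<in> carrier R" "c \<notin> m"
  obtains c' where "c' \<in> carrier R" "c' \<otimes> c = \<one>"
proof -
  have "PIdl c = carrier R"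
    using proper_ideal_le_m[OF cgenideal_ideal[OF assms(1)]] cgenideal_self[OF assms(1)] assms(2) by blast
  then have "\<one> \<in> PIdl c" by simp
  then show ?thesis using that unfolding cgenideal_def by auto
qed

lemma m_not_carrier: "m \<noteq> carrier R"
  using maximal maximalideal.I_notcarr by blast

lemma one_not_m: "\<one> \<notin> m"
  using m_not_carrier ideal.one_imp_carrier[OF ideal_m] by blast

lemma prime_m: "primeideal m R"
  using maximal maximalideal_prime by blast

lemma primeideal_le_m: "primeideal P R \<Longrightarrow> P \<subseteq> m"
  using proper_ideal_le_m primeideal.axioms(1) primeideal.I_notcarr by metis

text \<open>The chain condition replaces a choice of generators of \<open>V\<close>. If
  \<open>V\<close> is not inside \<open>K\<close>, an ideal \<open>W\<close> maximal among those
  that contain \<open>K \<inter> V\<close> and lie strictly inside \<open>V\<close> makes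
  \<open>V / W\<close> cyclic, and the unit argument is needed for one generator only.\<close>

lemma nakayama:
  assumes V: "ideal V R" and K: "ideal K R" and sub: "V \<subseteq> (m \<cdot> V) <+>\<^bsub>R\<^esub> K"
  shows "V \<subseteq> K"
proof (rule ccontr)
  assume nV: "\<not> V \<subseteq> K"
  define \<Phi> where "\<Phi> = (\<lambda>W. ideal W R \<and> K \<inter> V \<subseteq> W \<and> W \<subset> V)"
  have "\<Phi> (K \<inter> V)" using nV i_intersect[OF K V] unfolding \<Phi>_def by auto
  then obtain W where "\<Phi> W" and max: "\<And>X. \<Phi> X \<Longrightarrow> W \<subseteq> X \<Longrightarrow> X = W"
    by (rule ex_maximal_ideal) (auto simp: \<Phi>_def)
  then have W: "ideal W R" "K \<inter> V \<subseteq> W" "W \<subset> V" unfolding \<Phi>_def by auto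
  obtain v where v: "v \<in> V" "v \<notin> W" using W by blast
  have vc: "v \<in> carrier R" using v ideal_subset[OF V] by blast
  have L: "ideal (adjoin R W v m) R" by (rule adjoin_ideal[OF W(1) vc ideal_m])
  have WL: "W \<subseteq> adjoin R W v m" by (rule adjoin_super[OF W(1) vc ideal_m])
  have Vgen: "adjoin R W v (carrier R) = V"
  proof (rule ccontr)
    assume ne: "adjoin R W v (carrier R) \<noteq> V"
    have "adjoin R W v (carrier R) \<subseteq> V"
      by (rule adjoin_least[OF V]) (use W v ideal_rmult[OF V] in auto)
    with ne have "\<Phi> (adjoin R W v (carrier R))"
      using adjoin_ideal[OF W(1) vc oneideal] adjoin_super[OF W(1) vc oneideal] W unfolding \<Phi>_def by blast
    with max adjoin_super[OF W(1) vc oneideal] have "adjoin R W v (carrier R) = W" by blast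
    then show False using v adjoin_self[OF W(1) vc] by blast
  qed
  have "m \<cdot> V \<subseteq> adjoin R W v m"
  proof (rule ideal_prod_subset[OF L])
    fix c u assume c: "c \<in> m" and u: "u \<in> V"
    then obtain w r where wr: "w \<in> W" "r \<in> carrier R" "u = w \<oplus> v \<otimes> r" using Vgen unfolding adjoin_def by blast
    have cc: "c \<in> carrier R" "w \<in> carrier R" using c wr ideal_subset[OF ideal_m] ideal_subset[OF W(1)] by auto
    have "c \<otimes> u = c \<otimes> w \<oplus> v \<otimes> (c \<otimes> r)" unfolding wr using cc wr vc by algebra
    moreover have "c \<otimes> w \<in> W" "c \<otimes> r \<in> m"
      using ideal_lmult[OF W(1) cc(1) wr(1)] ideal_rmult[OF ideal_m wr(2) c] by auto
    ultimately show "c \<otimes> u \<in> adjoin R W v m" unfolding adjoin_def by blast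
  qed
  moreover have "v \<in> (m \<cdot> V) <+>\<^bsub>R\<^esub> K" using sub v by blast
  then obtain p k where pk: "p \<in> m \<cdot> V" "k \<in> K" "v = p \<oplus> k" unfolding set_add_def' by blast
  moreover have pV: "p \<in> V" using pk ideal_prod_inter[OF ideal_m V] by blast
  have "k \<in> carrier R" using pk ideal_subset[OF K] by blast
  then have "k \<in> V" using ideal_add_cancel[OF V] pV v pk by blast
  then have "k \<in> W" using pk W by blast
  ultimately have "v \<in> adjoin R W v m" using ideal_add[OF L] WL by blast
  then obtain w c where wc: "w \<in> W" "c \<in> m" "v = w \<oplus> v \<otimes> c" unfolding adjoin_def by blast
  have cc: "c \<in> carrier R" "w \<in> carrier R" using wc ideal_subset[OF ideal_m] ideal_subset[OF W(1)] by auto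
  \<comment> \<open>With \<open>1 - c\<close> invertible, \<open>v = w + v c\<close> forces
    \<open>v\<close> into \<open>W\<close>.\<close>
  have "\<one> \<ominus> c \<notin> m"
  proof
    assume "\<one> \<ominus> c \<in> m"
    then have "(\<one> \<ominus> c) \<oplus> c \<in> m" using ideal_add[OF ideal_m] wc by blast
    moreover have "(\<one> \<ominus> c) \<oplus> c = \<one>" using cc by algebra
    ultimately show False using one_not_m by simp
  qed
  then obtain e where e: "e \<in> carrier R" "e \<otimes> (\<one> \<ominus> c) = \<one>" using inverse_of_not_m[of "\<one> \<ominus> c"] cc by auto
  have "v \<ominus> v \<otimes> c = w"
  proof -
    have "v \<ominus> v \<otimes> c = (w \<oplus> v \<otimes> c) \<ominus> v \<otimes> c" using wc(3) by simp
    also have "\<dots> = w" using cc vc by algebra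
    finally show ?thesis .
  qed
  moreover have "v \<ominus> v \<otimes> c = (\<one> \<ominus> c) \<otimes> v" using cc vc by algebra
  ultimately have "e \<otimes> w = e \<otimes> ((\<one> \<ominus> c) \<otimes> v)" by simp
  also have "\<dots> = (e \<otimes> (\<one> \<ominus> c)) \<otimes> v" by (rule m_assoc[symmetric]) (use e cc vc in auto)
  finally have "e \<otimes> w = (e \<otimes> (\<one> \<ominus> c)) \<otimes> v" .
  then have "e \<otimes> w = v" using e vc by simp
  then show False using ideal_lmult[OF W(1) e(1) wc(1)] v by simp
qed

section \<open>Avoiding finitely many ideals over an infinite residue field\<close>

lemma residue_representatives:
  assumes "infinite (carrier (R Quot m))"
  obtains C where "infinite C" "C \<subseteq> carrier R" "\<And>c c'. c \<in> C \<Longrightarrow> c' \<in> C \<Longrightarrow> c \<noteq> c' \<Longrightarrow> c \<ominus> c' \<notin> m"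
proof -
  define f where "f = (\<lambda>X. SOME c. c \<in> carrier R \<and> X = m +> c)"
  have f: "f X \<in> carrier R" "X = m +> f X" if "X \<in> carrier (R Quot m)" for X
  proof -
    have "\<exists>c. c \<in> carrier R \<and> X = m +> c" using that unfolding FactRing_def A_RCOSETS_def' by auto
    then have "f X \<in> carrier R \<and> X = m +> f X" unfolding f_def by (rule someI_ex)
    then show "f X \<in> carrier R" "X = m +> f X" by auto
  qed
  have "inj_on f (carrier (R Quot m))" by (rule inj_onI) (metis f(2))
  then have "infinite (f ` carrier (R Quot m))" using assms finite_imageD by blast
  moreover have "f ` carrier (R Quot m) \<subseteq> carrier R" using f(1) by blast
  moreover have "c \<ominus> c' \<notin> m" if c: "c \<in> f ` carrier (R Quot m)" "c' \<in> f ` carrier (R Quot m)" "c \<noteq> c'" for c c'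
  proof
    assume "c \<ominus> c' \<in> m"
    obtain X X' where X: "X \<in> carrier (R Quot m)" "c = f X" "X' \<in> carrier (R Quot m)" "c' = f X'" using c by blast
    then have "X = X'"
      using quotient_eq_iff_same_a_r_cos[OF ideal_m, of c c'] f \<open>c \<ominus> c' \<in> m\<close> by metis
    then show False using X c(3) by simp
  qed
  ultimately show ?thesis using that by blast
qed

text \<open>Arbitrary ideals can be avoided, not just primes, and the graded pieces of relevant
  primes are of this general kind. Points \<open>v + c u\<close> with incongruent values of
  \<open>c\<close> differ by a unit multiple of \<open>u\<close>, so an ideal that misses
  \<open>u\<close> contains at most one of them; infinitely many residues leave a good
  choice.\<close>

lemma ideal_avoidance:
  assumes inf: "infinite (carrier (R Quot m))" and V: "ideal V R"
    and "finite \<W>" "\<And>W. W \<in> \<W> \<Longrightarrow> ideal W R" "\<And>W. W \<in> \<W> \<Longrightarrow> \<not> V \<subseteq> W"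
  shows "\<exists>v\<in>V. \<forall>W\<in>\<W>. v \<notin> W"
  using assms(3-5)
proof (induction \<W> rule: finite_induct)
  case empty
  then show ?case using ideal_zero[OF V] by blast
next
  case (insert U \<W>)
  obtain u where u: "u \<in> V" "\<forall>W\<in>\<W>. u \<notin> W" using insert by auto
  show ?case
  proof (cases "u \<in> U")
    case False
    then show ?thesis using u by blast
  next
    case True
    obtain v where v: "v \<in> V" "v \<notin> U" using insert.prems by blast
    obtain C where C: "infinite C" "C \<subseteq> carrier R" "\<And>c c'. c \<in> C \<Longrightarrow> c' \<in> C \<Longrightarrow> c \<noteq> c' \<Longrightarrow> c \<ominus> c' \<notin> m"
      using residue_representatives[OF inf] by blast
    have uv: "u \<in> carrier R" "v \<in> carrier R" using u v ideal_subset[OF V] by auto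
    have U: "ideal U R" using insert.prems by blast
    have bad: "finite {c\<in>C. v \<oplus> c \<otimes> u \<in> W}" if W: "W \<in> \<W>" for W
    proof -
      have iW: "ideal W R" using W insert.prems by blast
      have "c = c'" if c: "c \<in> C" "v \<oplus> c \<otimes> u \<in> W" "c' \<in> C" "v \<oplus> c' \<otimes> u \<in> W" for c c'
      proof (rule ccontr)
        assume "c \<noteq> c'"
        then obtain e where e: "e \<in> carrier R" "e \<otimes> (c \<ominus> c') = \<one>"
          using inverse_of_not_m[of "c \<ominus> c'"] C c by auto
        have cc: "c \<in> carrier R" "c' \<in> carrier R" using C c by auto
        have "(v \<oplus> c \<otimes> u) \<ominus> (v \<oplus> c' \<otimes> u) = (c \<ominus> c') \<otimes> u" using cc uv by algebra
        then have "(c \<ominus> c') \<otimes> u \<in> W" using ideal_minus[OF iW c(2,4)] by simp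
        then have "e \<otimes> ((c \<ominus> c') \<otimes> u) \<in> W" using ideal_lmult[OF iW e(1)] by blast
        moreover have "e \<otimes> ((c \<ominus> c') \<otimes> u) = u" using e cc uv by (simp add: m_assoc[symmetric])
        ultimately show False using u W by auto
      qed
      then have "\<exists>c. {c\<in>C. v \<oplus> c \<otimes> u \<in> W} \<subseteq> {c}" by blast
      then show ?thesis using finite_subset by blast
    qed
    have "finite (\<Union>W\<in>\<W>. {c\<in>C. v \<oplus> c \<otimes> u \<in> W})" using bad insert.hyps by blast
    then have "\<not> C \<subseteq> (\<Union>W\<in>\<W>. {c\<in>C. v \<oplus> c \<otimes> u \<in> W})" using C(1) finite_subset by blast
    then obtain c where c: "c \<in> C" "\<forall>W\<in>\<W>. v \<oplus> c \<otimes> u \<notin> W" by blast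
    have cc: "c \<in> carrier R" using C c by auto
    have "v \<oplus> c \<otimes> u \<in> V" using ideal_add[OF V v(1)] ideal_lmult[OF V cc u(1)] by blast
    \<comment> \<open>The new ideal \<open>U\<close> excludes no \<open>c\<close> at all: it
      contains \<open>u\<close> but not \<open>v\<close>.\<close>
    moreover have "v \<oplus> c \<otimes> u \<notin> U"
    proof
      assume "v \<oplus> c \<otimes> u \<in> U"
      then have "c \<otimes> u \<oplus> v \<in> U" using cc uv by (simp add: a_comm)
      then show False using ideal_add_cancel[OF U _ ideal_lmult[OF U cc True] uv(2)] v(2) by blast
    qed
    ultimately show ?thesis using c(2) by auto
  qed
qed

lemma finite_minimal_primes:
  assumes "ideal K R"
  shows "\<exists>F. finite F \<and> (\<forall>P\<in>F. primeideal P R \<and> K \<subseteq> P) \<and>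
    (\<forall>P. primeideal P R \<longrightarrow> K \<subseteq> P \<longrightarrow> (\<exists>P'\<in>F. P' \<subseteq> P))"
proof -
  have "\<exists>Q1\<in>{I. ideal I R}. \<exists>Q2\<in>{I. ideal I R}. Q < Q1 \<and> Q < Q2 \<and>
      (\<forall>X\<in>{P. primeideal P R}. Q \<le> X \<longrightarrow> Q1 \<le> X \<or> Q2 \<le> X)"
    if Q: "Q \<in> {I. ideal I R}" "Q \<notin> {P. primeideal P R}" "\<exists>X\<in>{P. primeideal P R}. Q \<le> X" for Q
  proof -
    have iQ: "ideal Q R" using Q by simp
    have "Q \<noteq> carrier R"
      using Q(3) primeideal.I_notcarr primeideal.axioms(1) ideal_subset by (metis mem_Collect_eq subset_antisym)
    then have "\<exists>x\<in>carrier R. \<exists>y\<in>carrier R. x \<otimes> y \<in> Q \<and> x \<notin> Q \<and> y \<notin> Q"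
      using primeidealI[OF iQ is_cring] Q(2) by auto
    then obtain x y where xy: "x \<in> carrier R" "y \<in> carrier R" "x \<otimes> y \<in> Q" "x \<notin> Q" "y \<notin> Q" by blast
    let ?Q = "\<lambda>x. adjoin R Q x (carrier R)"
    have le: "?Q z \<subseteq> X" if "primeideal X R" "Q \<subseteq> X" "z \<in> X" for z X
      by (rule adjoin_least) (use that primeideal.axioms(1) ideal_rmult in blast)+
    have "\<forall>X\<in>{P. primeideal P R}. Q \<le> X \<longrightarrow> ?Q x \<le> X \<or> ?Q y \<le> X"
      using primeideal.I_prime[OF _ xy(1,2)] le xy(3) by (metis mem_Collect_eq subsetD)
    moreover have "Q \<subset> ?Q x" "Q \<subset> ?Q y"
      using adjoin_super[OF iQ _ oneideal] adjoin_self[OF iQ] xy by blast+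
    moreover have "ideal (?Q x) R" "ideal (?Q y) R" using adjoin_ideal[OF iQ _ oneideal] xy by auto
    ultimately show ?thesis by blast
  qed
  from finite_minimal_elements[OF wf_ideals this, of K] assms
  obtain F where "finite F" "F \<subseteq> {P. primeideal P R}" "\<forall>X\<in>F. K \<le> X"
    "\<forall>X\<in>{P. primeideal P R}. K \<le> X \<longrightarrow> (\<exists>Y\<in>F. Y \<le> X)" by blast
  then show ?thesis by (intro exI[of _ F]) auto
qed

section \<open>Systems of parameters\<close>

definition prime_chain :: "nat \<Rightarrow> 'a set \<Rightarrow> bool" where
  "prime_chain l P \<longleftrightarrow> (\<exists>Q. (\<forall>i\<le>l. primeideal (Q i) R) \<and> (\<forall>i<l. Q i \<subset> Q (Suc i)) \<and> Q l = P)"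

lemma prime_chain_0: "primeideal P R \<Longrightarrow> prime_chain 0 P"
  unfolding prime_chain_def by (intro exI[of _ "\<lambda>_. P"]) simp

lemma prime_chain_Suc:
  assumes "prime_chain l P'" "P' \<subset> P" "primeideal P R"
  shows "prime_chain (Suc l) P"
proof -
  obtain Q where Q: "\<forall>i\<le>l. primeideal (Q i) R" "\<forall>i<l. Q i \<subset> Q (Suc i)" "Q l = P'"
    using assms unfolding prime_chain_def by blast
  let ?Q = "Q(Suc l := P)"
  have "?Q i \<subset> ?Q (Suc i)" if "i < Suc l" for i
    using that Q assms(2) by (cases "i = l") auto
  moreover have "primeideal (?Q i) R" if "i \<le> Suc l" for i
    using that Q assms(3) by (cases "i = Suc l") auto
  ultimately show ?thesis unfolding prime_chain_def by (intro exI[of _ ?Q]) auto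
qed

lemma prime_chain_le_dim:
  assumes "prime_chain l P" "krull_dim R = enat d"
  shows "l \<le> d"
proof -
  have "enat l \<le> krull_dim R"
    unfolding krull_dim_def by (rule SUP_upper) (use assms(1) in \<open>auto simp: prime_chain_def\<close>)
  then show ?thesis using assms(2) by simp
qed

text \<open>Each further element raises the height of the primes above the list: it avoids every
  member other than \<open>m\<close> of a finite set of primes below which no prime over the earlier
  elements falls. A prime over the longer list thus lies strictly above such a member, or equals
  \<open>m\<close>.\<close>

lemma ex_partial_parameters:
  assumes inf: "infinite (carrier (R Quot m))" and V: "ideal V R"
    and Vm: "\<And>P. primeideal P R \<Longrightarrow> V \<subseteq> P \<Longrightarrow> P = m"
  shows "\<exists>xs. length xs = l \<and> set xs \<subseteq> V \<and>
    (\<forall>P. primeideal P R \<longrightarrow> set xs \<subseteq> P \<longrightarrow> P = m \<or> prime_chain l P)"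
proof (induction l)
  case 0
  then show ?case using prime_chain_0 by (intro exI[of _ "[]"]) auto
next
  case (Suc l)
  then obtain xs where xs: "length xs = l" "set xs \<subseteq> V"
    "\<And>P. primeideal P R \<Longrightarrow> set xs \<subseteq> P \<Longrightarrow> P = m \<or> prime_chain l P" by blast
  have xc: "set xs \<subseteq> carrier R" using xs ideal_subset[OF V] by blast
  obtain F where F: "finite F" "\<And>P. P \<in> F \<Longrightarrow> primeideal P R \<and> Idl (set xs) \<subseteq> P"
    "\<And>P. primeideal P R \<Longrightarrow> Idl (set xs) \<subseteq> P \<Longrightarrow> \<exists>P'\<in>F. P' \<subseteq> P"
    using finite_minimal_primes[OF genideal_ideal[OF xc]] by blast
  \<comment> \<open>The ideal \<open>m\<close> is left out because it can contain \<open>V\<close>;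
    the conclusion admits it as an exceptional prime.\<close>
  have "\<exists>v\<in>V. \<forall>W\<in>F - {m}. v \<notin> W"
  proof (rule ideal_avoidance[OF inf V])
    show "finite (F - {m})" using F(1) by simp
    fix W assume "W \<in> F - {m}"
    then have W: "primeideal W R" "W \<noteq> m" using F(2) by auto
    show "ideal W R" using primeideal.axioms(1)[OF W(1)] .
    show "\<not> V \<subseteq> W" using Vm W by blast
  qed
  then obtain v where v: "v \<in> V" "\<And>W. W \<in> F \<Longrightarrow> W \<noteq> m \<Longrightarrow> v \<notin> W" by blast
  have "P = m \<or> prime_chain (Suc l) P" if P: "primeideal P R" "set (v # xs) \<subseteq> P" for P
  proof -
    have "Idl (set xs) \<subseteq> P" by (rule genideal_minimal) (use P primeideal.axioms(1) in auto)
    then obtain P' where P': "P' \<in> F" "P' \<subseteq> P" using F(3) P(1) by blast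
    have pP': "primeideal P' R" "set xs \<subseteq> P'" using F(2)[OF P'(1)] genideal_self[OF xc] by auto
    show ?thesis
    proof (cases "P' = m")
      case True
      then show ?thesis using P' primeideal_le_m[OF P(1)] by blast
    next
      case False
      then have "v \<notin> P'" using v(2) P' by blast
      then have "P' \<subset> P" using P' P by auto
      moreover have "prime_chain l P'" using xs(3)[OF pP'] False by blast
      ultimately show ?thesis using prime_chain_Suc P(1) by blast
    qed
  qed
  then show ?case using xs v(1) by (intro exI[of _ "v # xs"]) auto
qed

lemma ex_parameters:
  assumes "infinite (carrier (R Quot m))" "ideal V R" "krull_dim R = enat d"
    and "\<And>P. primeideal P R \<Longrightarrow> V \<subseteq> P \<Longrightarrow> P = m"
  shows "\<exists>xs. length xs = d \<and> set xs \<subseteq> V \<and> (\<forall>P. primeideal P R \<longrightarrow> set xs \<subseteq> P \<longrightarrow> P = m)"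
proof -
  obtain xs where xs: "length xs = d" "set xs \<subseteq> V"
    "\<And>P. primeideal P R \<Longrightarrow> set xs \<subseteq> P \<Longrightarrow> P = m \<or> prime_chain d P"
    using ex_partial_parameters[OF assms(1,2,4)] by blast
  have "P = m" if P: "primeideal P R" "set xs \<subseteq> P" for P
  proof (rule ccontr)
    assume ne: "P \<noteq> m"
    then have "prime_chain d P" using xs(3) P by blast
    then have "prime_chain (Suc d) m" using prime_chain_Suc prime_m primeideal_le_m[OF P(1)] ne by blast
    then show False using prime_chain_le_dim assms(3) by fastforce
  qed
  then show ?thesis using xs by blast
qed

section \<open>Finite length when \<open>m\<close> is the only prime above\<close>

lemma length_le_m: "length_le R m (carrier R) 1"
proof -
  \<comment> \<open>The upper end must vary for the induction: a step above \<open>m\<close> ends in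
    the whole ring, and nothing can follow it.\<close>
  have "k = 0 \<or> k = 1 \<and> K = carrier R" if "ideal_chain R I K k" "I = m" for I K k
    using that
  proof (induction rule: ideal_chain.induct)
    case (chain_step I L k K)
    have L: "ideal L R" "m \<subseteq> L" using ideal_chainD[OF chain_step.hyps(1)] chain_step.prems by auto
    have "K = carrier R" using proper_ideal_le_m[OF chain_step.hyps(2)] L chain_step.hyps(3) by blast
    moreover have "L \<noteq> carrier R" using chain_step.hyps(2,3) ideal_subset by blast
    ultimately show ?case using chain_step by auto
  qed simp
  then show ?thesis unfolding length_le_def by fastforce
qed

text \<open>Noetherian induction. If \<open>x y\<close> lies in \<open>K\<close> but neither factor
  does, then the length of \<open>R / K\<close> is at most that of \<open>R / (K : x)\<close> plus
  that of \<open>R / (K + x R)\<close>. Both ideals are strictly larger than \<open>K\<close>, the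
  colon because it contains \<open>y\<close>. The prime case is the field
  \<open>R / m\<close>.\<close>

lemma ex_length_le:
  assumes "ideal K R" "\<And>P. primeideal P R \<Longrightarrow> K \<subseteq> P \<Longrightarrow> P = m"
  shows "\<exists>h. length_le R K (carrier R) h"
  using assms
proof (induction K rule: wf_induct_rule[OF wf_ideals])
  case (1 K)
  note K = "1.prems"(1)
  have IH: "\<exists>h. length_le R L (carrier R) h" if "ideal L R" "K \<subset> L" for L
    using "1.IH"[of L] "1.prems" that by auto
  consider "K = carrier R" | "primeideal K R" | "K \<noteq> carrier R" "\<not> primeideal K R" by blast
  then show ?case
  proof cases
    case 1
    then show ?thesis using length_le_refl by blast
  next
    case 2
    then show ?thesis using "1.prems"(2) length_le_m by blast
  next
    case 3
    then have "\<exists>x\<in>carrier R. \<exists>y\<in>carrier R. x \<otimes> y \<in> K \<and> x \<notin> K \<and> y \<notin> K"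
      using primeidealI[OF K is_cring] by auto
    then obtain x y where xy: "x \<in> carrier R" "y \<in> carrier R" "x \<otimes> y \<in> K" "x \<notin> K" "y \<notin> K" by blast
    have iC: "ideal (colon R K x) R" by (rule colon_ideal[OF K xy(1)])
    have "K \<subset> colon R K x"
      using xy ideal_lmult[OF K xy(1)] ideal_subset[OF K] unfolding colon_def by blast
    then obtain h where h: "length_le R (colon R K x) (carrier R) h" using IH iC by blast
    have A: "ideal (adjoin R K x (carrier R)) R" "K \<subseteq> adjoin R K x (carrier R)" "x \<in> adjoin R K x (carrier R)"
      using adjoin_ideal[OF K xy(1) oneideal] adjoin_super[OF K xy(1) oneideal] adjoin_self[OF K xy(1)] by auto
    then obtain h' where h': "length_le R (adjoin R K x (carrier R)) (carrier R) h'" using IH xy(4) by blast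
    have "length_le R K (adjoin R K x (carrier R)) h"
      by (rule length_le_adjoin[OF K xy(1) iC _ h]) (simp add: colon_def)
    then show ?thesis using length_le_split[OF _ h' A(1,2) ideal_subset[OF A(1)]] by blast
  qed
qed

end

section \<open>Multi-indexed powers of ideals\<close>

definition unit_index :: "'s \<Rightarrow> 's \<Rightarrow> nat" where
  "unit_index i = (\<lambda>j. if j = i then 1 else 0)"

lemma multiindex_induct:
  fixes P :: "('s::finite \<Rightarrow> nat) \<Rightarrow> bool"
  assumes "P 0" "\<And>n i. P n \<Longrightarrow> P (n + unit_index i)"
  shows "P n"
proof (induction "\<Sum>i\<in>UNIV. n i" arbitrary: n)
  case 0
  then have "n = 0" by (auto simp: fun_eq_iff)
  then show ?case using assms(1) by blast
next
  case (Suc k)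
  have "\<not> (\<forall>i. n i = 0)"
  proof
    assume "\<forall>i. n i = 0"
    then have "(\<Sum>i\<in>UNIV. n i) = 0" by simp
    then show False using Suc.hyps(2) by simp
  qed
  then obtain i where i: "n i \<noteq> 0" by blast
  define n' where "n' = (\<lambda>j. n j - unit_index i j)"
  have n: "n = n' + unit_index i" using i by (auto simp: fun_eq_iff n'_def unit_index_def)
  have "(\<Sum>j\<in>UNIV. unit_index i j) = 1" by (simp add: unit_index_def)
  then have "(\<Sum>j\<in>UNIV. n j) = (\<Sum>j\<in>UNIV. n' j) + 1" by (subst n) (simp add: sum.distrib)
  then have "P n'" using Suc by auto
  then show ?case using assms(2) n by metis
qed

lemma add_diff_multiindex: "\<delta> \<le> n \<Longrightarrow> (n - \<delta>) + \<delta> = (n :: 's \<Rightarrow> nat)"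
  by (auto simp: le_fun_def fun_eq_iff)

lemma add_diff_multiindex': "\<delta> \<le> n \<Longrightarrow> \<delta> + (n - \<delta>) = (n :: 's \<Rightarrow> nat)"
  by (auto simp: le_fun_def fun_eq_iff)

context cring
begin

lemma ideals_set_simps:
  "carrier (ideals_set R) = {I. ideal I R}" "I \<otimes>\<^bsub>ideals_set R\<^esub> K = I \<cdot> K"
  "\<one>\<^bsub>ideals_set R\<^esub> = carrier R"
  by (simp_all add: ideals_set_def)

end

locale multi_ideals = noetherian_local R m for R :: "('a, 'b) ring_scheme" (structure) and m +
  fixes J :: "'s::finite \<Rightarrow> 'a set"
  assumes J_ideal: "ideal (J i) R"
    and J_le_m: "J i \<subseteq> m"
begin

sublocale ideals: comm_monoid "ideals_set R"
  by (rule ideals_set_is_comm_monoid)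

definition mpow :: "('s \<Rightarrow> nat) \<Rightarrow> 'a set" where
  "mpow n = finprod (ideals_set R) (\<lambda>i. J i [^]\<^bsub>ideals_set R\<^esub> n i) UNIV"

lemma J_in: "J i \<in> carrier (ideals_set R)"
  using J_ideal by (simp add: ideals_set_simps)

lemma mpow_ideal: "ideal (mpow n) R"
proof -
  have "mpow n \<in> carrier (ideals_set R)"
    unfolding mpow_def by (rule ideals.finprod_closed) (simp add: J_in)
  then show ?thesis by (simp add: ideals_set_simps)
qed

lemma mpow_subset: "mpow n \<subseteq> carrier R"
  using ideal_subset mpow_ideal .

lemma mpow_0: "mpow 0 = carrier R"
proof -
  have "mpow 0 = finprod (ideals_set R) (\<lambda>i::'s. \<one>\<^bsub>ideals_set R\<^esub>) UNIV"
    unfolding mpow_def by (rule ideals.finprod_cong') (auto simp: J_in)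
  also have "\<dots> = \<one>\<^bsub>ideals_set R\<^esub>" by (rule ideals.finprod_one)
  finally show ?thesis by (simp add: ideals_set_simps)
qed

lemma mpow_add: "mpow (n + k) = mpow n \<cdot> mpow k"
proof -
  have "mpow (n + k) = finprod (ideals_set R)
      (\<lambda>i. J i [^]\<^bsub>ideals_set R\<^esub> n i \<otimes>\<^bsub>ideals_set R\<^esub> J i [^]\<^bsub>ideals_set R\<^esub> k i) UNIV"
    unfolding mpow_def by (rule ideals.finprod_cong') (auto simp: J_in ideals.nat_pow_mult)
  also have "\<dots> = mpow n \<otimes>\<^bsub>ideals_set R\<^esub> mpow k"
    unfolding mpow_def by (rule ideals.finprod_multf) (auto simp: J_in)
  finally show ?thesis by (simp add: ideals_set_simps)
qed

lemma mpow_mult: "u \<in> mpow n \<Longrightarrow> v \<in> mpow k \<Longrightarrow> u \<otimes> v \<in> mpow (n + k)"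
  unfolding mpow_add by (rule ideal_prod.prod)

lemma mpow_single: "mpow (\<lambda>j. if j = i then l else 0) = J i [^]\<^bsub>ideals_set R\<^esub> l"
proof -
  have "mpow (\<lambda>j. if j = i then l else 0) =
      finprod (ideals_set R) (\<lambda>j. if i = j then J j [^]\<^bsub>ideals_set R\<^esub> l else \<one>\<^bsub>ideals_set R\<^esub>) UNIV"
    unfolding mpow_def by (rule ideals.finprod_cong') (auto simp: J_in)
  also have "\<dots> = J i [^]\<^bsub>ideals_set R\<^esub> l"
    by (rule ideals.finprod_singleton) (auto simp: J_in)
  finally show ?thesis .
qed

lemma mpow_unit: "mpow (unit_index i) = J i"
  unfolding unit_index_def mpow_single using J_in ideals.nat_pow_eone by simp

lemma mpow_antimono:
  assumes "n \<le> k"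
  shows "mpow k \<subseteq> mpow n"
proof -
  have "mpow k = mpow n \<cdot> mpow (k - n)" using mpow_add add_diff_multiindex'[OF assms] by metis
  then show ?thesis using ideal_prod_inter[OF mpow_ideal mpow_ideal] by auto
qed

lemma m_mpow_ideal: "ideal (m \<cdot> mpow n) R"
  using ideal_prod_is_ideal ideal_m mpow_ideal by blast

lemma m_mpow_subset: "m \<cdot> mpow n \<subseteq> mpow n"
  using ideal_prod_inter[OF ideal_m mpow_ideal] by blast

lemma m_mpow_mult:
  assumes "u \<in> mpow k" "v \<in> m \<cdot> mpow n"
  shows "u \<otimes> v \<in> m \<cdot> mpow (n + k)"
proof -
  have u: "u \<in> carrier R" using assms mpow_subset by blast
  have "m \<cdot> mpow n \<subseteq> colon R (m \<cdot> mpow (n + k)) u"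
  proof (rule ideal_prod_subset[OF colon_ideal[OF m_mpow_ideal u]])
    fix c w assume cw: "c \<in> m" "w \<in> mpow n"
    then have cc: "c \<in> carrier R" "w \<in> carrier R" using ideal_subset[OF ideal_m] mpow_subset by auto
    have "u \<otimes> (c \<otimes> w) = c \<otimes> (w \<otimes> u)" using u cc by algebra
    then show "c \<otimes> w \<in> colon R (m \<cdot> mpow (n + k)) u"
      unfolding colon_def using cc ideal_prod.prod[OF cw(1) mpow_mult[OF cw(2) assms(1)]] by simp
  qed
  then show ?thesis using assms(2) unfolding colon_def by blast
qed

text \<open>Here \<open>J_i \<subseteq> m\<close> enters. The fibre \<open>J^n / m J^n\<close>
  becomes a quotient of \<open>J^n / J^(n + e_i)\<close>, so chains found in fibres of successive
  degrees can be stacked inside \<open>R\<close>.\<close>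

lemma mpow_add_unit_subset: "mpow (n + unit_index i) \<subseteq> m \<cdot> mpow n"
proof -
  have "mpow n \<cdot> J i \<subseteq> m \<cdot> mpow n"
  proof (rule ideal_prod_subset[OF m_mpow_ideal])
    fix u v assume uv: "u \<in> mpow n" "v \<in> J i"
    then have "u \<otimes> v = v \<otimes> u" using mpow_subset ideal_subset[OF J_ideal] m_comm by (meson subsetD)
    then show "u \<otimes> v \<in> m \<cdot> mpow n" using ideal_prod.prod[of v m u "mpow n" R] uv J_le_m by auto
  qed
  then show ?thesis by (simp add: mpow_add mpow_unit)
qed

section \<open>Homogeneous ideals of the fibre ring\<close>

text \<open>
  A homogeneous ideal of \<open>\<Oplus>\<^sub>n J\<^sup>n / m J\<^sup>n\<close> is represented by the family of the preimages in \<open>J\<^sup>n\<close> of its graded pieces.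
\<close>

definition fibre_ideal :: "(('s \<Rightarrow> nat) \<Rightarrow> 'a set) \<Rightarrow> bool" where
  "fibre_ideal P \<longleftrightarrow> (\<forall>n. ideal (P n) R \<and> m \<cdot> mpow n \<subseteq> P n \<and> P n \<subseteq> mpow n) \<and>
     (\<forall>n k. \<forall>x\<in>mpow k. \<forall>y\<in>P n. x \<otimes> y \<in> P (n + k))"

lemma fibre_idealD:
  assumes "fibre_ideal P"
  shows "ideal (P n) R" "m \<cdot> mpow n \<subseteq> P n" "P n \<subseteq> mpow n"
    "x \<in> mpow k \<Longrightarrow> y \<in> P n \<Longrightarrow> x \<otimes> y \<in> P (n + k)"
  using assms unfolding fibre_ideal_def by blast+

lemma fibre_ideal_zero: "fibre_ideal (\<lambda>n. m \<cdot> mpow n)"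
  unfolding fibre_ideal_def using m_mpow_ideal m_mpow_subset m_mpow_mult by blast

text \<open>The homogeneous ideal generated by \<open>P\<close> and an element \<open>y\<close> of
  degree \<open>\<delta>\<close>. The case distinction guards against truncated subtraction, which
  would let \<open>y\<close> contribute in degrees that are not above
  \<open>\<delta>\<close>.\<close>

definition fibre_adjoin :: "(('s \<Rightarrow> nat) \<Rightarrow> 'a set) \<Rightarrow> 'a \<Rightarrow> ('s \<Rightarrow> nat) \<Rightarrow> ('s \<Rightarrow> nat) \<Rightarrow> 'a set" where
  "fibre_adjoin P y \<delta> n = (if \<delta> \<le> n then adjoin R (P n) y (mpow (n - \<delta>)) else P n)"

lemma fibre_adjoin_super:
  assumes "fibre_ideal P" "y \<in> mpow \<delta>"
  shows "P \<le> fibre_adjoin P y \<delta>"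
  using adjoin_super[OF fibre_idealD(1)[OF assms(1)] _ mpow_ideal] assms(2) mpow_subset
  unfolding fibre_adjoin_def le_fun_def by (auto simp: subset_iff)

lemma fibre_adjoin_mult:
  assumes "fibre_ideal P" "y \<in> mpow \<delta>" "v \<in> mpow n"
  shows "y \<otimes> v \<in> fibre_adjoin P y \<delta> (n + \<delta>)"
proof -
  have "\<delta> \<le> n + \<delta>" "n + \<delta> - \<delta> = n" by (auto simp: le_fun_def fun_eq_iff)
  moreover have "y \<otimes> v \<in> adjoin R (P (n + \<delta>)) y (mpow n)"
    by (rule adjoin_mult[OF fibre_idealD(1)[OF assms(1)] _ mpow_ideal assms(3)])
      (use assms(2) mpow_subset in blast)
  ultimately show ?thesis unfolding fibre_adjoin_def by simp
qed

lemma fibre_adjoin_self: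
  assumes "fibre_ideal P" "y \<in> mpow \<delta>"
  shows "y \<in> fibre_adjoin P y \<delta> \<delta>"
proof -
  have "y \<in> carrier R" using assms(2) mpow_subset by blast
  then have "y \<otimes> \<one> = y" by simp
  moreover have "y \<otimes> \<one> \<in> fibre_adjoin P y \<delta> (0 + \<delta>)"
    by (rule fibre_adjoin_mult[OF assms]) (simp add: mpow_0)
  ultimately show ?thesis by (simp only: add_0)
qed

lemma fibre_adjoin_ideal:
  assumes P: "fibre_ideal P" and y: "y \<in> mpow \<delta>"
  shows "fibre_ideal (fibre_adjoin P y \<delta>)"
  unfolding fibre_ideal_def
proof (intro conjI allI ballI)
  have yc: "y \<in> carrier R" using y mpow_subset by blast
  note PD = fibre_idealD[OF P]
  show "ideal (fibre_adjoin P y \<delta> n) R" for n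
    unfolding fibre_adjoin_def using adjoin_ideal[OF PD(1) yc mpow_ideal] PD(1) by simp
  show "m \<cdot> mpow n \<subseteq> fibre_adjoin P y \<delta> n" for n
    using fibre_adjoin_super[OF assms] PD(2)[of n] by (auto simp: le_fun_def)
  show "fibre_adjoin P y \<delta> n \<subseteq> mpow n" for n
  proof (cases "\<delta> \<le> n")
    case True
    have "y \<otimes> w \<in> mpow n" if "w \<in> mpow (n - \<delta>)" for w
      using mpow_mult[OF y that] add_diff_multiindex'[OF True] by simp
    then have "adjoin R (P n) y (mpow (n - \<delta>)) \<subseteq> mpow n" by (intro adjoin_least[OF mpow_ideal PD(3)])
    then show ?thesis using True by (simp add: fibre_adjoin_def)
  qed (simp add: fibre_adjoin_def PD(3))
  fix n k x u assume x: "x \<in> mpow k" and u: "u \<in> fibre_adjoin P y \<delta> n"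
  have xc: "x \<in> carrier R" using x mpow_subset by blast
  show "x \<otimes> u \<in> fibre_adjoin P y \<delta> (n + k)"
  proof (cases "\<delta> \<le> n")
    case True
    then obtain p w where pw: "p \<in> P n" "w \<in> mpow (n - \<delta>)" "u = p \<oplus> y \<otimes> w"
      using u unfolding fibre_adjoin_def adjoin_def by auto
    have c: "p \<in> carrier R" "w \<in> carrier R" using pw PD(3) mpow_subset by blast+
    have le: "\<delta> \<le> n + k" using True by (auto simp: le_fun_def trans_le_add1)
    have "w \<otimes> x \<in> mpow (n - \<delta> + k)" using mpow_mult[OF pw(2) x] .
    moreover have "n - \<delta> + k = n + k - \<delta>" using True by (auto simp: fun_eq_iff le_fun_def)
    ultimately have "w \<otimes> x \<in> mpow (n + k - \<delta>)" by simp
    moreover have "x \<otimes> u = x \<otimes> p \<oplus> y \<otimes> (w \<otimes> x)" unfolding pw using xc yc c by algebra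
    ultimately show ?thesis using PD(4)[OF x pw(1)] le unfolding fibre_adjoin_def adjoin_def by auto
  next
    case False
    then have "x \<otimes> u \<in> P (n + k)" using u PD(4)[OF x] unfolding fibre_adjoin_def by simp
    then show ?thesis using fibre_adjoin_super[OF assms] by (auto simp: le_fun_def)
  qed
qed

lemma fibre_adjoin_least:
  assumes "fibre_ideal P" "fibre_ideal Q" "P \<le> Q" "y \<in> Q \<delta>"
  shows "fibre_adjoin P y \<delta> \<le> Q"
proof (rule le_funI)
  fix n
  have PQ: "P n \<subseteq> Q n" using assms(3) by (simp add: le_fun_def)
  show "fibre_adjoin P y \<delta> n \<subseteq> Q n"
  proof (cases "\<delta> \<le> n")
    case True
    have "y \<otimes> w \<in> Q n" if w: "w \<in> mpow (n - \<delta>)" for w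
    proof -
      have "w \<otimes> y \<in> Q n" using fibre_idealD(4)[OF assms(2) w assms(4)] add_diff_multiindex'[OF True] by simp
      moreover have "w \<otimes> y = y \<otimes> w"
        using w assms(4) fibre_idealD(3)[OF assms(2)] mpow_subset m_comm by (meson subsetD)
      ultimately show ?thesis by simp
    qed
    then show ?thesis using True adjoin_least[OF fibre_idealD(1)[OF assms(2)] PQ] by (simp add: fibre_adjoin_def)
  qed (simp add: fibre_adjoin_def PQ)
qed

end

section \<open>Dickson's lemma and the ascending chain condition\<close>

text \<open>The entries of \<open>A\<close> are treated one after another by passing to
  subsequences. A monotone subsequence of naturals that is not increasing is decreasing, hence
  constant once it reaches its least value, so dropping an initial segment makes it increasing
  too.\<close>

lemma ex_subseq_mono_counts:
  fixes f :: "nat \<Rightarrow> 'x multiset"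
  assumes "finite A"
  shows "\<exists>g :: nat \<Rightarrow> nat. strict_mono g \<and> (\<forall>a\<in>A. mono (\<lambda>n. count (f (g n)) a))"
  using assms
proof (induction A rule: finite_induct)
  case empty
  show ?case by (intro exI[of _ "\<lambda>n. n"]) (simp add: strict_mono_def)
next
  case (insert a A)
  then obtain g :: "nat \<Rightarrow> nat" where g: "strict_mono g" "\<forall>a\<in>A. mono (\<lambda>n. count (f (g n)) a)" by blast
  obtain h :: "nat \<Rightarrow> nat" where h: "strict_mono h" "monoseq (\<lambda>n. count (f (g (h n))) a)"
    using seq_monosub[of "\<lambda>n. count (f (g n)) a"] by blast
  have "\<exists>N. mono (\<lambda>n. count (f (g (h (n + N)))) a)"
  proof (cases "mono (\<lambda>n. count (f (g (h n))) a)")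
    case True
    then show ?thesis by (intro exI[of _ 0]) simp
  next
    case False
    then have dec: "count (f (g (h k))) a \<le> count (f (g (h n))) a" if "n \<le> k" for n k
      using h(2) that unfolding monoseq_def mono_def by blast
    define c where "c = (LEAST c. \<exists>n. count (f (g (h n))) a = c)"
    have "\<exists>n. count (f (g (h n))) a = c" unfolding c_def by (rule LeastI_ex) blast
    then obtain N where N: "count (f (g (h N))) a = c" by blast
    have "count (f (g (h (n + N)))) a = c" for n
    proof (rule antisym)
      show "count (f (g (h (n + N)))) a \<le> c" using dec[of N "n + N"] N by simp
      show "c \<le> count (f (g (h (n + N)))) a" unfolding c_def by (rule Least_le) blast
    qed
    then show ?thesis by (intro exI[of _ N]) (simp add: mono_def)
  qed
  then obtain N where N: "mono (\<lambda>n. count (f (g (h (n + N)))) a)" by blast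
  let ?g = "\<lambda>n. g (h (n + N))"
  have hm: "strict_mono (\<lambda>n. h (n + N))" using h(1) by (simp add: strict_mono_def)
  have "strict_mono ?g" using g(1) hm by (simp add: strict_mono_def)
  moreover have "mono (\<lambda>n. count (f (?g n)) b)" if "b \<in> A" for b
  proof (rule monoI)
    fix x y :: nat assume "x \<le> y"
    then have "h (x + N) \<le> h (y + N)" using monoD[OF strict_mono_mono[OF hm]] by blast
    then show "count (f (?g x)) b \<le> count (f (?g y)) b" using g(2) that by (simp add: mono_def)
  qed
  ultimately show ?case using N by (intro exI[of _ ?g]) auto
qed

lemma dickson:
  fixes f :: "nat \<Rightarrow> 'x multiset"
  assumes "finite A" "\<And>n. set_mset (f n) \<subseteq> A"
  shows "\<exists>i j. i < j \<and> f i \<subseteq># f j"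
proof -
  obtain g :: "nat \<Rightarrow> nat" where g: "strict_mono g" "\<forall>a\<in>A. mono (\<lambda>n. count (f (g n)) a)"
    using ex_subseq_mono_counts[OF assms(1)] by blast
  have "count (f (g 0)) a \<le> count (f (g 1)) a" for a
  proof (cases "a \<in> A")
    case True
    then show ?thesis using g(2) by (simp add: mono_def)
  next
    case False
    then have "a \<notin># f (g 0)" using assms(2) by blast
    then show ?thesis by (simp add: not_in_iff)
  qed
  then have "f (g 0) \<subseteq># f (g 1)" by (simp add: subseteq_mset_def)
  moreover have "g 0 < g 1" using g(1) by (simp add: strict_mono_def)
  ultimately show ?thesis by blast
qed

text \<open>One list numbers the generators of all the ideals \<open>J i\<close>, and
  \<open>grp\<close> records the ideal for which an entry is listed. Multisets of numbers then serve
  as exponent vectors, and \<open>grp\<close> supplies the multidegree.\<close>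

locale multi_ideals_gens = multi_ideals R m J for R :: "('a, 'b) ring_scheme" (structure) and m
    and J :: "'s::finite \<Rightarrow> 'a set" +
  fixes x :: "nat \<Rightarrow> 'a" and grp :: "nat \<Rightarrow> 's" and N :: nat
  assumes x_in: "k < N \<Longrightarrow> x k \<in> J (grp k)"
    and J_gen: "J i \<subseteq> Idl {x k |k. k < N \<and> grp k = i}"
begin

section \<open>Monomials in the generators and their leading terms\<close>

definition monom :: "nat multiset \<Rightarrow> 'a" where
  "monom M = (\<Otimes>k\<in>{..<N}. x k [^] count M k)"

text \<open>Entries from \<open>N\<close> on are ignored by \<open>monom\<close> but counted by
  \<open>mdeg\<close>. Excluding them makes the two agree and provides the finite alphabet for
  Dickson's lemma.\<close>

definition valid :: "nat multiset \<Rightarrow> bool" where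
  "valid M \<longleftrightarrow> set_mset M \<subseteq> {..<N}"

definition mdeg :: "nat multiset \<Rightarrow> 's \<Rightarrow> nat" where
  "mdeg M = count (image_mset grp M)"

lemma x_carrier: "k < N \<Longrightarrow> x k \<in> carrier R"
  using x_in ideal_subset[OF J_ideal] by blast

lemma monom_carrier: "monom M \<in> carrier R"
  unfolding monom_def using x_carrier by (intro finprod_closed) auto

lemma monom_empty: "monom {#} = \<one>"
proof -
  have "monom {#} = (\<Otimes>k\<in>{..<N}. \<one>)" unfolding monom_def by (rule finprod_cong') auto
  then show ?thesis by simp
qed

lemma monom_add: "monom (M + M') = monom M \<otimes> monom M'"
proof -
  have "monom (M + M') = (\<Otimes>k\<in>{..<N}. x k [^] count M k \<otimes> x k [^] count M' k)"
    unfolding monom_def by (rule finprod_cong') (auto simp: x_carrier nat_pow_mult)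
  also have "\<dots> = monom M \<otimes> monom M'"
    unfolding monom_def by (rule finprod_multf) (auto simp: x_carrier)
  finally show ?thesis .
qed

lemma monom_single:
  assumes "k < N"
  shows "monom {#k#} = x k"
proof -
  have "monom {#k#} = (\<Otimes>j\<in>{..<N}. if k = j then x j else \<one>)"
    unfolding monom_def by (rule finprod_cong') (auto simp: x_carrier)
  also have "\<dots> = x k" by (rule finprod_singleton) (auto simp: assms x_carrier)
  finally show ?thesis .
qed

lemma mdeg_add: "mdeg (M + M') = mdeg M + mdeg M'"
  by (simp add: mdeg_def fun_eq_iff)

lemma mdeg_empty: "mdeg {#} = 0"
  by (simp add: mdeg_def fun_eq_iff)

lemma mdeg_single: "mdeg {#k#} = unit_index (grp k)"
  by (simp add: mdeg_def unit_index_def fun_eq_iff)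

lemma valid_add: "valid (M + M') \<longleftrightarrow> valid M \<and> valid M'"
  by (simp add: valid_def)

lemma monom_in_mpow: "valid M \<Longrightarrow> monom M \<in> mpow (mdeg M)"
proof (induction M)
  case empty
  show ?case unfolding monom_empty mdeg_empty mpow_0 by simp
next
  case (add k M)
  then have k: "k < N" "valid M" by (auto simp: valid_def)
  have "monom {#k#} \<in> mpow (mdeg {#k#})"
    using monom_single[OF k(1)] mdeg_single mpow_unit x_in[OF k(1)] by simp
  then have "monom ({#k#} + M) \<in> mpow (mdeg ({#k#} + M))"
    unfolding monom_add mdeg_add using mpow_mult add.IH k(2) by blast
  then show ?case by simp
qed

lemma mpow_gen: "mpow n \<subseteq> Idl {monom M |M. valid M \<and> mdeg M = n}"
proof (induction n rule: multiindex_induct)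
  case 1
  have "monom {#} \<in> {monom M |M. valid M \<and> mdeg M = 0}"
    using mdeg_empty by (force simp: valid_def)
  then have "\<one> \<in> Idl {monom M |M. valid M \<and> mdeg M = 0}"
    using genideal_self[of "{monom M |M. valid M \<and> mdeg M = 0}"] monom_carrier monom_empty by auto
  then have "Idl {monom M |M. valid M \<and> mdeg M = 0} = carrier R"
    by (intro ideal.one_imp_carrier genideal_ideal) (use monom_carrier in auto)
  then show ?case using mpow_subset by blast
next
  case (2 n i)
  let ?G = "\<lambda>n. {monom M |M. valid M \<and> mdeg M = n}"
  have sub: "?G k \<subseteq> carrier R" for k using monom_carrier by blast
  note G = genideal_ideal[OF sub]
  have "mpow n \<cdot> J i \<subseteq> Idl (?G (n + unit_index i))"
  proof (rule ideal_prod_subset[OF G])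
    fix u v assume uv: "u \<in> mpow n" "v \<in> J i"
    have uc: "u \<in> carrier R" "v \<in> carrier R" using uv mpow_subset ideal_subset[OF J_ideal] by auto
    have *: "x k \<otimes> u \<in> Idl (?G (n + unit_index i))" if k: "k < N" "grp k = i" for k
    proof -
      have "?G n \<subseteq> colon R (Idl (?G (n + unit_index i))) (x k)"
      proof
        fix w assume "w \<in> ?G n"
        then obtain M where M: "valid M" "mdeg M = n" "w = monom M" by blast
        have "valid (M + {#k#})" using M k by (simp add: valid_def)
        moreover have "mdeg (M + {#k#}) = n + unit_index i" using M k by (simp only: mdeg_add mdeg_single)
        ultimately have "monom (M + {#k#}) \<in> ?G (n + unit_index i)" by blast
        moreover have "monom (M + {#k#}) = x k \<otimes> w"
          unfolding monom_add M(3) monom_single[OF k(1)] using monom_carrier x_carrier k m_comm by simp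
        ultimately show "w \<in> colon R (Idl (?G (n + unit_index i))) (x k)"
          using genideal_self[OF sub] monom_carrier M(3) unfolding colon_def by auto
      qed
      then have "Idl (?G n) \<subseteq> colon R (Idl (?G (n + unit_index i))) (x k)"
        by (rule genideal_minimal[OF colon_ideal[OF G x_carrier[OF k(1)]]])
      then show ?thesis using uv(1) 2 unfolding colon_def by blast
    qed
    have "{x k |k. k < N \<and> grp k = i} \<subseteq> colon R (Idl (?G (n + unit_index i))) u"
    proof
      fix w assume "w \<in> {x k |k. k < N \<and> grp k = i}"
      then obtain k where k: "k < N" "grp k = i" "w = x k" by blast
      then show "w \<in> colon R (Idl (?G (n + unit_index i))) u"
        using *[OF k(1,2)] x_carrier[OF k(1)] uc m_comm unfolding colon_def by auto
    qed
    then have "Idl {x k |k. k < N \<and> grp k = i} \<subseteq> colon R (Idl (?G (n + unit_index i))) u"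
      by (rule genideal_minimal[OF colon_ideal[OF G uc(1)]])
    then show "u \<otimes> v \<in> Idl (?G (n + unit_index i))" using J_gen uv(2) unfolding colon_def by blast
  qed
  then show ?case unfolding mpow_add mpow_unit .
qed

text \<open>The multiset order acts as a term order: it is a well-order compatible with addition.
  The monomials need not be independent in the fibre ring, so an element has no unique expansion;
  leading terms are read off from this filtration of \<open>J^n / m J^n\<close> instead.\<close>

definition lower :: "('s \<Rightarrow> nat) \<Rightarrow> nat multiset \<Rightarrow> 'a set" where
  "lower n M = Idl ({monom F |F. valid F \<and> mdeg F = n \<and> F < M} \<union> m \<cdot> mpow n)"

lemma lower_sub: "{monom F |F. valid F \<and> mdeg F = n \<and> F < M} \<union> m \<cdot> mpow n \<subseteq> carrier R"
  using monom_carrier ideal_subset[OF m_mpow_ideal] by blast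

lemma lower_ideal: "ideal (lower n M) R"
  unfolding lower_def by (rule genideal_ideal[OF lower_sub])

lemma monom_in_lower: "valid F \<Longrightarrow> mdeg F = n \<Longrightarrow> F < M \<Longrightarrow> monom F \<in> lower n M"
  unfolding lower_def using genideal_self[OF lower_sub] by blast

lemma m_mpow_lower: "m \<cdot> mpow n \<subseteq> lower n M"
  unfolding lower_def using genideal_self[OF lower_sub] by blast

lemma lower_mono: "M \<le> M' \<Longrightarrow> lower n M \<subseteq> lower n M'"
  unfolding lower_def by (rule genideal_mono[OF _ lower_sub]) (use order_less_le_trans in blast)

text \<open>Existence of a leading term. Those elements that have one, together with
  \<open>m J^n\<close>, form an ideal: in a sum the larger leading monomial prevails, and equal ones
  add their coefficients. The coefficient may lie in \<open>m\<close>, so a cancellation calls for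
  no further descent here.\<close>

lemma lower_cases:
  assumes "u \<in> lower n M"
  shows "u \<in> m \<cdot> mpow n \<or> (\<exists>F c. valid F \<and> mdeg F = n \<and> F < M \<and> c \<in> carrier R \<and> u \<ominus> c \<otimes> monom F \<in> lower n F)"
proof -
  define U where "U = m \<cdot> mpow n \<union>
    {u \<in> carrier R. \<exists>F c. valid F \<and> mdeg F = n \<and> F < M \<and> c \<in> carrier R \<and> u \<ominus> c \<otimes> monom F \<in> lower n F}"
  have UI: "u \<in> U" if "u \<in> carrier R" "valid F" "mdeg F = n" "F < M" "c \<in> carrier R" "u \<ominus> c \<otimes> monom F \<in> lower n F" for u F c
    using that unfolding U_def by blast
  have mc: "m \<cdot> mpow n \<subseteq> carrier R" by (rule ideal_subset[OF m_mpow_ideal])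
  have lead: "u \<in> U" if u: "u \<in> carrier R" "valid F" "mdeg F = n" "F < M" "c \<in> carrier R" "w \<in> lower n F" "u = c \<otimes> monom F \<oplus> w" for u F c w
  proof (rule UI[OF u(1-5)])
    have "w \<in> carrier R" using u(6) ideal_subset[OF lower_ideal] by blast
    then have "u \<ominus> c \<otimes> monom F = w" unfolding u(7) using u(5) monom_carrier[of F] by algebra
    then show "u \<ominus> c \<otimes> monom F \<in> lower n F" using u(6) by simp
  qed
  have dest: "\<exists>w\<in>lower n F. u = c \<otimes> monom F \<oplus> w" if u: "u \<in> carrier R" "c \<in> carrier R" "u \<ominus> c \<otimes> monom F \<in> lower n F" for u F c
    by (rule bexI[OF _ u(3)]) (use u monom_carrier[of F] in algebra)
  have lc: "w \<in> carrier R" if "w \<in> lower n F" for w F using that ideal_subset[OF lower_ideal] by blast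
  have cl: "c \<otimes> monom F \<in> lower n F'" if "valid F" "mdeg F = n" "F < F'" "c \<in> carrier R" for c F F'
    using ideal_lmult[OF lower_ideal that(4) monom_in_lower[OF that(1-3)]] .
  have "ideal U R"
  proof (rule idealI_cring)
    show "U \<subseteq> carrier R" unfolding U_def using mc by blast
    show "\<zero> \<in> U" unfolding U_def using ideal_zero[OF m_mpow_ideal] by blast
    fix u v assume u: "u \<in> U"
    have uc: "u \<in> carrier R" using u mc unfolding U_def by blast
    { assume v: "v \<in> U"
      have vc: "v \<in> carrier R" using v mc unfolding U_def by blast
      show "u \<oplus> v \<in> U"
      proof (cases "u \<in> m \<cdot> mpow n")
        case um: True
        show ?thesis
        proof (cases "v \<in> m \<cdot> mpow n")
          case True
          then show ?thesis unfolding U_def using um ideal_add[OF m_mpow_ideal] by blast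
        next
          case False
          then obtain F c where F: "valid F" "mdeg F = n" "F < M" "c \<in> carrier R" "v \<ominus> c \<otimes> monom F \<in> lower n F"
            using v unfolding U_def by blast
          obtain w where w: "w \<in> lower n F" "v = c \<otimes> monom F \<oplus> w" using dest[OF vc F(4,5)] by blast
          show ?thesis
          proof (rule lead[OF _ F(1-4)])
            show "u \<oplus> w \<in> lower n F" using um m_mpow_lower ideal_add[OF lower_ideal] w(1) by blast
            show "u \<oplus> v = c \<otimes> monom F \<oplus> (u \<oplus> w)"
              unfolding w(2) using uc F(4) monom_carrier[of F] lc[OF w(1)] by algebra
          qed (use uc vc in simp)
        qed
      next
        case False
        then obtain F c where F: "valid F" "mdeg F = n" "F < M" "c \<in> carrier R" "u \<ominus> c \<otimes> monom F \<in> lower n F"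
          using u unfolding U_def by blast
        obtain w where w: "w \<in> lower n F" "u = c \<otimes> monom F \<oplus> w" using dest[OF uc F(4,5)] by blast
        show ?thesis
        proof (cases "v \<in> m \<cdot> mpow n")
          case True
          show ?thesis
          proof (rule lead[OF _ F(1-4)])
            show "v \<oplus> w \<in> lower n F" using True m_mpow_lower ideal_add[OF lower_ideal] w(1) by blast
            show "u \<oplus> v = c \<otimes> monom F \<oplus> (v \<oplus> w)"
              unfolding w(2) using vc F(4) monom_carrier[of F] lc[OF w(1)] by algebra
          qed (use uc vc in simp)
        next
          case False
          then obtain F' c' where F': "valid F'" "mdeg F' = n" "F' < M" "c' \<in> carrier R" "v \<ominus> c' \<otimes> monom F' \<in> lower n F'"
            using v unfolding U_def by blast
          obtain w' where w': "w' \<in> lower n F'" "v = c' \<otimes> monom F' \<oplus> w'" using dest[OF vc F'(4,5)] by blast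
          note cc = F(4) F'(4) monom_carrier[of F] monom_carrier[of F'] lc[OF w(1)] lc[OF w'(1)]
          consider "F < F'" | "F' < F" | "F = F'" by fastforce
          then show ?thesis
          proof cases
            case 1
            show ?thesis
            proof (rule lead[OF _ F'(1-4)])
              show "c \<otimes> monom F \<oplus> w \<oplus> w' \<in> lower n F'"
                using cl[OF F(1,2) 1 F(4)] lower_mono[of F F' n] 1 w(1) w'(1) ideal_add[OF lower_ideal]
                by (meson less_imp_le subsetD)
              show "u \<oplus> v = c' \<otimes> monom F' \<oplus> (c \<otimes> monom F \<oplus> w \<oplus> w')"
                unfolding w(2) w'(2) using cc by algebra
            qed (use uc vc in simp)
          next
            case 2
            show ?thesis
            proof (rule lead[OF _ F(1-4)])
              show "c' \<otimes> monom F' \<oplus> w' \<oplus> w \<in> lower n F"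
                using cl[OF F'(1,2) 2 F'(4)] lower_mono[of F' F n] 2 w(1) w'(1) ideal_add[OF lower_ideal]
                by (meson less_imp_le subsetD)
              show "u \<oplus> v = c \<otimes> monom F \<oplus> (c' \<otimes> monom F' \<oplus> w' \<oplus> w)"
                unfolding w(2) w'(2) using cc by algebra
            qed (use uc vc in simp)
          next
            case 3
            show ?thesis
            proof (rule lead[OF _ F(1-3)])
              show "c \<oplus> c' \<in> carrier R" using cc by simp
              show "w \<oplus> w' \<in> lower n F" using w(1) w'(1) 3 ideal_add[OF lower_ideal] by simp
              show "u \<oplus> v = (c \<oplus> c') \<otimes> monom F \<oplus> (w \<oplus> w')"
                unfolding w(2) w'(2) 3 using cc 3 by algebra
            qed (use uc vc in simp)
          qed
        qed
      qed }
    fix a assume a: "a \<in> carrier R"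
    show "a \<otimes> u \<in> U"
    proof (cases "u \<in> m \<cdot> mpow n")
      case True
      then show ?thesis unfolding U_def using ideal_lmult[OF m_mpow_ideal a] by blast
    next
      case False
      then obtain F c where F: "valid F" "mdeg F = n" "F < M" "c \<in> carrier R" "u \<ominus> c \<otimes> monom F \<in> lower n F"
        using u unfolding U_def by blast
      obtain w where w: "w \<in> lower n F" "u = c \<otimes> monom F \<oplus> w" using dest[OF uc F(4,5)] by blast
      show ?thesis
      proof (rule lead[OF _ F(1-3)])
        show "a \<otimes> c \<in> carrier R" using a F by simp
        show "a \<otimes> w \<in> lower n F" by (rule ideal_lmult[OF lower_ideal a w(1)])
        show "a \<otimes> u = a \<otimes> c \<otimes> monom F \<oplus> a \<otimes> w"
          unfolding w(2) using a F(4) monom_carrier[of F] lc[OF w(1)] by algebra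
      qed (use a uc in simp)
    qed
  qed
  moreover have "{monom F |F. valid F \<and> mdeg F = n \<and> F < M} \<union> m \<cdot> mpow n \<subseteq> U"
  proof
    fix u assume "u \<in> {monom F |F. valid F \<and> mdeg F = n \<and> F < M} \<union> m \<cdot> mpow n"
    then consider "u \<in> m \<cdot> mpow n" | F where "valid F" "mdeg F = n" "F < M" "u = monom F" by blast
    then show "u \<in> U"
    proof cases
      case (2 F)
      show ?thesis
        by (rule lead[OF _ 2(1-3) one_closed ideal_zero[OF lower_ideal]]) (use 2 monom_carrier in auto)
    qed (simp add: U_def)
  qed
  ultimately have "lower n M \<subseteq> U" unfolding lower_def by (rule genideal_minimal)
  then show ?thesis using assms unfolding U_def by blast
qed

text \<open>The ideals \<open>lower n M\<close> are directed, as \<open>M + M'\<close> dominates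
  both summands; their union is therefore an ideal, and it contains all monomials of degree
  \<open>n\<close>.\<close>

lemma mpow_lower:
  assumes "u \<in> mpow n"
  shows "\<exists>M. u \<in> lower n M"
proof -
  define U where "U = (\<Union>M. lower n M)"
  have "ideal U R"
  proof (rule idealI_cring)
    show "U \<subseteq> carrier R" unfolding U_def using ideal_subset[OF lower_ideal] by blast
    show "\<zero> \<in> U" unfolding U_def using ideal_zero[OF lower_ideal] by blast
    show "a \<otimes> u \<in> U" if "a \<in> carrier R" "u \<in> U" for a u
      using that ideal_lmult[OF lower_ideal] unfolding U_def by blast
    fix u v assume "u \<in> U" "v \<in> U"
    then obtain M M' where "u \<in> lower n M" "v \<in> lower n M'" unfolding U_def by blast
    moreover have "lower n M \<subseteq> lower n (M + M')" "lower n M' \<subseteq> lower n (M + M')"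
      by (rule lower_mono, simp add: subset_eq_imp_le_multiset)+
    ultimately have "u \<oplus> v \<in> lower n (M + M')" using ideal_add[OF lower_ideal] by (meson subsetD)
    then show "u \<oplus> v \<in> U" unfolding U_def by blast
  qed
  moreover have "{monom M |M. valid M \<and> mdeg M = n} \<subseteq> U"
  proof
    fix u assume "u \<in> {monom M |M. valid M \<and> mdeg M = n}"
    then obtain M where M: "valid M" "mdeg M = n" "u = monom M" by blast
    \<comment> \<open>Any strictly larger multiset will do; the entry \<open>0\<close> is arbitrary,
      since the bound does not have to be valid.\<close>
    have "M < M + {#0#}" by simp
    then show "u \<in> U" unfolding U_def M(3) using monom_in_lower[OF M(1,2)] by blast
  qed
  ultimately have "Idl {monom M |M. valid M \<and> mdeg M = n} \<subseteq> U" by (rule genideal_minimal)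
  then show ?thesis using assms mpow_gen unfolding U_def by blast
qed

text \<open>The initial ideal of the preimage of \<open>P\<close> in a polynomial ring over the
  residue field. In particular it contains each valid monomial that is already a combination of
  smaller ones in the fibre ring, with \<open>u\<close> equal to zero.\<close>

definition leading :: "(('s \<Rightarrow> nat) \<Rightarrow> 'a set) \<Rightarrow> nat multiset set" where
  "leading P = {M. valid M \<and> (\<exists>u\<in>P (mdeg M). u \<ominus> monom M \<in> lower (mdeg M) M)}"

lemma monom_mult_lower:
  assumes "valid G" "u \<in> lower n M"
  shows "monom G \<otimes> u \<in> lower (n + mdeg G) (M + G)"
proof -
  let ?C = "colon R (lower (n + mdeg G) (M + G)) (monom G)"
  have "{monom F |F. valid F \<and> mdeg F = n \<and> F < M} \<union> m \<cdot> mpow n \<subseteq> ?C"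
  proof
    fix w assume w: "w \<in> {monom F |F. valid F \<and> mdeg F = n \<and> F < M} \<union> m \<cdot> mpow n"
    have wc: "w \<in> carrier R" using w lower_sub by blast
    have "monom G \<otimes> w \<in> lower (n + mdeg G) (M + G)"
    proof (cases "w \<in> m \<cdot> mpow n")
      case True
      then show ?thesis using m_mpow_mult[OF monom_in_mpow[OF assms(1)]] m_mpow_lower by blast
    next
      case False
      then obtain F where F: "valid F" "mdeg F = n" "F < M" "w = monom F" using w by blast
      have "monom (F + G) \<in> lower (n + mdeg G) (M + G)"
        by (rule monom_in_lower) (use F assms(1) in \<open>simp_all add: valid_add mdeg_add\<close>)
      then show ?thesis unfolding F(4) monom_add using m_comm monom_carrier by metis
    qed
    then show "w \<in> ?C" using wc by (simp add: colon_def)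
  qed
  then have "lower n M \<subseteq> ?C"
    unfolding lower_def[of n] by (rule genideal_minimal[OF colon_ideal[OF lower_ideal monom_carrier]])
  then show ?thesis using assms(2) by (auto simp: colon_def)
qed

lemma leading_upward:
  assumes P: "fibre_ideal P" and M: "M \<in> leading P" "M \<subseteq># M'" "valid M'"
  shows "M' \<in> leading P"
proof -
  obtain G where G: "M' = M + G" using M(2) by (metis subset_mset.le_iff_add)
  have vG: "valid G" using M(3) G by (simp add: valid_add)
  obtain u where u: "u \<in> P (mdeg M)" "u \<ominus> monom M \<in> lower (mdeg M) M" using M(1) unfolding leading_def by blast
  have uc: "u \<in> carrier R" using u fibre_idealD(3)[OF P] mpow_subset by blast
  have "monom G \<otimes> u \<in> P (mdeg M')"
    unfolding G mdeg_add by (rule fibre_idealD(4)[OF P monom_in_mpow[OF vG] u(1)])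
  moreover have "monom G \<otimes> (u \<ominus> monom M) \<in> lower (mdeg M') M'"
    unfolding G mdeg_add by (rule monom_mult_lower[OF vG u(2)])
  moreover have "monom G \<otimes> (u \<ominus> monom M) = monom G \<otimes> u \<ominus> monom M'"
    unfolding G monom_add using uc monom_carrier[of M] monom_carrier[of G] by algebra
  ultimately show ?thesis unfolding leading_def using M(3) by auto
qed

text \<open>Reduction of an element of \<open>P'\<close> by elements of \<open>P\<close>. A leading
  coefficient in \<open>m\<close> puts the leading term into \<open>m J^n\<close>; any other is a
  unit, and an element of \<open>P\<close> with the same leading monomial cancels it. The well-order
  stops the descent.\<close>

lemma le_if_leading_subset:
  assumes P: "fibre_ideal P" and P': "fibre_ideal P'" and le: "P \<le> P'" and lead: "leading P' \<subseteq> leading P"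
  shows "P' \<le> P"
proof (rule le_funI)
  fix n
  have "u \<in> P n" if "u \<in> P' n" "u \<in> lower n M" for u M
    using that
  proof (induction M arbitrary: u rule: less_induct)
    case (less M)
    have uc: "u \<in> carrier R" using less.prems ideal_subset[OF lower_ideal] by blast
    have PP: "P n \<subseteq> P' n" using le by (simp add: le_fun_def)
    from lower_cases[OF less.prems(2)] show ?case
    proof
      assume "u \<in> m \<cdot> mpow n"
      then show ?thesis using fibre_idealD(2)[OF P] by blast
    next
      assume "\<exists>F c. valid F \<and> mdeg F = n \<and> F < M \<and> c \<in> carrier R \<and> u \<ominus> c \<otimes> monom F \<in> lower n F"
      then obtain F c where F: "valid F" "mdeg F = n" "F < M" "c \<in> carrier R" "u \<ominus> c \<otimes> monom F \<in> lower n F" by blast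
      note mc = monom_carrier[of F]
      show ?thesis
      proof (cases "c \<in> m")
        case True
        have "c \<otimes> monom F \<in> m \<cdot> mpow n" using ideal_prod.prod[OF True monom_in_mpow[OF F(1)]] F(2) by simp
        then have "c \<otimes> monom F \<in> lower n F" using m_mpow_lower by blast
        then have "(u \<ominus> c \<otimes> monom F) \<oplus> c \<otimes> monom F \<in> lower n F" using ideal_add[OF lower_ideal F(5)] by blast
        moreover have "(u \<ominus> c \<otimes> monom F) \<oplus> c \<otimes> monom F = u" using uc F(4) mc by algebra
        ultimately show ?thesis using less.IH[OF F(3) less.prems(1)] by simp
      next
        case False
        then obtain e where e: "e \<in> carrier R" "e \<otimes> c = \<one>" using inverse_of_not_m F(4) by blast
        have "e \<otimes> (u \<ominus> c \<otimes> monom F) = e \<otimes> u \<ominus> (e \<otimes> c) \<otimes> monom F" using e(1) uc F(4) mc by algebra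
        then have eq: "e \<otimes> (u \<ominus> c \<otimes> monom F) = e \<otimes> u \<ominus> monom F" using e(2) mc by simp
        have "e \<otimes> (u \<ominus> c \<otimes> monom F) \<in> lower n F" by (rule ideal_lmult[OF lower_ideal e(1) F(5)])
        then have "F \<in> leading P'"
          unfolding leading_def using F(1,2) ideal_lmult[OF fibre_idealD(1)[OF P'] e(1) less.prems(1)] eq by auto
        then have "F \<in> leading P" using lead by blast
        then obtain p where p: "p \<in> P n" "p \<ominus> monom F \<in> lower n F" unfolding leading_def using F(2) by blast
        have pc: "p \<in> carrier R" using p(1) ideal_subset[OF fibre_idealD(1)[OF P]] by blast
        have cp: "c \<otimes> p \<in> P n" by (rule ideal_lmult[OF fibre_idealD(1)[OF P] F(4) p(1)])
        have "(u \<ominus> c \<otimes> monom F) \<ominus> c \<otimes> (p \<ominus> monom F) \<in> lower n F"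
          by (rule ideal_minus[OF lower_ideal F(5) ideal_lmult[OF lower_ideal F(4) p(2)]])
        moreover have "(u \<ominus> c \<otimes> monom F) \<ominus> c \<otimes> (p \<ominus> monom F) = u \<ominus> c \<otimes> p"
          using uc F(4) mc pc by algebra
        ultimately have "u \<ominus> c \<otimes> p \<in> lower n F" by simp
        moreover have "u \<ominus> c \<otimes> p \<in> P' n" using ideal_minus[OF fibre_idealD(1)[OF P'] less.prems(1)] cp PP by blast
        ultimately have "u \<ominus> c \<otimes> p \<in> P n" using less.IH[OF F(3)] by blast
        then have "(u \<ominus> c \<otimes> p) \<oplus> c \<otimes> p \<in> P n" using ideal_add[OF fibre_idealD(1)[OF P]] cp by blast
        moreover have "(u \<ominus> c \<otimes> p) \<oplus> c \<otimes> p = u" using uc F(4) pc by algebra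
        ultimately show ?thesis by simp
      qed
    qed
  qed
  then show "P' n \<subseteq> P n" using mpow_lower fibre_idealD(3)[OF P'] by blast
qed

text \<open>Each strict inclusion in an ascending sequence contributes a new leading monomial. By
  Dickson's lemma a later one is a multiple of an earlier one, and upward closure shows that it was
  not new.\<close>

lemma wf_fibre_ideals_gens: "wf {(Y, X). X \<in> Collect fibre_ideal \<and> Y \<in> Collect fibre_ideal \<and> X < Y}"
proof (rule ccontr)
  assume "\<not> ?thesis"
  then obtain Q where "\<And>i. (Q (Suc i), Q i) \<in> {(Y, X). X \<in> Collect fibre_ideal \<and> Y \<in> Collect fibre_ideal \<and> X < Y}"
    unfolding wf_iff_no_infinite_down_chain by blast
  then have Q: "fibre_ideal (Q i)" "Q i < Q (Suc i)" for i by auto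
  have "\<exists>M. M \<in> leading (Q (Suc i)) \<and> M \<notin> leading (Q i)" for i
  proof -
    have "\<not> leading (Q (Suc i)) \<subseteq> leading (Q i)"
      using le_if_leading_subset[OF Q(1) Q(1), of i "Suc i"] Q(2)[of i] by (auto simp: less_le_not_le)
    then show ?thesis by blast
  qed
  then obtain f where f: "\<And>i. f i \<in> leading (Q (Suc i))" "\<And>i. f i \<notin> leading (Q i)" by metis
  have valid: "valid (f i)" for i using f(1) unfolding leading_def by blast
  obtain i j where ij: "i < j" "f i \<subseteq># f j"
    using dickson[of "{..<N}" f] valid unfolding valid_def by blast
  have "Q (Suc i) \<le> Q j" using lift_Suc_mono_le[of Q "Suc i" j] Q(2) ij(1) by (simp add: less_imp_le)
  then have "leading (Q (Suc i)) \<subseteq> leading (Q j)" unfolding leading_def le_fun_def by blast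
  then have "f j \<in> leading (Q j)" using leading_upward[OF Q(1) _ ij(2) valid] f(1) by blast
  then show False using f(2) by blast
qed

end

context multi_ideals
begin

lemma wf_fibre_ideals: "wf {(Y, X). X \<in> Collect fibre_ideal \<and> Y \<in> Collect fibre_ideal \<and> X < Y}"
proof -
  have "\<forall>i. \<exists>A. A \<subseteq> carrier R \<and> finite A \<and> J i = Idl A" using finetely_gen[OF J_ideal] by blast
  then obtain A where A: "\<And>i. A i \<subseteq> carrier R" "\<And>i. finite (A i)" "\<And>i. J i = Idl (A i)" by metis
  \<comment> \<open>The disjoint union keeps a separate copy of an element for each ideal in whose
    generating set it occurs.\<close>
  have "finite (Sigma UNIV A)" using A(2) by (intro finite_SigmaI) auto
  then obtain f :: "nat \<Rightarrow> 's \<times> 'a" and N where f: "Sigma UNIV A = f ` {i. i < N}"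
    using finite_imp_nat_seg_image_inj_on by blast
  interpret multi_ideals_gens R m J "\<lambda>k. snd (f k)" "\<lambda>k. fst (f k)" N
  proof
    fix k assume "k < N"
    then have "f k \<in> Sigma UNIV A" using f by blast
    then have "snd (f k) \<in> A (fst (f k))" by (metis SigmaE fst_conv snd_conv)
    then show "snd (f k) \<in> J (fst (f k))" using genideal_self[OF A(1)] A(3) by blast
  next
    fix i
    have "A i \<subseteq> {snd (f k) |k. k < N \<and> fst (f k) = i}"
    proof
      fix a assume "a \<in> A i"
      then have "(i, a) \<in> f ` {i. i < N}" unfolding f[symmetric] by simp
      then show "a \<in> {snd (f k) |k. k < N \<and> fst (f k) = i}" by (auto simp: image_iff) (metis fst_conv snd_conv)
    qed
    moreover have "{snd (f k) |k. k < N \<and> fst (f k) = i} \<subseteq> carrier R"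
    proof
      fix a assume "a \<in> {snd (f k) |k. k < N \<and> fst (f k) = i}"
      then obtain k where k: "k < N" "a = snd (f k)" by blast
      then have "f k \<in> Sigma UNIV A" using f by blast
      then show "a \<in> carrier R" using A(1) k(2) by (metis SigmaE snd_conv subsetD)
    qed
    ultimately show "J i \<subseteq> Idl {snd (f k) |k. k < N \<and> fst (f k) = i}" unfolding A(3) by (rule genideal_mono)
  qed
  show ?thesis by (rule wf_fibre_ideals_gens)
qed

end

section \<open>Relevant primes of the fibre ring\<close>

context multi_ideals
begin

text \<open>These are the points of the multigraded Proj of the fibre ring: the second clause says
  that no graded piece is swallowed whole. Primality is tested on homogeneous elements, which is
  enough in a ring graded by \<open>\<nat>^s\<close>.\<close>

definition relevant_prime :: "(('s \<Rightarrow> nat) \<Rightarrow> 'a set) \<Rightarrow> bool" where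
  "relevant_prime P \<longleftrightarrow> fibre_ideal P \<and> (\<forall>n. P n \<noteq> mpow n) \<and>
     (\<forall>n k. \<forall>x\<in>mpow n. \<forall>y\<in>mpow k. x \<otimes> y \<in> P (n + k) \<longrightarrow> x \<in> P n \<or> y \<in> P k)"

lemma relevant_primeD:
  assumes "relevant_prime P"
  shows "fibre_ideal P" "P n \<noteq> mpow n"
    "x \<in> mpow n \<Longrightarrow> y \<in> mpow k \<Longrightarrow> x \<otimes> y \<in> P (n + k) \<Longrightarrow> x \<in> P n \<or> y \<in> P k"
  using assms unfolding relevant_prime_def by blast+

lemma fibre_adjoin_prod:
  assumes Q: "fibre_ideal Q" and x: "x \<in> mpow n" and y: "y \<in> mpow k" and xy: "x \<otimes> y \<in> Q (n + k)"
  shows "fibre_adjoin Q x n p \<cdot> fibre_adjoin Q y k q \<subseteq> Q (p + q)"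
proof (rule ideal_prod_subset[OF fibre_idealD(1)[OF Q]])
  note QD = fibre_idealD[OF Q]
  have com: "v \<otimes> u \<in> Q (l + j)" if "v \<in> Q l" "u \<in> mpow j" for v u l j
  proof -
    have "u \<otimes> v = v \<otimes> u" using that QD(3) mpow_subset m_comm by (meson subsetD)
    then show ?thesis using QD(4)[OF that(2,1)] by simp
  qed
  fix u v assume u: "u \<in> fibre_adjoin Q x n p" and v: "v \<in> fibre_adjoin Q y k q"
  have um: "u \<in> mpow p" and vm: "v \<in> mpow q"
    using u v fibre_idealD(3)[OF fibre_adjoin_ideal[OF Q]] x y by blast+
  consider "u \<in> Q p" | "v \<in> Q q" | "n \<le> p" "k \<le> q" "u \<notin> Q p" "v \<notin> Q q"
    using u v unfolding fibre_adjoin_def by (auto split: if_splits)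
  then show "u \<otimes> v \<in> Q (p + q)"
  proof cases
    case 1
    then show ?thesis using com vm by blast
  next
    case 2
    have "u \<otimes> v \<in> Q (q + p)" by (rule QD(4)[OF um 2])
    then show ?thesis by (simp only: add.commute)
  next
    case 3
    then obtain a w b z where u': "a \<in> Q p" "w \<in> mpow (p - n)" "u = a \<oplus> x \<otimes> w"
      and v': "b \<in> Q q" "z \<in> mpow (q - k)" "v = b \<oplus> y \<otimes> z"
      using u v unfolding fibre_adjoin_def adjoin_def by auto
    have c: "a \<in> carrier R" "w \<in> carrier R" "b \<in> carrier R" "z \<in> carrier R" "x \<in> carrier R" "y \<in> carrier R"
      using u' v' x y mpow_subset ideal_subset[OF QD(1)] by blast+
    have xw: "x \<otimes> w \<in> mpow p" using mpow_mult[OF x u'(2)] add_diff_multiindex'[OF 3(1)] by simp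
    have "(x \<otimes> y) \<otimes> (w \<otimes> z) \<in> Q ((n + k) + ((p - n) + (q - k)))"
      by (rule com[OF xy mpow_mult[OF u'(2) v'(2)]])
    moreover have "(n + k) + ((p - n) + (q - k)) = p + q"
    proof (rule ext)
      fix i show "((n + k) + ((p - n) + (q - k))) i = (p + q) i"
        using le_funD[OF 3(1), of i] le_funD[OF 3(2), of i] by simp
    qed
    ultimately have "(x \<otimes> y) \<otimes> (w \<otimes> z) \<in> Q (p + q)" by simp
    moreover have "a \<otimes> v \<in> Q (p + q)" by (rule com[OF u'(1) vm])
    moreover have "(x \<otimes> w) \<otimes> b \<in> Q (p + q)" using QD(4)[OF xw v'(1)] by (simp only: add.commute[of p q])
    moreover have "u \<otimes> v = a \<otimes> v \<oplus> ((x \<otimes> w) \<otimes> b \<oplus> (x \<otimes> y) \<otimes> (w \<otimes> z))"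
      unfolding u'(3) v'(3) using c by algebra
    ultimately show ?thesis using ideal_add[OF QD(1)] by simp
  qed
qed

text \<open>A maximal family without a full graded piece is prime. Adjoining \<open>x\<close>
  outside it fills some degree \<open>p\<close>, adjoining \<open>y\<close> fills some degree
  \<open>q\<close>; if \<open>x y\<close> lay in the family, then so would
  \<open>J^(p+q) = J^p J^q\<close>. The two degrees may differ.\<close>

lemma ex_relevant_prime:
  assumes Q: "fibre_ideal Q" "\<And>n. Q n \<noteq> mpow n"
  shows "\<exists>P. relevant_prime P \<and> Q \<le> P"
proof -
  let ?A = "{P. fibre_ideal P \<and> Q \<le> P \<and> (\<forall>n. P n \<noteq> mpow n)}"
  have "Q \<in> ?A" using Q by simp
  then obtain P where P: "P \<in> ?A" "\<And>Y. (Y, P) \<in> {(Y, X). X \<in> Collect fibre_ideal \<and> Y \<in> Collect fibre_ideal \<and> X < Y} \<Longrightarrow> Y \<notin> ?A"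
    by (rule wfE_min[OF wf_fibre_ideals]) (rule that)
  have fP: "fibre_ideal P" "Q \<le> P" "\<And>n. P n \<noteq> mpow n" using P(1) by auto
  have full: "\<exists>p. fibre_adjoin P x n p = mpow p" if "x \<in> mpow n" "x \<notin> P n" for x n
  proof (rule ccontr)
    assume ne: "\<nexists>p. fibre_adjoin P x n p = mpow p"
    have le: "P \<le> fibre_adjoin P x n" by (rule fibre_adjoin_super[OF fP(1) that(1)])
    moreover have "x \<in> fibre_adjoin P x n n" by (rule fibre_adjoin_self[OF fP(1) that(1)])
    ultimately have "P < fibre_adjoin P x n" using that(2) by (metis order_le_less)
    then have "fibre_adjoin P x n \<notin> ?A" by (intro P(2)) (simp add: fP(1) fibre_adjoin_ideal[OF fP(1) that(1)])
    moreover have "Q \<le> fibre_adjoin P x n" using le fP(2) by (rule order_trans[rotated])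
    ultimately show False using fibre_adjoin_ideal[OF fP(1) that(1)] ne by simp
  qed
  have "x \<in> P n \<or> y \<in> P k" if x: "x \<in> mpow n" and y: "y \<in> mpow k" and xy: "x \<otimes> y \<in> P (n + k)" for n k x y
  proof (rule ccontr)
    assume "\<not> ?thesis"
    then obtain p q where "fibre_adjoin P x n p = mpow p" "fibre_adjoin P y k q = mpow q"
      using full[OF x] full[OF y] by blast
    then have "mpow (p + q) \<subseteq> P (p + q)"
      using fibre_adjoin_prod[OF fP(1) x y xy, of p q] by (simp only: mpow_add)
    then show False using fP(3) fibre_idealD(3)[OF fP(1)] by blast
  qed
  then have "relevant_prime P" unfolding relevant_prime_def using fP by blast
  then show ?thesis using fP(2) by blast
qed

lemma finite_minimal_relevant_primes:
  assumes "fibre_ideal Q"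
  shows "\<exists>F. finite F \<and> (\<forall>P\<in>F. relevant_prime P \<and> Q \<le> P) \<and>
    (\<forall>P. relevant_prime P \<longrightarrow> Q \<le> P \<longrightarrow> (\<exists>P'\<in>F. P' \<le> P))"
proof -
  have "\<exists>Q1\<in>Collect fibre_ideal. \<exists>Q2\<in>Collect fibre_ideal. Q < Q1 \<and> Q < Q2 \<and>
      (\<forall>X\<in>Collect relevant_prime. Q \<le> X \<longrightarrow> Q1 \<le> X \<or> Q2 \<le> X)"
    if Q: "Q \<in> Collect fibre_ideal" "Q \<notin> Collect relevant_prime" "\<exists>X\<in>Collect relevant_prime. Q \<le> X" for Q
  proof -
    have fQ: "fibre_ideal Q" using Q(1) by simp
    obtain X where X: "relevant_prime X" "Q \<le> X" using Q(3) by blast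
    \<comment> \<open>A relevant prime above \<open>Q\<close> keeps every graded piece of
      \<open>Q\<close> proper, so \<open>Q\<close> can only fail at primality, which yields the pair
      to split on.\<close>
    have "Q n \<noteq> mpow n" for n
      using relevant_primeD(2)[OF X(1), of n] fibre_idealD(3)[OF relevant_primeD(1)[OF X(1)], of n] X(2)
      by (auto simp: le_fun_def)
    then obtain n k x y where xy: "x \<in> mpow n" "y \<in> mpow k" "x \<otimes> y \<in> Q (n + k)" "x \<notin> Q n" "y \<notin> Q k"
      using Q(2) fQ unfolding relevant_prime_def by auto
    have less: "Q < fibre_adjoin Q z l" if "z \<in> mpow l" "z \<notin> Q l" for z l
      using fibre_adjoin_super[OF fQ that(1)] fibre_adjoin_self[OF fQ that(1)] that(2) by (metis order_le_less)
    have "fibre_adjoin Q x n \<le> X \<or> fibre_adjoin Q y k \<le> X" if X: "relevant_prime X" "Q \<le> X" for X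
    proof -
      have "x \<otimes> y \<in> X (n + k)" using xy(3) X(2) by (auto simp: le_fun_def)
      then have "x \<in> X n \<or> y \<in> X k" using relevant_primeD(3)[OF X(1) xy(1,2)] by blast
      then show ?thesis using fibre_adjoin_least[OF fQ relevant_primeD(1)[OF X(1)] X(2)] by blast
    qed
    then show ?thesis
      using less[OF xy(1,4)] less[OF xy(2,5)] fibre_adjoin_ideal[OF fQ] xy(1,2)
      by (intro bexI[of _ "fibre_adjoin Q x n"] bexI[of _ "fibre_adjoin Q y k"]) auto
  qed
  from finite_minimal_elements[OF wf_fibre_ideals this, of Q] assms
  obtain F where "finite F" "F \<subseteq> Collect relevant_prime" "\<forall>X\<in>F. Q \<le> X"
    "\<forall>X\<in>Collect relevant_prime. Q \<le> X \<longrightarrow> (\<exists>Y\<in>F. Y \<le> X)" by auto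
  then show ?thesis by (intro exI[of _ F]) auto
qed

text \<open>The second clause compares the generated ideal with primes. The third describes it
  degree by degree from above, which turns an equation \<open>Q n = J^n\<close> into the inclusion
  that Nakayama's lemma asks for.\<close>

lemma ex_generated_fibre_ideal:
  assumes "finite A" "\<And>p. p \<in> A \<Longrightarrow> y p \<in> mpow (\<delta> p)"
  shows "\<exists>Q. fibre_ideal Q \<and> (\<forall>X. fibre_ideal X \<longrightarrow> (Q \<le> X \<longleftrightarrow> (\<forall>p\<in>A. y p \<in> X (\<delta> p)))) \<and>
    (\<forall>n W. ideal W R \<longrightarrow> m \<cdot> mpow n \<subseteq> W \<longrightarrow>
       (\<forall>p\<in>A. \<delta> p \<le> n \<longrightarrow> (\<forall>v\<in>mpow (n - \<delta> p). y p \<otimes> v \<in> W)) \<longrightarrow> Q n \<subseteq> W)"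
  using assms
proof (induction A rule: finite_induct)
  case empty
  show ?case
    by (rule exI[of _ "\<lambda>n. m \<cdot> mpow n"]) (auto simp: fibre_ideal_zero le_fun_def dest: fibre_idealD(2))
next
  case (insert q A)
  then obtain Q where Q: "fibre_ideal Q"
    "\<And>X. fibre_ideal X \<Longrightarrow> Q \<le> X \<longleftrightarrow> (\<forall>p\<in>A. y p \<in> X (\<delta> p))"
    "\<And>n W. ideal W R \<Longrightarrow> m \<cdot> mpow n \<subseteq> W \<Longrightarrow>
       (\<forall>p\<in>A. \<delta> p \<le> n \<longrightarrow> (\<forall>v\<in>mpow (n - \<delta> p). y p \<otimes> v \<in> W)) \<Longrightarrow> Q n \<subseteq> W" by blast
  have yq: "y q \<in> mpow (\<delta> q)" using insert.prems by blast
  let ?Q = "fibre_adjoin Q (y q) (\<delta> q)"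
  have "?Q \<le> X \<longleftrightarrow> (\<forall>p\<in>insert q A. y p \<in> X (\<delta> p))" if X: "fibre_ideal X" for X
  proof
    assume le: "?Q \<le> X"
    then have "Q \<le> X" using fibre_adjoin_super[OF Q(1) yq] by (rule order_trans[rotated])
    moreover have "y q \<in> X (\<delta> q)" using le fibre_adjoin_self[OF Q(1) yq] unfolding le_fun_def by blast
    ultimately show "\<forall>p\<in>insert q A. y p \<in> X (\<delta> p)" using Q(2)[OF X] by blast
  next
    assume "\<forall>p\<in>insert q A. y p \<in> X (\<delta> p)"
    then show "?Q \<le> X" using fibre_adjoin_least[OF Q(1) X] Q(2)[OF X] by blast
  qed
  moreover have "?Q n \<subseteq> W" if W: "ideal W R" "m \<cdot> mpow n \<subseteq> W"
    "\<forall>p\<in>insert q A. \<delta> p \<le> n \<longrightarrow> (\<forall>v\<in>mpow (n - \<delta> p). y p \<otimes> v \<in> W)" for n W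
  proof -
    have "Q n \<subseteq> W" using Q(3)[OF W(1,2)] W(3) by blast
    then show ?thesis unfolding fibre_adjoin_def using W(3) adjoin_least[OF W(1)] by simp
  qed
  ultimately show ?case using fibre_adjoin_ideal[OF Q(1) yq] by (intro exI[of _ ?Q]) blast
qed

section \<open>Growth of the fibre ring\<close>

text \<open>
  Multiplication by \<open>y\<close> is injective modulo \<open>P'\<close> and lands in \<open>P\<close>, so the Hilbert functions satisfy
  \<open>H\<^sub>P\<^sub>'(n) \<ge> H\<^sub>P\<^sub>'(n - \<delta>) + H\<^sub>P(n)\<close>.
\<close>

lemma ideal_chain_prime_step:
  assumes P: "relevant_prime P" and P': "relevant_prime P'" and le: "P' \<le> P"
    and y: "y \<in> P \<delta>" "y \<notin> P' \<delta>"
    and chain: "\<And>n. n0 \<le> n \<Longrightarrow> ideal_chain R (P n) (mpow n) k"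
    and n: "\<And>i. n0 i + L * \<delta> i \<le> n i"
  shows "ideal_chain R (P' n) (mpow n) (L * k)"
  using n
proof (induction L arbitrary: n)
  case 0
  note fP = relevant_primeD(1)[OF P']
  show ?case using chain_base[OF fibre_idealD(1)[OF fP] mpow_ideal fibre_idealD(3)[OF fP]] by simp
next
  case (Suc L)
  note fP = relevant_primeD(1)[OF P] and fP' = relevant_primeD(1)[OF P']
  have ym: "y \<in> mpow \<delta>" using y(1) fibre_idealD(3)[OF fP] by blast
  have yc: "y \<in> carrier R" using ym mpow_subset by blast
  have dn: "\<delta> \<le> n"
  proof (rule le_funI)
    fix i show "\<delta> i \<le> n i" using Suc.prems[of i] by simp
  qed
  have n0n: "n0 \<le> n"
  proof (rule le_funI)
    fix i show "n0 i \<le> n i" using Suc.prems[of i] by simp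
  qed
  have "n0 i + L * \<delta> i \<le> (n - \<delta>) i" for i using Suc.prems[of i] by simp
  then have ch: "ideal_chain R (P' (n - \<delta>)) (mpow (n - \<delta>)) (L * k)" by (rule Suc.IH)
  note PI = fibre_idealD(1)[OF fP', of n]
  let ?\<phi> = "\<lambda>X. adjoin R (P' n) y X"
  have "ideal_chain R (?\<phi> (P' (n - \<delta>))) (?\<phi> (mpow (n - \<delta>))) (L * k)"
  proof (rule ideal_chain_map[OF ch])
    show "ideal (?\<phi> X) R" if "ideal X R" for X by (rule adjoin_ideal[OF PI yc that])
    fix X Y assume XY: "ideal X R" "ideal Y R" "P' (n - \<delta>) \<subseteq> X" "X \<subset> Y" "Y \<subseteq> mpow (n - \<delta>)"
    obtain u where u: "u \<in> Y" "u \<notin> X" using XY(4) by blast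
    have "y \<otimes> u \<notin> ?\<phi> X"
    proof
      assume "y \<otimes> u \<in> ?\<phi> X"
      then obtain p v where pv: "p \<in> P' n" "v \<in> X" "y \<otimes> u = p \<oplus> y \<otimes> v" unfolding adjoin_def by blast
      have c: "u \<in> carrier R" "v \<in> carrier R" "p \<in> carrier R"
        using u(1) pv(1,2) ideal_subset XY(1,2) PI by blast+
      have "y \<otimes> (u \<ominus> v) = y \<otimes> u \<ominus> y \<otimes> v" using c yc by algebra
      also have "\<dots> = p" unfolding pv(3) using c yc by algebra
      finally have "y \<otimes> (u \<ominus> v) \<in> P' (\<delta> + (n - \<delta>))" using pv(1) add_diff_multiindex'[OF dn] by simp
      moreover have "v \<in> Y" using pv(2) XY(4) by blast
      then have "u \<ominus> v \<in> mpow (n - \<delta>)" using ideal_minus[OF XY(2) u(1)] XY(5) by blast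
      ultimately have "u \<ominus> v \<in> P' (n - \<delta>)" using relevant_primeD(3)[OF P' ym] y(2) by blast
      then have "v \<oplus> (u \<ominus> v) \<in> X" using ideal_add[OF XY(1) pv(2)] XY(3) by blast
      moreover have "v \<oplus> (u \<ominus> v) = u" using c by algebra
      ultimately show False using u(2) by simp
    qed
    moreover have "y \<otimes> u \<in> ?\<phi> Y" by (rule adjoin_mult[OF PI yc XY(2) u(1)])
    moreover have "?\<phi> X \<subseteq> ?\<phi> Y" using XY(4) unfolding adjoin_def by blast
    ultimately show "?\<phi> X \<subset> ?\<phi> Y" by blast
  qed
  then have "ideal_chain R (P' n) (?\<phi> (mpow (n - \<delta>))) (L * k)"
    by (rule ideal_chain_down[OF _ PI adjoin_super[OF PI yc fibre_idealD(1)[OF fP']]])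
  moreover have "?\<phi> (mpow (n - \<delta>)) \<subseteq> P n"
  proof (rule adjoin_least[OF fibre_idealD(1)[OF fP]])
    show "P' n \<subseteq> P n" using le by (simp add: le_fun_def)
    fix w assume w: "w \<in> mpow (n - \<delta>)"
    have "w \<otimes> y \<in> P n" using fibre_idealD(4)[OF fP w y(1)] add_diff_multiindex'[OF dn] by simp
    moreover have "w \<otimes> y = y \<otimes> w" using w yc mpow_subset m_comm by blast
    ultimately show "y \<otimes> w \<in> P n" by simp
  qed
  ultimately have "ideal_chain R (P' n) (P n) (L * k)"
    by (rule ideal_chain_up[OF _ fibre_idealD(1)[OF fP]])
  \<comment> \<open>The steps below \<open>P n\<close> come from degree \<open>n - \<delta>\<close>
    by multiplication with \<open>y\<close>; the \<open>k\<close> steps above \<open>P n\<close> are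
    the given ones.\<close>
  then have "ideal_chain R (P' n) (mpow n) (L * k + k)"
    by (rule ideal_chain_trans[OF chain[OF n0n]])
  then show ?case by (simp add: add.commute)
qed

text \<open>The chain of primes from \<open>P0\<close> up to \<open>P\<close> stays implicit in the
  growth statement. An element chosen off the minimal relevant primes over its predecessors lies in
  \<open>P\<close> but not in some such \<open>P'\<close> below \<open>P\<close>; passing from
  \<open>P\<close> to \<open>P'\<close> multiplies the number of steps by \<open>L\<close> and costs
  \<open>L * \<delta> q\<close> in degree. The induction replaces \<open>k\<close> by
  \<open>L * k\<close> and \<open>n0\<close> by \<open>n0 + L * \<delta> q\<close>, so both are
  quantified inside, whereas \<open>P0\<close> must not depend on \<open>L\<close>.\<close>

lemma ex_general_elements:
  fixes \<delta> :: "'p \<Rightarrow> 's \<Rightarrow> nat"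
  assumes inf: "infinite (carrier (R Quot m))" and "finite A"
  shows "\<exists>y. (\<forall>p\<in>A. y p \<in> mpow (\<delta> p)) \<and>
    (\<forall>P. relevant_prime P \<longrightarrow> (\<forall>p\<in>A. y p \<in> P (\<delta> p)) \<longrightarrow>
      (\<exists>P0. relevant_prime P0 \<and> (\<forall>L k n0 n. (\<forall>n. n0 \<le> n \<longrightarrow> ideal_chain R (P n) (mpow n) k) \<longrightarrow>
        (\<forall>i. n0 i + L * (\<Sum>p\<in>A. \<delta> p i) \<le> n i) \<longrightarrow> ideal_chain R (P0 n) (mpow n) (L ^ card A * k))))"
  using assms(2)
proof (induction A rule: finite_induct)
  case empty
  have "ideal_chain R (P n) (mpow n) k"
    if "\<forall>n. n0 \<le> n \<longrightarrow> ideal_chain R (P n) (mpow n) k" "\<forall>i. n0 i \<le> n i" for P n0 n k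
    using that by (simp add: le_fun_def)
  then show ?case by auto
next
  case (insert q A)
  then obtain y where y: "\<And>p. p \<in> A \<Longrightarrow> y p \<in> mpow (\<delta> p)"
    and grow: "\<And>P. relevant_prime P \<Longrightarrow> \<forall>p\<in>A. y p \<in> P (\<delta> p) \<Longrightarrow>
      \<exists>P0. relevant_prime P0 \<and> (\<forall>L k n0 n. (\<forall>n. n0 \<le> n \<longrightarrow> ideal_chain R (P n) (mpow n) k) \<longrightarrow>
        (\<forall>i. n0 i + L * (\<Sum>p\<in>A. \<delta> p i) \<le> n i) \<longrightarrow> ideal_chain R (P0 n) (mpow n) (L ^ card A * k))" by blast
  obtain Q where Q: "fibre_ideal Q" "\<And>X. fibre_ideal X \<Longrightarrow> Q \<le> X \<longleftrightarrow> (\<forall>p\<in>A. y p \<in> X (\<delta> p))"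
    using ex_generated_fibre_ideal[OF insert.hyps(1), of y \<delta>] y by blast
  obtain F where F: "finite F" "\<And>P. P \<in> F \<Longrightarrow> relevant_prime P \<and> Q \<le> P"
    "\<And>P. relevant_prime P \<Longrightarrow> Q \<le> P \<Longrightarrow> \<exists>P'\<in>F. P' \<le> P"
    using finite_minimal_relevant_primes[OF Q(1)] by blast
  have "\<exists>v\<in>mpow (\<delta> q). \<forall>W\<in>(\<lambda>P. P (\<delta> q)) ` F. v \<notin> W"
  proof (rule ideal_avoidance[OF inf mpow_ideal])
    show "finite ((\<lambda>P. P (\<delta> q)) ` F)" using F(1) by simp
    fix W assume "W \<in> (\<lambda>P. P (\<delta> q)) ` F"
    then obtain P where P: "relevant_prime P" "W = P (\<delta> q)" using F(2) by blast
    note fP = relevant_primeD(1)[OF P(1)]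
    show "ideal W R" using fibre_idealD(1)[OF fP] P(2) by simp
    show "\<not> mpow (\<delta> q) \<subseteq> W" using fibre_idealD(3)[OF fP] relevant_primeD(2)[OF P(1)] P(2) by blast
  qed
  then obtain v where v: "v \<in> mpow (\<delta> q)" "\<And>P. P \<in> F \<Longrightarrow> v \<notin> P (\<delta> q)" by blast
  let ?y = "y(q := v)"
  have "\<exists>P0. relevant_prime P0 \<and> (\<forall>L k n0 n. (\<forall>n. n0 \<le> n \<longrightarrow> ideal_chain R (P n) (mpow n) k) \<longrightarrow>
      (\<forall>i. n0 i + L * (\<Sum>p\<in>insert q A. \<delta> p i) \<le> n i) \<longrightarrow> ideal_chain R (P0 n) (mpow n) (L ^ card (insert q A) * k))"
    if P: "relevant_prime P" "\<forall>p\<in>insert q A. ?y p \<in> P (\<delta> p)" for P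
  proof -
    have "\<forall>p\<in>A. y p \<in> P (\<delta> p)" using P(2) insert.hyps(2) by (metis fun_upd_apply insertCI)
    then have "Q \<le> P" using Q(2)[OF relevant_primeD(1)[OF P(1)]] by blast
    then obtain P' where P': "P' \<in> F" "P' \<le> P" using F(3) P(1) by blast
    have rP': "relevant_prime P'" "Q \<le> P'" using F(2) P'(1) by auto
    then have "\<forall>p\<in>A. y p \<in> P' (\<delta> p)" using Q(2)[OF relevant_primeD(1)] by blast
    then obtain P0 where P0: "relevant_prime P0"
      "\<And>L k n0 n. \<forall>n. n0 \<le> n \<longrightarrow> ideal_chain R (P' n) (mpow n) k \<Longrightarrow>
        \<forall>i. n0 i + L * (\<Sum>p\<in>A. \<delta> p i) \<le> n i \<Longrightarrow> ideal_chain R (P0 n) (mpow n) (L ^ card A * k)"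
      using grow[OF rP'(1)] by blast
    have vP: "v \<in> P (\<delta> q)" "v \<notin> P' (\<delta> q)" using P(2) v(2) P'(1) by auto
    have "ideal_chain R (P0 n) (mpow n) (L ^ card (insert q A) * k)"
      if hyp: "\<forall>n. n0 \<le> n \<longrightarrow> ideal_chain R (P n) (mpow n) k"
        "\<forall>i. n0 i + L * (\<Sum>p\<in>insert q A. \<delta> p i) \<le> n i" for L k n0 n
    proof -
      let ?n0 = "\<lambda>i. n0 i + L * \<delta> q i"
      have "\<forall>n. ?n0 \<le> n \<longrightarrow> ideal_chain R (P' n) (mpow n) (L * k)"
        using ideal_chain_prime_step[OF P(1) rP'(1) P'(2) vP, of n0 k L] hyp(1) by (auto simp: le_fun_def)
      moreover have "\<forall>i. ?n0 i + L * (\<Sum>p\<in>A. \<delta> p i) \<le> n i"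
        using hyp(2) insert.hyps by (simp add: add_mult_distrib2 add.assoc)
      ultimately have "ideal_chain R (P0 n) (mpow n) (L ^ card A * (L * k))" by (rule P0(2))
      then show ?thesis using insert.hyps by (simp add: mult.assoc mult.left_commute)
    qed
    then show ?thesis using P0(1) by blast
  qed
  moreover have "\<forall>p\<in>insert q A. ?y p \<in> mpow (\<delta> p)" using y v(1) by auto
  ultimately show ?case by (intro exI[of _ ?y]) blast
qed

section \<open>Upper bound for the length modulo diagonal powers\<close>

lemma ex_power_in_mpow:
  assumes "\<And>i. \<exists>k::nat. c [^] k \<in> J i" "c \<in> carrier R"
  shows "\<exists>k::nat. c [^] k \<in> mpow n"
proof (induction n rule: multiindex_induct)
  case 1
  show ?case using assms(2) unfolding mpow_0 by (intro exI[of _ 0]) simp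
next
  case (2 n i)
  then obtain k l :: nat where "c [^] k \<in> mpow n" "c [^] l \<in> mpow (unit_index i)"
    using assms(1) mpow_unit by metis
  then have "c [^] (k + l) \<in> mpow (n + unit_index i)" using mpow_mult nat_pow_mult[OF assms(2)] by metis
  then show ?case by blast
qed

lemma power_in_mpow:
  assumes "v \<in> mpow n"
  shows "v [^] (N::nat) \<in> mpow (\<lambda>i. N * n i)"
proof (induction N)
  case 0
  have "(\<lambda>i. 0 * n i) = 0" by (simp add: fun_eq_iff)
  then show ?case using mpow_0 by simp
next
  case (Suc N)
  have "(\<lambda>i. N * n i) + n = (\<lambda>i. Suc N * n i)" by (simp add: fun_eq_iff add.commute)
  then show ?case using mpow_mult[OF Suc assms] by simp
qed

lemma prime_power_mem: "primeideal P R \<Longrightarrow> c \<in> carrier R \<Longrightarrow> c [^] (k::nat) \<in> P \<Longrightarrow> c \<in> P"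
proof (induction k)
  case 0
  then have "P = carrier R" using ideal.one_imp_carrier primeideal.axioms(1) by force
  then show ?case using 0 by simp
next
  case (Suc k)
  then show ?case using primeideal.I_prime[OF Suc.prems(1), of "c [^] k" c] by auto
qed

lemma ex_length_le_mpow:
  assumes inf: "infinite (carrier (R Quot m))" and dim: "krull_dim R = enat d"
    and rad: "\<forall>i. \<forall>c\<in>m. \<exists>k::nat. c [^] k \<in> J i"
  shows "\<exists>h. \<forall>N. length_le R (mpow (\<lambda>_. N)) (carrier R) (N ^ d * h)"
proof -
  \<comment> \<open>Every element of \<open>m\<close> has a power in \<open>J^(1, ..., 1)\<close>,
    so \<open>m\<close> is the only prime above it and a system of parameters can be chosen
    inside.\<close>
  have "P = m" if P: "primeideal P R" "mpow (\<lambda>_. 1) \<subseteq> P" for P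
  proof -
    have "m \<subseteq> P"
    proof
      fix c assume c: "c \<in> m"
      have cc: "c \<in> carrier R" using c ideal_subset[OF ideal_m] by blast
      then obtain k :: nat where "c [^] k \<in> P" using ex_power_in_mpow[OF _ cc] rad c P(2) by blast
      then show "c \<in> P" by (rule prime_power_mem[OF P(1) cc])
    qed
    then show ?thesis using primeideal_le_m[OF P(1)] by blast
  qed
  then obtain xs where xs: "length xs = d" "set xs \<subseteq> mpow (\<lambda>_. 1)"
    "\<And>P. primeideal P R \<Longrightarrow> set xs \<subseteq> P \<Longrightarrow> P = m"
    using ex_parameters[OF inf mpow_ideal dim] by blast
  have xc: "set xs \<subseteq> carrier R" using xs(2) mpow_subset by blast
  have "\<exists>h. length_le R (Idl (set xs)) (carrier R) h"
    by (rule ex_length_le[OF genideal_ideal[OF xc]]) (use xs(3) genideal_self[OF xc] in blast)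
  then obtain h where h: "length_le R (Idl (set xs)) (carrier R) h" by blast
  have "length_le R (mpow (\<lambda>_. N)) (carrier R) (N ^ d * h)" for N
  proof -
    let ?S = "(\<lambda>x. x [^] N) ` set xs"
    have "?S \<subseteq> mpow (\<lambda>_. N)" using power_in_mpow[of _ "\<lambda>_. 1" N] xs(2) by auto
    then have sub: "Idl ?S \<subseteq> mpow (\<lambda>_. N)" by (rule genideal_minimal[OF mpow_ideal])
    have Sc: "?S \<subseteq> carrier R" using xc by auto
    have "length_le R (Idl ?S) (carrier R) (N ^ d * h)"
      using length_le_powers[of xs "{}" h N] h xc xs(1) by simp
    then show ?thesis by (rule length_le_down[OF _ sub genideal_ideal[OF Sc]])
  qed
  then show ?thesis by blast
qed

text \<open>The equation for \<open>J^n\<close> is phrased as a property of all ideals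
  \<open>W\<close> that contain the products \<open>y p \<otimes> v\<close>. In this form it applies
  directly to colon ideals, through which it passes to modules over the Rees algebra. The truncated
  difference \<open>n - \<delta> p\<close> agrees with the convention that negative exponents count
  as zero.\<close>

theorem ex_joint_reduction:
  fixes \<delta> :: "'p \<Rightarrow> 's \<Rightarrow> nat"
  assumes inf: "infinite (carrier (R Quot m))" and dim: "krull_dim R = enat (card A)"
    and rad: "\<forall>i. \<forall>c\<in>m. \<exists>k::nat. c [^] k \<in> J i" and fin: "finite A"
  shows "\<exists>y n0. (\<forall>p\<in>A. y p \<in> mpow (\<delta> p)) \<and> (\<forall>n W. n0 \<le> n \<longrightarrow> ideal W R \<longrightarrow>
    (\<forall>p\<in>A. \<forall>v\<in>mpow (n - \<delta> p). y p \<otimes> v \<in> W) \<longrightarrow> mpow n \<subseteq> W)"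
proof -
  let ?d = "card A"
  obtain y where y: "\<And>p. p \<in> A \<Longrightarrow> y p \<in> mpow (\<delta> p)"
    and grow: "\<And>P. relevant_prime P \<Longrightarrow> \<forall>p\<in>A. y p \<in> P (\<delta> p) \<Longrightarrow>
      \<exists>P0. relevant_prime P0 \<and> (\<forall>L k n0 n. (\<forall>n. n0 \<le> n \<longrightarrow> ideal_chain R (P n) (mpow n) k) \<longrightarrow>
        (\<forall>i. n0 i + L * (\<Sum>p\<in>A. \<delta> p i) \<le> n i) \<longrightarrow> ideal_chain R (P0 n) (mpow n) (L ^ ?d * k))"
    using ex_general_elements[OF inf fin, of \<delta>] by blast
  obtain Q where Q: "fibre_ideal Q" "\<And>X. fibre_ideal X \<Longrightarrow> Q \<le> X \<longleftrightarrow> (\<forall>p\<in>A. y p \<in> X (\<delta> p))"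
    "\<And>n W. ideal W R \<Longrightarrow> m \<cdot> mpow n \<subseteq> W \<Longrightarrow>
       (\<forall>p\<in>A. \<delta> p \<le> n \<longrightarrow> (\<forall>v\<in>mpow (n - \<delta> p). y p \<otimes> v \<in> W)) \<Longrightarrow> Q n \<subseteq> W"
    using ex_generated_fibre_ideal[OF fin, of y \<delta>] y by blast
  have "\<exists>n. Q n = mpow n"
  proof (rule ccontr)
    assume "\<nexists>n. Q n = mpow n"
    then obtain P where P: "relevant_prime P" "Q \<le> P" using ex_relevant_prime[OF Q(1)] by blast
    then have "\<forall>p\<in>A. y p \<in> P (\<delta> p)" using Q(2)[OF relevant_primeD(1)] by blast
    from grow[OF P(1) this] obtain P0 where P0: "relevant_prime P0"
      "\<And>L k n0 n. \<forall>n. n0 \<le> n \<longrightarrow> ideal_chain R (P n) (mpow n) k \<Longrightarrow>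
        \<forall>i. n0 i + L * (\<Sum>p\<in>A. \<delta> p i) \<le> n i \<Longrightarrow> ideal_chain R (P0 n) (mpow n) (L ^ ?d * k)" by blast
    note fP = relevant_primeD(1)[OF P(1)] and fP0 = relevant_primeD(1)[OF P0(1)]
    have one: "ideal_chain R (P n) (mpow n) 1" for n
    proof -
      have "P n \<subset> mpow n" using fibre_idealD(3)[OF fP] relevant_primeD(2)[OF P(1)] by blast
      then show ?thesis
        using chain_step[OF chain_base[OF fibre_idealD(1)[OF fP] fibre_idealD(1)[OF fP] order_refl] mpow_ideal]
        by simp
    qed
    \<comment> \<open>A bound, uniform in the coordinates, for the degree spent per unit of
      \<open>L\<close>; the successor makes it positive.\<close>
    define M where "M = Suc (\<Sum>i\<in>UNIV. \<Sum>p\<in>A. \<delta> p i)"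
    have M: "(\<Sum>p\<in>A. \<delta> p i) \<le> M" for i
    proof -
      have "(\<Sum>p\<in>A. \<delta> p i) \<le> (\<Sum>i\<in>UNIV. \<Sum>p\<in>A. \<delta> p i)"
        by (rule member_le_sum) auto
      then show ?thesis unfolding M_def by simp
    qed
    obtain h where h: "\<And>N. length_le R (mpow (\<lambda>_. N)) (carrier R) (N ^ ?d * h)"
      using ex_length_le_mpow[OF inf dim rad] by blast
    \<comment> \<open>Between \<open>J^(2ML, ..., 2ML)\<close> and \<open>J^(ML, ..., ML)\<close>
      there will be \<open>M L\<close> layers with \<open>L^d\<close> steps each, while the length
      bound allows at most \<open>(2ML)^d h\<close> steps. After cancelling \<open>L^d\<close> this
      reads \<open>M L \<le> (2M)^d h\<close>, which this \<open>L\<close> violates.\<close>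
    define L where "L = Suc ((2 * M) ^ ?d * h)"
    have diag: "ideal_chain R (mpow (\<lambda>_. Suc p)) (mpow (\<lambda>_. p)) (L ^ ?d)" if p: "M * L \<le> p" for p
    proof -
      have "0 + L * (\<Sum>p\<in>A. \<delta> p i) \<le> p" for i
        using order_trans[OF mult_le_mono2[OF M[of i], of L]] p by (simp only: mult.commute add_0)
      then have "ideal_chain R (P0 (\<lambda>_. p)) (mpow (\<lambda>_. p)) (L ^ ?d * 1)"
        by (intro P0(2)[of "0"]) (use one in auto)
      moreover have "mpow (\<lambda>_. Suc p) \<subseteq> P0 (\<lambda>_. p)"
      proof -
        \<comment> \<open>Any index serves: raising one coordinate of the diagonal degree already
          leads into \<open>m J^p\<close>, hence into \<open>P0\<close>.\<close>
        obtain i :: 's where True by blast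
        have "(\<lambda>_. p) + unit_index i \<le> (\<lambda>_. Suc p)" by (simp add: le_fun_def unit_index_def)
        then have "mpow (\<lambda>_. Suc p) \<subseteq> mpow ((\<lambda>_. p) + unit_index i)" by (rule mpow_antimono)
        then show ?thesis using mpow_add_unit_subset fibre_idealD(2)[OF fP0] by blast
      qed
      ultimately show ?thesis using ideal_chain_down mpow_ideal by fastforce
    qed
    have "ideal_chain R (mpow (\<lambda>_. M * L + t)) (mpow (\<lambda>_. M * L)) (t * L ^ ?d)" for t
    proof (induction t)
      case 0
      show ?case using chain_base[OF mpow_ideal mpow_ideal order_refl] by simp
    next
      case (Suc t)
      show ?case using ideal_chain_trans[OF Suc diag[of "M * L + t"]] by simp
    qed
    from this[of "M * L"] have "ideal_chain R (mpow (\<lambda>_. 2 * M * L)) (mpow (\<lambda>_. M * L)) (M * L * L ^ ?d)"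
      by (simp add: mult_2 add_mult_distrib)
    then have "ideal_chain R (mpow (\<lambda>_. 2 * M * L)) (carrier R) (M * L * L ^ ?d)"
      by (rule ideal_chain_up[OF _ oneideal mpow_subset])
    then have "M * L * L ^ ?d \<le> (2 * M * L) ^ ?d * h" using h unfolding length_le_def by blast
    also have "\<dots> = (2 * M) ^ ?d * h * L ^ ?d" by (simp add: power_mult_distrib)
    finally have "M * L \<le> (2 * M) ^ ?d * h" by (simp add: L_def)
    moreover have "L \<le> M * L" unfolding M_def by simp
    ultimately show False unfolding L_def by linarith
  qed
  then obtain n0 where n0: "Q n0 = mpow n0" by blast
  have "mpow n \<subseteq> W"
    if le: "n0 \<le> n" and W: "ideal W R" "\<forall>p\<in>A. \<forall>v\<in>mpow (n - \<delta> p). y p \<otimes> v \<in> W" for n W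
  proof -
    \<comment> \<open>Since \<open>J^n = J^(n - n0) J^n0\<close>, an ideal of the fibre ring that is
      full in degree \<open>n0\<close> is full in all degrees above it.\<close>
    have "mpow n = mpow (n - n0) \<cdot> Q n0" unfolding n0 mpow_add[symmetric] add_diff_multiindex[OF le] ..
    also have "\<dots> \<subseteq> Q n"
      using ideal_prod_subset[OF fibre_idealD(1)[OF Q(1)], of "mpow (n - n0)" "Q n0" n]
        fibre_idealD(4)[OF Q(1), of _ "n - n0" _ n0] add_diff_multiindex'[OF le] by simp
    also have "Q n \<subseteq> (m \<cdot> mpow n) <+>\<^bsub>R\<^esub> W"
    proof (rule Q(3))
      show "ideal ((m \<cdot> mpow n) <+>\<^bsub>R\<^esub> W) R" by (rule add_ideals[OF m_mpow_ideal W(1)])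
    qed (use sum_ideal_upper[OF m_mpow_ideal W(1)] W(2) in blast)+
    finally show "mpow n \<subseteq> W" by (rule nakayama[OF mpow_ideal W(1)])
  qed
  then show ?thesis using y by blast
qed

end

section \<open>Extended Rees algebras\<close>

context cring
begin

lemma linear_combinations_ideal:
  assumes fin: "finite A" and y: "\<And>p. p \<in> A \<Longrightarrow> y p \<in> carrier R" and V: "\<And>p. p \<in> A \<Longrightarrow> ideal (V p) R"
  shows "ideal {\<Oplus>p\<in>A. y p \<otimes> z p |z. \<forall>p\<in>A. z p \<in> V p} R" (is "ideal ?S R")
    and "p \<in> A \<Longrightarrow> v \<in> V p \<Longrightarrow> y p \<otimes> v \<in> {\<Oplus>p\<in>A. y p \<otimes> z p |z. \<forall>p\<in>A. z p \<in> V p}"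
proof -
  have zc: "z p \<in> carrier R" if "p \<in> A" "\<forall>p\<in>A. z p \<in> V p" for z p
    using that ideal_subset[OF V] by blast
  have SI: "u \<in> ?S" if "u = (\<Oplus>p\<in>A. y p \<otimes> z p)" "\<And>p. p \<in> A \<Longrightarrow> z p \<in> V p" for u z
    using that by blast
  show "ideal ?S R"
  proof (rule idealI_cring)
    show "?S \<subseteq> carrier R" using y zc by (auto intro!: finsum_closed)
    have "(\<Oplus>p\<in>A. y p \<otimes> \<zero>) = (\<Oplus>p\<in>A. \<zero>)" by (rule finsum_cong') (auto simp: y)
    then have "\<zero> = (\<Oplus>p\<in>A. y p \<otimes> \<zero>)" by simp
    then show "\<zero> \<in> ?S" by (rule SI) (rule ideal_zero[OF V])
    fix u assume "u \<in> ?S"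
    then obtain z where z: "u = (\<Oplus>p\<in>A. y p \<otimes> z p)" "\<forall>p\<in>A. z p \<in> V p" by blast
    { fix v assume "v \<in> ?S"
      then obtain z' where z': "v = (\<Oplus>p\<in>A. y p \<otimes> z' p)" "\<forall>p\<in>A. z' p \<in> V p" by blast
      have "(\<Oplus>p\<in>A. y p \<otimes> (z p \<oplus> z' p)) = (\<Oplus>p\<in>A. y p \<otimes> z p \<oplus> y p \<otimes> z' p)"
        by (rule finsum_cong') (use y zc z(2) z'(2) in \<open>auto simp: r_distr\<close>)
      also have "\<dots> = u \<oplus> v"
        unfolding z(1) z'(1) by (rule finsum_addf) (use y zc z(2) z'(2) in auto)
      finally show "u \<oplus> v \<in> ?S"
        by (intro SI[of _ "\<lambda>p. z p \<oplus> z' p"]) (use ideal_add[OF V] z(2) z'(2) in auto) }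
    fix c assume c: "c \<in> carrier R"
    have "c \<otimes> u = (\<Oplus>p\<in>A. c \<otimes> (y p \<otimes> z p))"
      unfolding z(1) by (rule finsum_rdistr[OF fin c]) (use y zc z(2) in auto)
    also have "\<dots> = (\<Oplus>p\<in>A. y p \<otimes> (c \<otimes> z p))"
      by (rule finsum_cong') (use y zc z(2) c in \<open>auto simp: m_lcomm\<close>)
    finally show "c \<otimes> u \<in> ?S"
      by (rule SI) (use ideal_lmult[OF V c] z(2) in auto)
  qed
  assume p: "p \<in> A" "v \<in> V p"
  have vc: "v \<in> carrier R" using p ideal_subset[OF V] by blast
  have "(\<Oplus>q\<in>A. y q \<otimes> (if q = p then v else \<zero>)) = (\<Oplus>q\<in>A. if p = q then y q \<otimes> v else \<zero>)"
    by (rule finsum_cong') (use y vc in auto)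
  also have "\<dots> = y p \<otimes> v" by (rule finsum_singleton) (use p fin y vc in auto)
  finally show "y p \<otimes> v \<in> ?S"
    by (intro SI[of _ "\<lambda>q. if q = p then v else \<zero>"]) (use p(2) ideal_zero[OF V] in auto)
qed

lemma laurent_ring_carrier:
  "f \<in> carrier (laurent_ring R) \<longleftrightarrow> (\<forall>n. f n \<in> carrier R) \<and> finite {n. f n \<noteq> \<zero>}"
  by (simp add: laurent_ring_def)

lemma laurent_ring_add: "(f \<oplus>\<^bsub>laurent_ring R\<^esub> g) n = f n \<oplus> g n"
  by (simp add: laurent_ring_def)

lemma laurent_ring_zero: "\<zero>\<^bsub>laurent_ring R\<^esub> n = \<zero>"
  by (simp add: laurent_ring_def)

lemma laurent_ring_mult: "(f \<otimes>\<^bsub>laurent_ring R\<^esub> g) n = (\<Oplus>k\<in>{k. f k \<noteq> \<zero>}. f k \<otimes> g (n - k))"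
  by (simp add: laurent_ring_def)

lemma laurent_ring_finsum:
  fixes h :: "'g \<Rightarrow> ('s::finite \<Rightarrow> int) \<Rightarrow> 'a"
  assumes "finite G" "\<And>g. g \<in> G \<Longrightarrow> h g \<in> carrier (laurent_ring R)"
  shows "finsum (laurent_ring R) h G n = (\<Oplus>g\<in>G. h g n)"
  using assms
proof (induction G rule: finite_induct)
  case empty
  interpret L: cring "laurent_ring R :: (('s \<Rightarrow> int) \<Rightarrow> 'a) ring" by (rule laurent_ring_cring[OF is_cring])
  show ?case by (simp add: laurent_ring_zero)
next
  case (insert g G)
  interpret L: cring "laurent_ring R :: (('s \<Rightarrow> int) \<Rightarrow> 'a) ring" by (rule laurent_ring_cring[OF is_cring])
  have hc: "h g n \<in> carrier R" "(\<lambda>g. h g n) \<in> G \<rightarrow> carrier R"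
    using insert.prems unfolding laurent_ring_carrier by auto
  have "finsum (laurent_ring R) h (insert g G) = h g \<oplus>\<^bsub>laurent_ring R\<^esub> finsum (laurent_ring R) h G"
    by (rule L.finsum_insert[OF insert.hyps]) (use insert.prems in auto)
  then show ?case using insert hc by (simp add: laurent_ring_add)
qed

lemma laurent_monom_carrier: "c \<in> carrier R \<Longrightarrow> laurent_monom R c k \<in> carrier (laurent_ring R)"
  unfolding laurent_ring_carrier laurent_monom_def by auto

end

context multi_ideals
begin

lemma multi_power_eq: "multi_power R J k = mpow (\<lambda>i. nat (k i))"
  by (simp add: multi_power_def mpow_def)

lemma laurent_mult_in_ideal:
  assumes f: "f \<in> carrier (laurent_ring R)" and W: "ideal W R" and summands: "\<And>k. f k \<otimes> g (n - k) \<in> W"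
  shows "(f \<otimes>\<^bsub>laurent_ring R\<^esub> g) n \<in> W"
  unfolding laurent_ring_mult
  by (rule finsum_in_ideal[OF W]) (use f summands in \<open>auto simp: laurent_ring_carrier\<close>)

text \<open>The bound holds for the generators and survives multiplication because positive parts
  are subadditive: \<open>k^+ \<le> l^+ + (k - l)^+\<close>, so the product of the two powers lies
  in the power for \<open>k\<close>.\<close>

lemma extended_rees_algebra_coeff:
  assumes "c \<in> extended_rees_algebra R J"
  shows "c \<in> carrier (laurent_ring R) \<and> (\<forall>k. c k \<in> multi_power R J k)"
proof -
  interpret L: cring "laurent_ring R :: (('s \<Rightarrow> int) \<Rightarrow> 'a) ring" by (rule laurent_ring_cring[OF is_cring])
  have mono: "laurent_monom R c l \<in> carrier (laurent_ring R) \<and> (\<forall>k. laurent_monom R c l k \<in> multi_power R J k)"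
    if "c \<in> mpow (\<lambda>i. nat (l i))" for c l
    using that laurent_monom_carrier mpow_subset ideal_zero[OF mpow_ideal]
    by (auto simp: multi_power_eq laurent_monom_def)
  have z: "(\<lambda>i::'s. nat (l i)) = 0" if "\<And>i. l i \<le> 0" for l using that by (simp add: fun_eq_iff)
  have u: "(\<lambda>k. nat (unit_exponent i k)) = unit_index i" for i :: 's
    by (auto simp: unit_exponent_def unit_index_def fun_eq_iff)
  show ?thesis using assms unfolding extended_rees_algebra_def
  proof (induction c rule: generate_ring.induct)
    case one
    have "\<one>\<^bsub>laurent_ring R\<^esub> = laurent_monom R \<one> (0 :: 's \<Rightarrow> int)"
      by (simp add: laurent_ring_def laurent_monom_def)
    moreover have "\<one> \<in> mpow (\<lambda>i. nat ((0 :: 's \<Rightarrow> int) i))" by (subst z) (simp_all only: mpow_0 one_closed zero_fun_apply order_refl)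
    ultimately show ?case using mono by simp
  next
    case (incl h)
    then consider c where "h = laurent_monom R c 0" "c \<in> carrier R"
      | c i where "h = laurent_monom R c (unit_exponent i)" "c \<in> J i"
      | i where "h = laurent_monom R \<one> (- unit_exponent i)" by blast
    then show ?case
    proof cases
      case 1
      have "c \<in> mpow (\<lambda>i. nat ((0 :: 's \<Rightarrow> int) i))" by (subst z) (simp_all only: mpow_0 1 zero_fun_apply order_refl)
      then show ?thesis unfolding 1(1) by (rule mono)
    next
      case (2 c i)
      show ?thesis unfolding 2(1) by (rule mono) (simp add: u mpow_unit 2(2))
    next
      case (3 i)
      have "\<one> \<in> mpow (\<lambda>k. nat ((- unit_exponent i) k))"
        by (subst z) (simp_all add: mpow_0[unfolded zero_fun_def] unit_exponent_def zero_fun_def)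
      then show ?thesis unfolding 3 by (rule mono)
    qed
  next
    case (a_inv h)
    then have h: "h \<in> carrier (laurent_ring R)" "\<And>k. h k \<in> multi_power R J k" by auto
    have "(\<ominus>\<^bsub>laurent_ring R\<^esub> h) k \<in> multi_power R J k" for k
    proof -
      have "(h \<oplus>\<^bsub>laurent_ring R\<^esub> (\<ominus>\<^bsub>laurent_ring R\<^esub> h)) k = \<zero>"
        using L.r_neg[OF h(1)] by (simp add: laurent_ring_zero)
      then have "h k \<oplus> (\<ominus>\<^bsub>laurent_ring R\<^esub> h) k \<in> multi_power R J k"
        using ideal_zero[OF mpow_ideal] by (simp add: laurent_ring_add multi_power_eq)
      moreover have "(\<ominus>\<^bsub>laurent_ring R\<^esub> h) k \<in> carrier R"
        using L.a_inv_closed[OF h(1)] unfolding laurent_ring_carrier by blast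
      ultimately show ?thesis
        using ideal_add_cancel[OF mpow_ideal] h(2)[of k] unfolding multi_power_eq by blast
    qed
    then show ?case using L.a_inv_closed[OF h(1)] by blast
  next
    case (eng_add h1 h2)
    then have "(h1 \<oplus>\<^bsub>laurent_ring R\<^esub> h2) k \<in> multi_power R J k" for k
      using ideal_add[OF mpow_ideal] unfolding laurent_ring_add multi_power_eq by blast
    then show ?case using L.a_closed eng_add by blast
  next
    case (eng_mult h1 h2)
    have "(h1 \<otimes>\<^bsub>laurent_ring R\<^esub> h2) k \<in> multi_power R J k" for k
      unfolding multi_power_eq
    proof (rule laurent_mult_in_ideal[OF _ mpow_ideal])
      show "h1 \<in> carrier (laurent_ring R)" using eng_mult by blast
      fix l
      have "h1 l \<otimes> h2 (k - l) \<in> mpow ((\<lambda>i. nat (l i)) + (\<lambda>i. nat ((k - l) i)))"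
        by (rule mpow_mult) (use eng_mult in \<open>simp_all only: multi_power_eq\<close>)
      moreover have "(\<lambda>i. nat (k i)) \<le> (\<lambda>i. nat (l i)) + (\<lambda>i. nat ((k - l) i))"
        by (rule le_funI) simp
      ultimately show "h1 l \<otimes> h2 (k - l) \<in> mpow (\<lambda>i. nat (k i))" using mpow_antimono by blast
    qed
    then show ?case using L.m_closed eng_mult by blast
  qed
qed

end

section \<open>Joint reductions of admissible families\<close>

text \<open>Expand \<open>f t^n\<close> in the finitely many module generators \<open>g\<close> and
  compare coefficients: \<open>f\<close> is a sum of products \<open>c_g(k) g(n - k)\<close> with
  \<open>c_g(k)\<close> in \<open>J^k\<close>. For large \<open>n\<close> only exponents
  \<open>k \<ge> n0\<close> occur with a nonzero factor \<open>g(n - k)\<close>. There the reduction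
  of \<open>J^k\<close> applies, and \<open>J^(k - \<delta>_p) F(n - k)\<close> lies in
  \<open>F(n - \<delta>_p)\<close>.\<close>

lemma (in multi_ideals) admissible_joint_reduction:
  fixes F :: "('s \<Rightarrow> int) \<Rightarrow> 'a set" and \<delta> :: "'p \<Rightarrow> 's \<Rightarrow> nat"
  assumes F: "\<And>n. ideal (F n) R" "\<And>n. multi_power R J n \<subseteq> F n" "\<And>n k. F n \<cdot> F k \<subseteq> F (n + k)"
    and finmod: "finite_module_over (laurent_ring R) (extended_rees_algebra R J) (extended_rees_module R F)"
    and y: "\<And>p. p \<in> A \<Longrightarrow> y p \<in> mpow (\<delta> p)" and fin: "finite A"
    and red: "\<And>n W. n0 \<le> n \<Longrightarrow> ideal W R \<Longrightarrow> \<forall>p\<in>A. \<forall>v\<in>mpow (n - \<delta> p). y p \<otimes> v \<in> W \<Longrightarrow> mpow n \<subseteq> W"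
  shows "\<exists>n1 :: 's \<Rightarrow> nat. \<forall>n :: 's \<Rightarrow> nat. n1 \<le> n \<longrightarrow>
    F (\<lambda>k. int (n k)) = {\<Oplus>p\<in>A. y p \<otimes> z p |z. \<forall>p\<in>A. z p \<in> F (\<lambda>k. int (n k) - int (\<delta> p k))}"
proof -
  interpret L: cring "laurent_ring R :: (('s \<Rightarrow> int) \<Rightarrow> 'a) ring" by (rule laurent_ring_cring[OF is_cring])
  obtain G where G: "G \<subseteq> extended_rees_module R F" "finite G"
    "extended_rees_module R F =
      {finsum (laurent_ring R) (\<lambda>g. c g \<otimes>\<^bsub>laurent_ring R\<^esub> g) G |c. c \<in> G \<rightarrow> extended_rees_algebra R J}"
    using finmod unfolding finite_module_over_def by blast
  have Gc: "g \<in> carrier (laurent_ring R)" "g k \<in> F k" if "g \<in> G" for g k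
    using G(1) that unfolding extended_rees_module_def by auto
  define D where "D = (\<Union>g\<in>G. {k. g k \<noteq> \<zero>})"
  have finD: "finite D" unfolding D_def using G(2) Gc(1) laurent_ring_carrier by blast
  \<comment> \<open>The sum over the finite joint support \<open>D\<close> of the generators
    dominates each exponent in \<open>D\<close>, so \<open>n - k \<in> D\<close> and
    \<open>n \<ge> n1\<close> give \<open>k \<ge> n0\<close>.\<close>
  define n1 where "n1 = (\<lambda>i. n0 i + (\<Sum>e\<in>D. nat (e i)))"
  have yc: "y p \<in> carrier R" if "p \<in> A" for p using y[OF that] mpow_subset by blast
  have prod: "u \<otimes> v \<in> F l" if "u \<in> F n" "v \<in> F k" "l = n + k" for u v n k l
    using F(3)[of n k] ideal_prod.prod[OF that(1,2), of R] that(3) by blast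
  have powF: "v \<in> F l" if "v \<in> mpow n" "\<And>i. n i = nat (l i)" for v n l
  proof -
    have "n = (\<lambda>i. nat (l i))" by (rule ext) (rule that(2))
    then show ?thesis using that(1) subsetD[OF F(2)[of l]] unfolding multi_power_eq by simp
  qed
  have "F (\<lambda>k. int (n k)) = {\<Oplus>p\<in>A. y p \<otimes> z p |z. \<forall>p\<in>A. z p \<in> F (\<lambda>k. int (n k) - int (\<delta> p k))}"
    (is "F ?n = ?W") if n: "n1 \<le> n" for n
  proof
    have Wid: "ideal ?W R" by (rule linear_combinations_ideal(1)[OF fin yc F(1)])
    have W: "y p \<otimes> v \<in> ?W" if "p \<in> A" "v \<in> F (\<lambda>k. int (n k) - int (\<delta> p k))" for p v
      using linear_combinations_ideal(2)[of A y "\<lambda>p. F (\<lambda>k. int (n k) - int (\<delta> p k))" p v] fin yc F(1) that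
      by simp
    show "?W \<subseteq> F ?n"
    proof
      fix u assume "u \<in> ?W"
      then obtain z where z: "u = (\<Oplus>p\<in>A. y p \<otimes> z p)" "\<forall>p\<in>A. z p \<in> F (\<lambda>k. int (n k) - int (\<delta> p k))" by blast
      show "u \<in> F ?n" unfolding z(1)
      proof (rule finsum_in_ideal[OF F(1) fin])
        fix p assume p: "p \<in> A"
        have "y p \<in> F (\<lambda>k. int (\<delta> p k))" by (rule powF[OF y[OF p]]) simp
        then show "y p \<otimes> z p \<in> F ?n" by (rule prod) (use p z(2) in \<open>auto simp: fun_eq_iff\<close>)
      qed
    qed
    show "F ?n \<subseteq> ?W"
    proof
      fix f assume f: "f \<in> F ?n"
      have fc: "f \<in> carrier R" using f ideal_subset[OF F(1)] by blast
      have "laurent_monom R f ?n \<in> extended_rees_module R F"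
        unfolding extended_rees_module_def using laurent_monom_carrier[OF fc] f ideal_zero[OF F(1)]
        by (auto simp: laurent_monom_def)
      then obtain c where c: "c \<in> G \<rightarrow> extended_rees_algebra R J"
        "laurent_monom R f ?n = finsum (laurent_ring R) (\<lambda>g. c g \<otimes>\<^bsub>laurent_ring R\<^esub> g) G"
        unfolding G(3) by blast
      have cc: "c g \<in> carrier (laurent_ring R)" "c g k \<in> multi_power R J k" if "g \<in> G" for g k
        using extended_rees_algebra_coeff c(1) that by blast+
      have "f = laurent_monom R f ?n ?n" by (simp add: laurent_monom_def)
      also have "\<dots> = (\<Oplus>g\<in>G. (c g \<otimes>\<^bsub>laurent_ring R\<^esub> g) ?n)"
        unfolding c(2) by (rule laurent_ring_finsum[OF G(2)]) (use cc(1) Gc(1) in blast)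
      also have "\<dots> \<in> ?W"
      proof (rule finsum_in_ideal[OF Wid G(2)])
        fix g assume g: "g \<in> G"
        show "(c g \<otimes>\<^bsub>laurent_ring R\<^esub> g) ?n \<in> ?W"
        proof (rule laurent_mult_in_ideal[OF cc(1)[OF g] Wid])
          fix k
          have ckc: "c g k \<in> carrier R" using cc(1)[OF g] laurent_ring_carrier by blast
          have gc: "g (?n - k) \<in> carrier R" using Gc(1)[OF g] laurent_ring_carrier by blast
          show "c g k \<otimes> g (?n - k) \<in> ?W"
          proof (cases "g (?n - k) = \<zero>")
            case True
            then show ?thesis using ckc ideal_zero[OF Wid] by simp
          next
            case False
            then have eD: "?n - k \<in> D" unfolding D_def using g by blast
            have kn: "int (n0 i) \<le> k i" for i
            proof -
              have "nat ((?n - k) i) \<le> (\<Sum>e\<in>D. nat (e i))"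
                by (rule member_le_sum[OF eD, of "\<lambda>e. nat (e i)"]) (use finD in auto)
              moreover have "n0 i + (\<Sum>e\<in>D. nat (e i)) \<le> n i" using le_funD[OF n, of i] unfolding n1_def .
              ultimately show ?thesis by simp
            qed
            define k' where "k' = (\<lambda>i. nat (k i))"
            have k': "int (k' i) = k i" for i using kn[of i] unfolding k'_def by simp
            have n0k: "n0 \<le> k'"
            proof (rule le_funI)
              fix i show "n0 i \<le> k' i" using kn[of i] k'[of i] by linarith
            qed
            \<comment> \<open>The reduction is used with the colon of the target ideal by the fixed
              coefficient \<open>g (?n - k)\<close>, which turns a statement about powers of
              \<open>J\<close> into one about products with that coefficient.\<close>
            have "mpow k' \<subseteq> colon R ?W (g (?n - k))"
            proof (rule red[OF n0k colon_ideal[OF Wid gc]], intro ballI)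
              fix p v assume p: "p \<in> A" and v: "v \<in> mpow (k' - \<delta> p)"
              have vc: "v \<in> carrier R" using v mpow_subset by blast
              have "v \<in> F (\<lambda>i. k i - int (\<delta> p i))"
              proof (rule powF[OF v])
                \<comment> \<open>Truncated subtraction of naturals is the positive part of the
                  integer difference, so both ways of treating exponents below
                  \<open>\<delta> p\<close> coincide.\<close>
                fix i show "(k' - \<delta> p) i = nat (k i - int (\<delta> p i))" using k'[of i] by simp
              qed
              then have "v \<otimes> g (?n - k) \<in> F (\<lambda>i. int (n i) - int (\<delta> p i))"
                by (rule prod[OF _ Gc(2)[OF g]]) (auto simp: fun_eq_iff)
              then have "y p \<otimes> (v \<otimes> g (?n - k)) \<in> ?W" by (rule W[OF p])
              moreover have "y p \<otimes> (v \<otimes> g (?n - k)) = g (?n - k) \<otimes> (y p \<otimes> v)"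
                using m_comm[of "g (?n - k)" "y p \<otimes> v"] m_assoc[of "y p" v "g (?n - k)"] yc[OF p] vc gc by simp
              ultimately show "y p \<otimes> v \<in> colon R ?W (g (?n - k))" using yc[OF p] vc unfolding colon_def by simp
            qed
            moreover have "c g k \<in> mpow k'" using cc(2)[OF g, of k] unfolding multi_power_eq k'_def .
            ultimately have "g (?n - k) \<otimes> c g k \<in> ?W" unfolding colon_def by blast
            then show ?thesis using m_comm[OF gc ckc] by simp
          qed
        qed
      qed
      finally show "f \<in> ?W" .
    qed
  qed
  then show ?thesis by blast
qed

lemma (in cring) graded_family_ideal: "graded_primary_family R m I \<Longrightarrow> ideal (I n) R"
  unfolding graded_primary_family_def m_primary_def primary_ideal_def
  using oneideal by (cases "n = 0") auto

theorem corollary4p7: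
  fixes R :: "('a, 'b) ring_scheme"
    and m :: "'a set"
    and d :: nat
    and I :: "'s::finite \<Rightarrow> nat \<Rightarrow> 'a set"
    and J :: "'s \<Rightarrow> 'a set"
    and r :: "'s \<Rightarrow> nat"
    and a :: "'s \<Rightarrow> nat \<Rightarrow> nat"
  assumes "noetherian_local_ring R m"
    and "krull_dim R = enat d"
    and "d \<ge> 1"
    and "\<And>i. graded_primary_family R m (I i)"
    and "infinite (carrier (R Quot m))"
    and "multigraded_admissible R m I J"
    and "(\<Sum>i\<in>UNIV. r i) = d"
    and "\<And>i j. j \<in> {1..r i} \<Longrightarrow> a i j \<ge> 1"
  shows "\<exists>y :: 's \<Rightarrow> nat \<Rightarrow> 'a.
      (\<forall>i. \<forall>j \<in> {1..r i}. y i j \<in> J i [^]\<^bsub>ideals_set R\<^esub> a i j \<and>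
         J i [^]\<^bsub>ideals_set R\<^esub> a i j \<subseteq> I i (a i j)) \<and>
      strong_homogeneous_joint_reduction R I r a y"
proof -
  have local_ring: "cring R" "noetherian_ring R" "maximalideal m R" "\<And>n. maximalideal n R \<Longrightarrow> n = m"
    using assms(1) unfolding noetherian_local_ring_def by auto
  interpret noetherian_local R m
    by (intro noetherian_local.intro noetherian_local_axioms.intro local_ring)
  have prim: "m_primary R m (J i)" for i using assms(6) unfolding multigraded_admissible_def by blast
  have Jid: "ideal (J i) R" for i using prim unfolding m_primary_def primary_ideal_def by blast
  have rad: "\<forall>i. \<forall>c\<in>m. \<exists>k::nat. c [^]\<^bsub>R\<^esub> k \<in> J i"
    using prim unfolding m_primary_def radical_def by blast
  have Jm: "J i \<subseteq> m" for i
  proof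
    fix x assume x: "x \<in> J i"
    then have "x \<in> carrier R" using ideal_subset[OF Jid] by blast
    then have "x [^]\<^bsub>R\<^esub> (1::nat) \<in> J i" using x by simp
    then have "x \<in> radical R (J i)" unfolding radical_def using \<open>x \<in> carrier R\<close> by blast
    then show "x \<in> m" using prim[of i] unfolding m_primary_def by blast
  qed
  interpret multi_ideals R m J by (intro multi_ideals.intro multi_ideals_axioms.intro noetherian_local_axioms Jid Jm)
  let ?F = "multi_filtration R I"
  have Iid: "I i n \<in> carrier (ideals_set R)" for i n
    using graded_family_ideal[OF assms(4)] by (simp add: ideals_set_simps)
  have Fid: "ideal (?F n) R" for n
  proof -
    have "?F n \<in> carrier (ideals_set R)"
      unfolding multi_filtration_def by (rule ideals.finprod_closed) (simp add: Iid)
    then show ?thesis by (simp add: ideals_set_simps)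
  qed
  have powF: "multi_power R J n \<subseteq> ?F n" and prodF: "?F n \<cdot>\<^bsub>R\<^esub> ?F k \<subseteq> ?F (n + k)" for n k
    using assms(6) unfolding multigraded_admissible_def by blast+
  have finmod: "finite_module_over (laurent_ring R) (extended_rees_algebra R J) (extended_rees_module R ?F)"
    using assms(6) unfolding multigraded_admissible_def by blast
  \<comment> \<open>The first admissibility condition, read off at the exponent
    \<open>l e_i\<close>; all other factors of the filtration are the unit ideal there.\<close>
  have JI: "J i [^]\<^bsub>ideals_set R\<^esub> l \<subseteq> I i l" for i l
  proof -
    have I0: "I j 0 = \<one>\<^bsub>ideals_set R\<^esub>" for j
      using assms(4)[of j] unfolding graded_primary_family_def by (simp add: ideals_set_simps)
    let ?n = "\<lambda>j. if j = i then int l else 0"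
    have "?F ?n = finprod (ideals_set R) (\<lambda>j. if i = j then I j l else \<one>\<^bsub>ideals_set R\<^esub>) UNIV"
      unfolding multi_filtration_def by (rule ideals.finprod_cong') (auto simp: I0 Iid)
    also have "\<dots> = I i l" by (rule ideals.finprod_singleton) (auto simp: Iid)
    finally have "?F ?n = I i l" .
    moreover have "(\<lambda>j. nat (?n j)) = (\<lambda>j. if j = i then l else 0)" by auto
    then have "multi_power R J ?n = J i [^]\<^bsub>ideals_set R\<^esub> l" unfolding multi_power_eq by (simp only: mpow_single)
    ultimately show ?thesis using powF[of ?n] by simp
  qed
  let ?A = "SIGMA i:UNIV. {1..r i}"
  \<comment> \<open>The pair \<open>(i, j)\<close> receives the degree \<open>a_ij e_i\<close>.
    There are \<open>r_1 + ... + r_s = d\<close> such pairs, so the number of elements equals the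
    dimension.\<close>
  define \<delta> where "\<delta> = (\<lambda>p k. if k = fst p then a (fst p) (snd p) else 0)"
  have finA: "finite ?A" by simp
  have "krull_dim R = enat (card ?A)" using assms(2,7) by simp
  from ex_joint_reduction[OF assms(5) this rad finA, of \<delta>]
  obtain y n0 where y: "\<forall>p\<in>?A. y p \<in> mpow (\<delta> p)"
    and *: "\<forall>n W. n0 \<le> n \<longrightarrow> ideal W R \<longrightarrow> (\<forall>p\<in>?A. \<forall>v\<in>mpow (n - \<delta> p). y p \<otimes>\<^bsub>R\<^esub> v \<in> W) \<longrightarrow> mpow n \<subseteq> W"
    by (elim exE conjE)
  have red: "mpow n \<subseteq> W"
    if "n0 \<le> n" "ideal W R" "\<forall>p\<in>?A. \<forall>v\<in>mpow (n - \<delta> p). y p \<otimes>\<^bsub>R\<^esub> v \<in> W" for n W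
    by (rule mp[OF mp[OF mp[OF spec[OF spec[OF *]] that(1)] that(2)] that(3)])
  have "\<exists>n1 :: 's \<Rightarrow> nat. \<forall>n. n1 \<le> n \<longrightarrow> ?F (\<lambda>k. int (n k)) =
    {\<Oplus>\<^bsub>R\<^esub>p\<in>?A. y p \<otimes>\<^bsub>R\<^esub> z p |z. \<forall>p\<in>?A. z p \<in> ?F (\<lambda>k. int (n k) - int (\<delta> p k))}"
    by (rule admissible_joint_reduction[OF Fid powF prodF finmod bspec[OF y] finA]) (assumption, rule red)
  then obtain n1 :: "'s \<Rightarrow> nat" where n1: "\<forall>n. n1 \<le> n \<longrightarrow> ?F (\<lambda>k. int (n k)) =
    {\<Oplus>\<^bsub>R\<^esub>p\<in>?A. y p \<otimes>\<^bsub>R\<^esub> z p |z. \<forall>p\<in>?A. z p \<in> ?F (\<lambda>k. int (n k) - int (\<delta> p k))}"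
    by (elim exE)
  have yJ: "y (i, j) \<in> J i [^]\<^bsub>ideals_set R\<^esub> a i j" if "j \<in> {1..r i}" for i j
    using bspec[OF y, of "(i, j)"] that by (simp add: \<delta>_def mpow_single)
  have deg: "(\<lambda>k. int (n k) - int (\<delta> (i, j) k)) = (\<lambda>k. int (n k) - int (a i j) * unit_exponent i k)" for n i j
    by (auto simp: \<delta>_def unit_exponent_def fun_eq_iff)
  have "strong_homogeneous_joint_reduction R I r a (\<lambda>i j. y (i, j))"
    unfolding strong_homogeneous_joint_reduction_def
  proof (intro conjI exI[of _ n1] allI impI ballI)
    show "a i j \<ge> 1" if "j \<in> {1..r i}" for i j using assms(8) that .
    show "y (i, j) \<in> I i (a i j)" if "j \<in> {1..r i}" for i j using yJ[OF that] JI by blast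
    fix n assume n: "n1 \<le> n"
    let ?f = "\<lambda>z. \<Oplus>\<^bsub>R\<^esub>p\<in>?A. y p \<otimes>\<^bsub>R\<^esub> z p"
    let ?g = "\<lambda>z. finsum R (\<lambda>(i, j). y (i, j) \<otimes>\<^bsub>R\<^esub> z i j) ?A"
    \<comment> \<open>Coefficients indexed by pairs and curried coefficients give the same sums; the
      two set inclusions below translate one into the other.\<close>
    have fg: "?f z = ?g (\<lambda>i j. z (i, j))" for z by (simp add: case_prod_unfold)
    have gf: "?g z = ?f (\<lambda>p. z (fst p) (snd p))" for z by (simp add: case_prod_unfold)
    show "?F (\<lambda>k. int (n k)) = {?g z |z. \<forall>i. \<forall>j\<in>{1..r i}.
        z i j \<in> ?F (\<lambda>k. int (n k) - int (a i j) * unit_exponent i k)}" (is "_ = ?X")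
      unfolding mp[OF spec[OF n1] n]
    proof (intro subset_antisym subsetI)
      fix u assume "u \<in> {?f z |z. \<forall>p\<in>?A. z p \<in> ?F (\<lambda>k. int (n k) - int (\<delta> p k))}"
      then obtain z where z: "u = ?f z" "\<forall>p\<in>?A. z p \<in> ?F (\<lambda>k. int (n k) - int (\<delta> p k))" by blast
      have *: "\<forall>i. \<forall>j\<in>{1..r i}. z (i, j) \<in> ?F (\<lambda>k. int (n k) - int (a i j) * unit_exponent i k)"
        using z(2) unfolding deg[symmetric] by blast
      show "u \<in> ?X"
        unfolding z(1) fg by (intro CollectI exI[of _ "\<lambda>i j. z (i, j)"] conjI refl) (rule *)
    next
      fix u assume "u \<in> ?X"
      then obtain z where z: "u = ?g z"
        "\<forall>i. \<forall>j\<in>{1..r i}. z i j \<in> ?F (\<lambda>k. int (n k) - int (a i j) * unit_exponent i k)" by blast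
      have *: "\<forall>p\<in>?A. z (fst p) (snd p) \<in> ?F (\<lambda>k. int (n k) - int (\<delta> p k))"
        using z(2) unfolding deg[symmetric] by auto
      show "u \<in> {?f z |z. \<forall>p\<in>?A. z p \<in> ?F (\<lambda>k. int (n k) - int (\<delta> p k))}"
        unfolding z(1) gf by (intro CollectI exI[of _ "\<lambda>p. z (fst p) (snd p)"] conjI refl) (rule *)
    qed
  qed
  then show ?thesis using yJ JI by (intro exI[of _ "\<lambda>i j. y (i, j)"]) blast
qed

end
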